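(* Let $\alpha\in(0,1]$, $\mathbb T^{A}\in\mathcal T_\alpha$ be arbitrary and $t_0\ge0$. Then $\mathbb T^{G(t_0)},\mathbb T^{G(t_0+1)}\in\mathcal T_\alpha$, and under model $\mathcal M_{\mathrm s}$, for all $t=1,2,\dots$, $$\mathbb E\big(\mathrm U_t(\mathbb T^{A})\big)\le\mathbb E\big(\mathrm U_t(\mathbb T^{G(t_0+1)})\big)\le\mathbb E\big(\mathrm U_t(\mathbb T^{G(t_0)})\big)\le\mathbb E\big(\mathrm U_t(\mathbb T^* )\big).$$
   Context: There are $K\ge1$ data streams. Each stream $k$ has a change point $\tau_k\in\{0,1,2,\dots\}\cup\{\infty\}$. Observations $X_{k,t}$ ($1\le k\le K$, $t=1,2,\dots$) are, conditionally on $(\tau_1,\dots,\tau_K)$, independent over $k$ and $t$, with $X_{k,t}$ having density $p_{k,t}$ if $t\le\tau_k$ and $q_{k,t}$ if $t>\tau_k$ with respect to a baseline measure $\mu$. Model $\mathcal M_{\mathrm s}$: $\tau_1,\dots,\tau_K$ are i.i.d. with $\mathbb P(\tau_k=m)=\theta(1-\theta)^m$, $m=0,1,2,\dots$, for some $\theta\in(0,1)$, and $p_{k,t}=p$, $q_{k,t}=q$ for all $k,t$. A compound sequential detection procedure consists of index sets $S_1=\{1,\dots,K\}\supseteq S_2\supseteq\cdots$ and a filtration defined inductively by $\mathcal F_1=\sigma(X_{k,1}:1\le k\le K)$ and $\mathcal F_t=\sigma(\mathcal F_{t-1},S_t,X_{k,t}:k\in S_t)$ for $t>1$, where $S_t$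 is required to be $\mathcal F_{t-1}$-measurable. $\mathcal T$ is the set of all such procedures. For $t\ge1$, $\mathrm{FNP}_{t+1}(\mathbb T)=\sum_{k\in S_{t+1}}\mathbf 1(\tau_k<t)/(|S_{t+1}|\vee1)$, $\mathrm{LFNR}_{t+1}(\mathbb T)=\mathbb E(\mathrm{FNP}_{t+1}(\mathbb T)\mid\mathcal F_t)$, $\mathrm{LFNR}_1(\mathbb T)=0$. $\mathcal T_\alpha=\{\mathbb T\in\mathcal T:\mathrm{LFNR}_t(\mathbb T)\le\alpha\text{ a.s. for all }t\ge1\}$. Stream utilization: $\mathrm U_t(\mathbb T)=\sum_{s=1}^t|S_s|$. Posterior probabilities: $W_{k,t}=\mathbb P(\tau_k<t\mid\mathcal F_t)$. One-step update rule: given $\alpha$, $S_t$ and $(W_{k,t})_{k\in S_t}$, write $S_t=\{k_1,\dots,k_m\}$ ordered so that $W_{k_1,t}\le\cdots\le W_{k_m,t}$, ties broken so that $k_i<k_{i+1}$ when $W_{k_i,t}=W_{k_{i+1},t}$; set $R_0=0$ and $R_n=\frac1n\sum_{i=1}^nW_{k_i,t}$; let $n$ be the largest element of $\{0,\dots,m\}$ with $R_n\le\alpha$; output $S_{t+1}=\{k_1,\dots,k_n\}$ ($\emptyset$ if $n=0$). The proposed procedure $\mathbb T^*$: $S_1=\{1,\dots,K\}$ and, for every $t\ge1$, $S_{t+1}$ is the output of the one-step rule applied to $S_t$ and $(W_{k,t})_{k\in S_t}$. Switching procedure: for $\mathbb T^A\in\mathcal T_\alpha$ with active sets $S^A_t$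 and $t_0\ge0$, $\mathbb T^{G(t_0)}$ is the procedure with $S^{G(t_0)}_t=S^A_t$ for $1\le t\le t_0$ and, for every $t\ge\max(t_0,1)$, $S^{G(t_0)}_{t+1}$ equal to the output of the one-step rule applied to $S^{G(t_0)}_t$ and its own posteriors $W^{G(t_0)}_{k,t}=\mathbb P(\tau_k<t\mid\mathcal F^{G(t_0)}_t)$. In particular $\mathbb T^{G(0)}=\mathbb T^*$. *)

theory Defs
  imports "HOL-Probability.Probability"
begin

(* Streams are indexed by {1..K}; time by t = 1,2,...
   M   : underlying probability space,  N : observation space with baseline measure mu
   tau k : change point of stream k (enat, \<infinity> = no change)
   X k t : observation of stream k at time t
   S t   : active set at time t (S 0 is irrelevant) *)

text \<open>The model: conditionally on the change points (which take countably many values),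
  the observations are independent, X k t having density p k t if t \<le> tau k and q k t
  otherwise (with respect to N).  The joint law of the change points is arbitrary.\<close>

definition cp_model ::
  "'w measure \<Rightarrow> 'x measure \<Rightarrow> nat \<Rightarrow> (nat \<Rightarrow> 'w \<Rightarrow> enat) \<Rightarrow> (nat \<Rightarrow> nat \<Rightarrow> 'w \<Rightarrow> 'x)
   \<Rightarrow> (nat \<Rightarrow> nat \<Rightarrow> 'x \<Rightarrow> real) \<Rightarrow> (nat \<Rightarrow> nat \<Rightarrow> 'x \<Rightarrow> real) \<Rightarrow> bool" where
  "cp_model M N K \<tau> X p q \<longleftrightarrow>
     prob_space M \<and> K \<ge> 1 \<and>
     (\<forall>k\<in>{1..K}. \<tau> k \<in> measurable M (count_space UNIV)) \<and>
     (\<forall>k\<in>{1..K}. \<forall>t\<ge>1. X k t \<in> measurable M N) \<and>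
     (\<forall>k\<in>{1..K}. \<forall>t\<ge>1.
        p k t \<in> borel_measurable N \<and> (\<forall>x\<in>space N. p k t x \<ge> 0) \<and>
        (\<integral>\<^sup>+ x. ennreal (p k t x) \<partial>N) = 1 \<and>
        q k t \<in> borel_measurable N \<and> (\<forall>x\<in>space N. q k t x \<ge> 0) \<and>
        (\<integral>\<^sup>+ x. ennreal (q k t x) \<partial>N) = 1) \<and>
     (\<forall>(v :: nat \<Rightarrow> enat) (F :: (nat \<times> nat) set) (B :: nat \<times> nat \<Rightarrow> 'x set).
        finite F \<longrightarrow> F \<subseteq> {1..K} \<times> {1..} \<longrightarrow> (\<forall>kt\<in>F. B kt \<in> sets N) \<longrightarrow>
        measure M {\<omega>\<in>space M. (\<forall>k\<in>{1..K}. \<tau> k \<omega> = v k) \<and>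
                                (\<forall>(k,t)\<in>F. X k t \<omega> \<in> B (k,t))}
        = measure M {\<omega>\<in>space M. \<forall>k\<in>{1..K}. \<tau> k \<omega> = v k} *
          (\<Prod>(k,t)\<in>F. measure (density N (\<lambda>x. ennreal
              (if enat t \<le> v k then p k t x else q k t x))) (B (k,t))))"

definition model_s ::
  "'w measure \<Rightarrow> nat \<Rightarrow> (nat \<Rightarrow> 'w \<Rightarrow> enat)
   \<Rightarrow> (nat \<Rightarrow> nat \<Rightarrow> 'x \<Rightarrow> real) \<Rightarrow> (nat \<Rightarrow> nat \<Rightarrow> 'x \<Rightarrow> real)
   \<Rightarrow> real \<Rightarrow> ('x \<Rightarrow> real) \<Rightarrow> ('x \<Rightarrow> real) \<Rightarrow> bool" where
  "model_s M K \<tau> p q \<theta> p0 q0 \<longleftrightarrow>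
     0 < \<theta> \<and> \<theta> < 1 \<and>
     (\<forall>v :: nat \<Rightarrow> nat.
        measure M {\<omega>\<in>space M. \<forall>k\<in>{1..K}. \<tau> k \<omega> = enat (v k)}
        = (\<Prod>k\<in>{1..K}. \<theta> * (1 - \<theta>) ^ v k)) \<and>
     (\<forall>k\<in>{1..K}. \<forall>t\<ge>1. p k t = p0 \<and> q k t = q0)"

definition filt_gen ::
  "'w measure \<Rightarrow> 'x measure \<Rightarrow> (nat \<Rightarrow> nat \<Rightarrow> 'w \<Rightarrow> 'x) \<Rightarrow> (nat \<Rightarrow> 'w \<Rightarrow> nat set)
   \<Rightarrow> nat \<Rightarrow> 'w set set" where
  "filt_gen M N X S t =
     {{\<omega>\<in>space M. S s \<omega> = A} | s A. 1 \<le> s \<and> s \<le> t} \<union>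
     {{\<omega>\<in>space M. k \<in> S s \<omega> \<and> X k s \<omega> \<in> B} | s k B. 1 \<le> s \<and> s \<le> t \<and> B \<in> sets N}"

definition filt ::
  "'w measure \<Rightarrow> 'x measure \<Rightarrow> (nat \<Rightarrow> nat \<Rightarrow> 'w \<Rightarrow> 'x) \<Rightarrow> (nat \<Rightarrow> 'w \<Rightarrow> nat set)
   \<Rightarrow> nat \<Rightarrow> 'w measure" where
  "filt M N X S t = sigma (space M) (filt_gen M N X S t)"

definition is_proc ::
  "'w measure \<Rightarrow> 'x measure \<Rightarrow> nat \<Rightarrow> (nat \<Rightarrow> nat \<Rightarrow> 'w \<Rightarrow> 'x) \<Rightarrow> (nat \<Rightarrow> 'w \<Rightarrow> nat set) \<Rightarrow> bool" where
  "is_proc M N K X S \<longleftrightarrow>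
     (\<forall>\<omega>\<in>space M. S 1 \<omega> = {1..K}) \<and>
     (\<forall>t\<ge>1. \<forall>\<omega>\<in>space M. S (Suc t) \<omega> \<subseteq> S t \<omega>) \<and>
     (\<forall>t\<ge>1. \<forall>A. {\<omega>\<in>space M. S (Suc t) \<omega> = A} \<in> sets (filt M N X S t))"

text \<open>False non-discovery proportion FNP_{t+1}, for t \<ge> 1.\<close>

definition FNP :: "(nat \<Rightarrow> 'w \<Rightarrow> enat) \<Rightarrow> (nat \<Rightarrow> 'w \<Rightarrow> nat set) \<Rightarrow> nat \<Rightarrow> 'w \<Rightarrow> real" where
  "FNP \<tau> S t \<omega> =
     (\<Sum>k\<in>S (Suc t) \<omega>. if \<tau> k \<omega> < enat t then 1 else 0) / real (max (card (S (Suc t) \<omega>)) 1)"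

text \<open>LFNR_{t+1} = E(FNP_{t+1} | F_t), for t \<ge> 1.\<close>

definition LFNR ::
  "'w measure \<Rightarrow> 'x measure \<Rightarrow> (nat \<Rightarrow> 'w \<Rightarrow> enat) \<Rightarrow> (nat \<Rightarrow> nat \<Rightarrow> 'w \<Rightarrow> 'x)
   \<Rightarrow> (nat \<Rightarrow> 'w \<Rightarrow> nat set) \<Rightarrow> nat \<Rightarrow> 'w \<Rightarrow> real" where
  "LFNR M N \<tau> X S t = real_cond_exp M (filt M N X S t) (FNP \<tau> S t)"

text \<open>The class \<T>_alpha (LFNR_1 = 0 \<le> alpha holds trivially).\<close>

definition in_T_alpha ::
  "'w measure \<Rightarrow> 'x measure \<Rightarrow> nat \<Rightarrow> (nat \<Rightarrow> 'w \<Rightarrow> enat) \<Rightarrow> (nat \<Rightarrow> nat \<Rightarrow> 'w \<Rightarrow> 'x)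
   \<Rightarrow> real \<Rightarrow> (nat \<Rightarrow> 'w \<Rightarrow> nat set) \<Rightarrow> bool" where
  "in_T_alpha M N K \<tau> X \<alpha> S \<longleftrightarrow>
     is_proc M N K X S \<and> (\<forall>t\<ge>1. AE \<omega> in M. LFNR M N \<tau> X S t \<omega> \<le> \<alpha>)"

definition W ::
  "'w measure \<Rightarrow> 'x measure \<Rightarrow> (nat \<Rightarrow> 'w \<Rightarrow> enat) \<Rightarrow> (nat \<Rightarrow> nat \<Rightarrow> 'w \<Rightarrow> 'x)
   \<Rightarrow> (nat \<Rightarrow> 'w \<Rightarrow> nat set) \<Rightarrow> nat \<Rightarrow> nat \<Rightarrow> 'w \<Rightarrow> real" where
  "W M N \<tau> X S k t = real_cond_exp M (filt M N X S t)
      (indicator {\<omega>\<in>space M. \<tau> k \<omega> < enat t})"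

definition onestep :: "real \<Rightarrow> nat set \<Rightarrow> (nat \<Rightarrow> real) \<Rightarrow> nat set" where
  "onestep \<alpha> S w =
     (let ks = (THE ks. set ks = S \<and> distinct ks \<and>
                  sorted_wrt (\<lambda>i j. w i < w j \<or> (w i = w j \<and> i < j)) ks);
          R = (\<lambda>n. if n = 0 then 0 else (\<Sum>i<n. w (ks ! i)) / real n);
          n = (GREATEST n. n \<le> length ks \<and> R n \<le> \<alpha>)
      in set (take n ks))"

text \<open>Switching procedure T^{G(t0)} built from S^A.  Posteriors are conditional expectations,
  determined only almost surely; the update rule is therefore required almost surely.\<close>

definition is_switching ::
  "'w measure \<Rightarrow> 'x measure \<Rightarrow> nat \<Rightarrow> (nat \<Rightarrow> 'w \<Rightarrow> enat) \<Rightarrow> (nat \<Rightarrow> nat \<Rightarrow> 'w \<Rightarrow> 'x)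
   \<Rightarrow> real \<Rightarrow> (nat \<Rightarrow> 'w \<Rightarrow> nat set) \<Rightarrow> nat \<Rightarrow> (nat \<Rightarrow> 'w \<Rightarrow> nat set) \<Rightarrow> bool" where
  "is_switching M N K \<tau> X \<alpha> SA t0 S \<longleftrightarrow>
     is_proc M N K X S \<and>
     (\<forall>t. 1 \<le> t \<and> t \<le> t0 \<longrightarrow> (\<forall>\<omega>\<in>space M. S t \<omega> = SA t \<omega>)) \<and>
     (\<forall>t\<ge>max t0 1. AE \<omega> in M.
        S (Suc t) \<omega> = onestep \<alpha> (S t \<omega>) (\<lambda>k. W M N \<tau> X S k t \<omega>))"

definition is_Tstar ::
  "'w measure \<Rightarrow> 'x measure \<Rightarrow> nat \<Rightarrow> (nat \<Rightarrow> 'w \<Rightarrow> enat) \<Rightarrow> (nat \<Rightarrow> nat \<Rightarrow> 'w \<Rightarrow> 'x)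
   \<Rightarrow> real \<Rightarrow> (nat \<Rightarrow> 'w \<Rightarrow> nat set) \<Rightarrow> bool" where
  "is_Tstar M N K \<tau> X \<alpha> S \<longleftrightarrow>
     is_proc M N K X S \<and>
     (\<forall>t\<ge>1. AE \<omega> in M.
        S (Suc t) \<omega> = onestep \<alpha> (S t \<omega>) (\<lambda>k. W M N \<tau> X S k t \<omega>))"

definition EU :: "'w measure \<Rightarrow> (nat \<Rightarrow> 'w \<Rightarrow> nat set) \<Rightarrow> nat \<Rightarrow> real" where
  "EU M S t = (\<integral>\<omega>. (\<Sum>s\<in>{1..t}. real (card (S s \<omega>))) \<partial>M)"

end

(* The expected utilization is compared through a value function. If the posteriors of the active
   streams at time s are v, let val n A v be the largest expected utilization that can be collected
   in the next n steps from the active set A, when at each step any subset with average posterior at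
   most alpha may be kept. By induction on n, val increases when the active set is mapped injectively
   into another one with smaller posteriors: a smaller posterior makes the next posterior
   stochastically smaller, because the update is monotone both in the prior and in the likelihood
   ratio. The one-step rule keeps a set into which every feasible subset embeds in this way, so it
   attains the maximum. Hence E(U_s + val (t - s)) is nonincreasing in s for every procedure in the
   class and constant along the steps of the one-step rule. For a switching procedure its value at
   s = t is therefore its value for the original procedure at the switching time, and the three
   inequalities compare the values of one nonincreasing sequence at different times.
   The law of the next posteriors is computed given all observations up to time s, also those of
   deactivated streams; by independence this does not change the posterior of an active stream. *)

theory Submission
  imports Defs
begin

section \<open>The one-step rule\<close>

text \<open>The value function maximizes over fixed subsets, not over procedures. It therefore
  depends only on the active set and its posteriors, and no measurable selection of an optimal set
  is needed: the one-step rule supplies the maximizer. The delicate point is monotonicity. Raising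
  one posterior changes both the updated value and the law of the observation that drives the
  update, so a pointwise comparison is not enough; \<open>expect_one_antimono\<close> adds the
  comparison of laws. Two facts let a computation on the fixed grid of all observations serve every
  procedure. Active sets decrease, so an active stream has been observed at every earlier time and
  its posterior is a function of known data. The next active set is chosen from data up to time s,
  so each of its values is taken on an event of that grid. Integrals are taken in
  \<open>ennreal\<close>, where exchanging them needs no integrability. The membership claims use
  only conditional expectations and are proved for any law of the change points.\<close>

lemma sorted_wrt_unique:
  assumes "\<And>a b. R a b \<Longrightarrow> \<not> R b a"
    and "sorted_wrt R xs" "sorted_wrt R ys" "set xs = set ys"
  shows "xs = ys"
  using assms(2-)
proof (induction xs arbitrary: ys)
  case Nil
  then show ?case by simp
next
  case (Cons x xs)
  then obtain y ys' where ys: "ys = y # ys'" by (cases ys) auto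
  have xy: "x = y"
  proof (rule ccontr)
    assume "x \<noteq> y"
    then have "x \<in> set ys'" "y \<in> set xs" using Cons.prems ys by auto
    then have "R y x" "R x y" using Cons.prems ys by auto
    then show False using assms(1) by blast
  qed
  have irr: "\<not> R a a" for a using assms(1) by blast
  have "x \<notin> set xs" "x \<notin> set ys'" using Cons.prems ys xy irr by auto
  then have "set xs = set ys'" using Cons.prems ys xy by auto
  then show ?case using Cons.IH[of ys'] Cons.prems ys xy by simp
qed

text \<open>Together with \<open>sorted_wrt_unique\<close> this turns the definite description in
  \<open>onestep\<close> into an actual list. A new element is put between its predecessors and its
  successors.\<close>

lemma sorted_wrt_exists:
  assumes "finite S"
    and "\<And>a b c. R a b \<Longrightarrow> R b c \<Longrightarrow> R a c"
    and "\<And>a b. a \<noteq> b \<Longrightarrow> R a b \<or> R b a"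
    and "\<And>a. \<not> R a a"
  shows "\<exists>ks. set ks = S \<and> distinct ks \<and> sorted_wrt R ks"
  using assms(1)
proof induction
  case empty
  show ?case by (intro exI[of _ "[]"]) simp
next
  case (insert x F)
  then obtain ks where ks: "set ks = F" "distinct ks" "sorted_wrt R ks" by blast
  let ?ks = "filter (\<lambda>y. R y x) ks @ x # filter (\<lambda>y. R x y) ks"
  have "set ?ks = insert x F" using ks(1) insert(2) assms(3) by auto
  moreover have "distinct ?ks"
    using ks insert(2) assms(2,4) by (auto simp: distinct_filter)
  moreover have "sorted_wrt R ?ks"
    using ks assms(2) by (auto simp: sorted_wrt_append intro: sorted_wrt_filter)
  ultimately show ?case by blast
qed

text \<open>Elements of \<open>B\<close> already in \<open>T\<close> stay; the others go injectively
  into \<open>T - B\<close>, which is large enough because \<open>card B \<le> card T\<close>. A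
  moved element leaves the complement of \<open>T\<close> for \<open>T\<close>, where the weights
  are no larger.\<close>

lemma exchange_injection:
  fixes w :: "nat \<Rightarrow> real"
  assumes "finite S" "T \<subseteq> S" "B \<subseteq> S" "card B \<le> card T"
    and low: "\<And>i j. i \<in> T \<Longrightarrow> j \<in> S - T \<Longrightarrow> w i \<le> w j"
  obtains \<sigma> where "inj_on \<sigma> B" "\<sigma> ` B \<subseteq> T" "\<And>i. i \<in> B \<Longrightarrow> w (\<sigma> i) \<le> w i"
proof -
  have fin: "finite B" "finite T" using assms finite_subset by blast+
  have "card (B - T) \<le> card (T - B)"
    using assms(4) card_le_sym_Diff[OF fin] by blast
  then obtain f where f: "inj_on f (B - T)" "f ` (B - T) \<subseteq> T - B"
    using card_le_inj[of "B - T" "T - B"] fin by auto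
  define \<sigma> where "\<sigma> i = (if i \<in> T then i else f i)" for i
  have "inj_on \<sigma> B"
  proof (rule inj_onI)
    fix i j assume ij: "i \<in> B" "j \<in> B" "\<sigma> i = \<sigma> j"
    have *: "f k \<notin> B" if "k \<in> B" "k \<notin> T" for k using that f(2) by blast
    show "i = j"
      using ij *[of i] *[of j] inj_onD[OF f(1), of i j] unfolding \<sigma>_def
      by (cases "i \<in> T"; cases "j \<in> T") auto
  qed
  moreover have "\<sigma> ` B \<subseteq> T" using f(2) unfolding \<sigma>_def by (auto simp: image_subset_iff)
  moreover have "w (\<sigma> i) \<le> w i" if "i \<in> B" for i
  proof (cases "i \<in> T")
    case False
    then have "f i \<in> T" "i \<in> S - T" using f(2) that assms(3) by auto
    then show ?thesis using low False by (simp add: \<sigma>_def)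
  qed (simp add: \<sigma>_def)
  ultimately show ?thesis using that by blast
qed

text \<open>All that later proofs use about the rule: it keeps a prefix of a list sorted by weight,
  the prefix is feasible, and no longer prefix is.\<close>

lemma onestep_initial_segment:
  assumes "finite S"
  obtains ks N where "set ks = S" "distinct ks" "N \<le> length ks"
    "onestep \<alpha> S w = set (take N ks)"
    "\<And>n i j. i \<in> set (take n ks) \<Longrightarrow> j \<in> S - set (take n ks) \<Longrightarrow> w i \<le> w j"
    "0 \<le> \<alpha> \<Longrightarrow> (\<Sum>i\<in>set (take N ks). w i) \<le> \<alpha> * real N"
    "\<And>n. n \<le> length ks \<Longrightarrow> (\<Sum>i\<in>set (take n ks). w i) \<le> \<alpha> * real n \<Longrightarrow> 0 \<le> \<alpha> \<Longrightarrow> n \<le> N"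
proof -
  define R where "R i j \<longleftrightarrow> w i < w j \<or> (w i = w j \<and> i < j)" for i j :: nat
  obtain ks where ks: "set ks = S" "distinct ks" "sorted_wrt R ks"
  proof -
    have "\<exists>ks. set ks = S \<and> distinct ks \<and> sorted_wrt R ks"
      by (rule sorted_wrt_exists[OF assms]) (auto simp: R_def)
    then show ?thesis using that by blast
  qed
  have the: "(THE ks. set ks = S \<and> distinct ks \<and>
      sorted_wrt (\<lambda>i j. w i < w j \<or> (w i = w j \<and> i < j)) ks) = ks"
  proof (rule the_equality)
    show "set ks = S \<and> distinct ks \<and> sorted_wrt (\<lambda>i j. w i < w j \<or> (w i = w j \<and> i < j)) ks"
      using ks unfolding R_def by simp
    fix ys assume ys: "set ys = S \<and> distinct ys \<and>
      sorted_wrt (\<lambda>i j. w i < w j \<or> (w i = w j \<and> i < j)) ys"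
    then have "sorted_wrt R ys" "set ys = set ks" using ks(1) by (auto simp: R_def[abs_def])
    then show "ys = ks"
      by (intro sorted_wrt_unique[OF _ _ ks(3)]) (auto simp: R_def)
  qed
  define Q where "Q n \<longleftrightarrow> n \<le> length ks \<and>
    (if n = 0 then 0 else (\<Sum>i<n. w (ks ! i)) / real n) \<le> \<alpha>" for n :: nat
  define N where "N = (GREATEST n. Q n)"
  have one: "onestep \<alpha> S w = set (take N ks)"
    unfolding onestep_def the Let_def N_def Q_def by (simp only:)
  have sums: "(\<Sum>i\<in>set (take n ks). w i) = (\<Sum>i<n. w (ks ! i))" if "n \<le> length ks" for n
  proof -
    have "(\<Sum>i\<in>set (take n ks). w i) = sum_list (map w (take n ks))"
      by (rule sum_list_distinct_conv_sum_set[symmetric]) (simp add: ks)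
    also have "\<dots> = (\<Sum>i<n. w (ks ! i))"
      using that by (simp add: sum_list_sum_nth atLeast0LessThan min_def)
    finally show ?thesis .
  qed
  have Q_iff: "Q n \<longleftrightarrow> (\<Sum>i\<in>set (take n ks). w i) \<le> \<alpha> * real n"
    if "n \<le> length ks" "0 \<le> \<alpha>" for n
    using that sums[OF that(1)] unfolding Q_def by (auto simp: field_simps)
  have Q0: "Q 0" if "0 \<le> \<alpha>" using that by (simp add: Q_def)
  have bnd: "Q n \<Longrightarrow> n \<le> length ks" for n by (simp add: Q_def)
  have QN: "Q N" if "0 \<le> \<alpha>"
    unfolding N_def using Q0[OF that] bnd by (rule GreatestI_nat)
  have low: "w i \<le> w j" if "i \<in> set (take n ks)" "j \<in> S - set (take n ks)" for n i j
  proof -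
    have "j \<in> set (drop n ks)" using that ks(1) by (metis DiffE Un_iff append_take_drop_id set_append)
    moreover have "sorted_wrt R (take n ks @ drop n ks)" using ks(3) by simp
    ultimately have "R i j" using that(1) unfolding sorted_wrt_append by blast
    then show ?thesis unfolding R_def by auto
  qed
  \<comment> \<open>For negative \<alpha> possibly no prefix qualifies and \<open>GREATEST\<close>
    is unspecified. Clipping at the length keeps \<open>N' \<le> length ks\<close> free of a sign
    condition and does not change the prefix.\<close>
  define N' where "N' = min N (length ks)"
  have N': "set (take N' ks) = set (take N ks)" unfolding N'_def by (simp add: min_def)
  have NN: "N' = N" if "0 \<le> \<alpha>" using bnd[OF QN[OF that]] by (simp add: N'_def)
  show ?thesis
  proof (rule that[of ks N'])
    show "(\<Sum>i\<in>set (take N' ks). w i) \<le> \<alpha> * real N'" if "0 \<le> \<alpha>"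
      using QN[OF that] Q_iff[OF bnd[OF QN[OF that]] that] NN[OF that] by simp
    show "n \<le> N'" if "n \<le> length ks" "(\<Sum>i\<in>set (take n ks). w i) \<le> \<alpha> * real n" "0 \<le> \<alpha>" for n
      using Q_iff[OF that(1,3)] that(2) NN[OF that(3)] Greatest_le_nat[of Q n "length ks"] bnd
      unfolding N_def by blast
  qed (use ks one N' low in \<open>auto simp: N'_def\<close>)
qed

lemma onestep_subset: "finite S \<Longrightarrow> onestep \<alpha> S w \<subseteq> S"
  by (rule onestep_initial_segment[of S \<alpha> w]) (auto dest: in_set_takeD)

lemma onestep_feasible:
  assumes "finite S" "0 \<le> \<alpha>"
  shows "(\<Sum>i\<in>onestep \<alpha> S w. w i) \<le> \<alpha> * real (card (onestep \<alpha> S w))"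
proof (rule onestep_initial_segment[OF assms(1), of \<alpha> w])
  fix ks N assume *: "set ks = S" "distinct ks" "N \<le> length ks" "onestep \<alpha> S w = set (take N ks)"
    "0 \<le> \<alpha> \<Longrightarrow> sum w (set (take N ks)) \<le> \<alpha> * real N"
  then have "card (onestep \<alpha> S w) = N" by (simp add: distinct_card)
  then show ?thesis using * assms(2) by simp
qed

text \<open>The exchange is used twice. Mapping \<open>B\<close> onto the \<open>card B\<close>
  smallest weights shows that this prefix is feasible, so the rule keeps at least
  \<open>card B\<close> streams; then \<open>B\<close> can be mapped into the kept set.\<close>

lemma onestep_dominates:
  assumes fin: "finite S" and a: "0 \<le> \<alpha>" and B: "B \<subseteq> S" "(\<Sum>i\<in>B. w i) \<le> \<alpha> * real (card B)"
  obtains \<sigma> where "inj_on \<sigma> B" "\<sigma> ` B \<subseteq> onestep \<alpha> S w" "\<And>i. i \<in> B \<Longrightarrow> w (\<sigma> i) \<le> w i"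
proof (rule onestep_initial_segment[OF fin, of \<alpha> w])
  fix ks N assume ks: "set ks = S" "distinct ks" "N \<le> length ks"
    and one: "onestep \<alpha> S w = set (take N ks)"
    and low: "\<And>n i j. i \<in> set (take n ks) \<Longrightarrow> j \<in> S - set (take n ks) \<Longrightarrow> w i \<le> w j"
    and max: "\<And>n. n \<le> length ks \<Longrightarrow> sum w (set (take n ks)) \<le> \<alpha> * real n \<Longrightarrow> 0 \<le> \<alpha> \<Longrightarrow> n \<le> N"
  define n where "n = card B"
  have n: "n \<le> length ks"
    unfolding n_def using ks B fin by (metis card_mono distinct_card)
  have cards: "card (set (take m ks)) = m" if "m \<le> length ks" for m
    using that ks by (simp add: distinct_card)
  have sub: "set (take m ks) \<subseteq> S" for m using ks by (auto dest: in_set_takeD)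
  obtain \<rho> where \<rho>: "inj_on \<rho> B" "\<rho> ` B \<subseteq> set (take n ks)" "\<And>i. i \<in> B \<Longrightarrow> w (\<rho> i) \<le> w i"
    by (rule exchange_injection[of S "set (take n ks)" B w])
      (use fin sub B low n cards[OF n] in \<open>auto simp: n_def\<close>)
  \<comment> \<open>Equal cardinalities make \<rho> onto, so the sum over the prefix can be
    reindexed over \<open>B\<close>.\<close>
  have "\<rho> ` B = set (take n ks)"
    by (rule card_subset_eq) (use \<rho> cards[OF n] in \<open>auto simp: card_image n_def\<close>)
  then have "sum w (set (take n ks)) = (\<Sum>i\<in>B. w (\<rho> i))"
    using sum.reindex[OF \<rho>(1), of w] by simp
  also have "\<dots> \<le> (\<Sum>i\<in>B. w i)" by (rule sum_mono) (rule \<rho>(3))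
  finally have "n \<le> N" using max[OF n _ a] B(2) n_def by simp
  then have le: "card B \<le> card (set (take N ks))" using cards[OF ks(3)] n_def by simp
  obtain \<sigma> where "inj_on \<sigma> B" "\<sigma> ` B \<subseteq> set (take N ks)" "\<And>i. i \<in> B \<Longrightarrow> w (\<sigma> i) \<le> w i"
    by (rule exchange_injection[of S "set (take N ks)" B w]) (use fin sub B low le in blast)+
  then show ?thesis using that one by simp
qed

section \<open>Bayesian updating and the value function\<close>

text \<open>It suffices to compare rectangles, where the integral of the product density factors.
  This serves the predictive laws as well as the laws given the change points.\<close>

lemma PiM_density:
  fixes m :: "'i \<Rightarrow> 'a \<Rightarrow> ennreal"
  assumes fin: "finite I" and L: "\<And>i. prob_space (L i)"
    and m[measurable]: "\<And>i. m i \<in> borel_measurable (L i)"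
    and one: "\<And>i. (\<integral>\<^sup>+x. m i x \<partial>L i) = 1"
  shows "PiM I (\<lambda>i. density (L i) (m i)) = density (PiM I L) (\<lambda>x. \<Prod>i\<in>I. m i (x i))"
proof -
  interpret P: product_sigma_finite L
    using L by (auto simp: product_sigma_finite_def prob_space_def finite_measure_def)
  have "prob_space (density (L i) (m i))" for i
    by (rule prob_spaceI) (simp add: emeasure_density one cong: nn_integral_cong)
  then interpret Q: product_sigma_finite "\<lambda>i. density (L i) (m i)"
    by (auto simp: product_sigma_finite_def prob_space_def finite_measure_def)
  show ?thesis
  proof (rule Q.PiM_eqI[OF fin, symmetric])
    show "sets (density (PiM I L) (\<lambda>x. \<Prod>i\<in>I. m i (x i))) = sets (PiM I (\<lambda>i. density (L i) (m i)))"
      by (simp cong: sets_PiM_cong)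
  next
    fix A assume A: "\<And>i. i \<in> I \<Longrightarrow> A i \<in> sets (density (L i) (m i))"
    then have A': "\<And>i. i \<in> I \<Longrightarrow> A i \<in> sets (L i)" by simp
    have "emeasure (density (PiM I L) (\<lambda>x. \<Prod>i\<in>I. m i (x i))) (Pi\<^sub>E I A)
      = (\<integral>\<^sup>+x. (\<Prod>i\<in>I. m i (x i)) * indicator (Pi\<^sub>E I A) x \<partial>PiM I L)"
      by (rule emeasure_density) (use fin A' in \<open>auto intro!: sets_PiM_I_finite\<close>)
    also have "\<dots> = (\<integral>\<^sup>+x. (\<Prod>i\<in>I. m i (x i) * indicator (A i) (x i)) \<partial>PiM I L)"
    proof (rule nn_integral_cong)
      fix x assume "x \<in> space (PiM I L)"
      then have "indicator (Pi\<^sub>E I A) x = (\<Prod>i\<in>I. indicator (A i) (x i) :: ennreal)"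
        using fin by (auto simp: indicator_def space_PiM PiE_iff split: if_splits)
      then show "(\<Prod>i\<in>I. m i (x i)) * indicator (Pi\<^sub>E I A) x = (\<Prod>i\<in>I. m i (x i) * indicator (A i) (x i))"
        by (simp add: prod.distrib)
    qed
    also have "\<dots> = (\<Prod>i\<in>I. \<integral>\<^sup>+x. m i x * indicator (A i) x \<partial>L i)"
      by (rule P.product_nn_integral_prod) (use fin A' in auto)
    also have "\<dots> = (\<Prod>i\<in>I. emeasure (density (L i) (m i)) (A i))"
      by (intro prod.cong refl) (simp add: emeasure_density A')
    finally show "emeasure (density (PiM I L) (\<lambda>x. \<Prod>i\<in>I. m i (x i))) (Pi\<^sub>E I A)
      = (\<Prod>i\<in>I. emeasure (density (L i) (m i)) (A i))" .
  qed
qed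

locale change_densities = prob_space \<nu> for \<nu> :: "'x measure" +
  fixes f g :: "'x \<Rightarrow> real" and \<theta> :: real
  assumes f_meas[measurable]: "f \<in> borel_measurable \<nu>"
    and g_meas[measurable]: "g \<in> borel_measurable \<nu>"
    and f_nonneg: "x \<in> space \<nu> \<Longrightarrow> 0 \<le> f x" and g_nonneg: "x \<in> space \<nu> \<Longrightarrow> 0 \<le> g x"
    and f_one: "(\<integral>\<^sup>+x. ennreal (f x) \<partial>\<nu>) = 1" and g_one: "(\<integral>\<^sup>+x. ennreal (g x) \<partial>\<nu>) = 1"
    and theta: "0 < \<theta>" "\<theta> < 1"
begin

text \<open>The truncation to \<open>[0, 1]\<close> is inactive on genuine probabilities; it makes \<open>law a\<close> a
  probability measure for every real \<open>a\<close>.\<close>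

definition prior :: "real \<Rightarrow> real" where "prior a = max 0 (min 1 (a + \<theta> * (1 - a)))"

text \<open>Predictive density of the next observation of a stream with posterior \<open>a\<close>.
  Here \<open>prior a\<close> adds to \<open>a\<close> the chance that a so far unchanged stream
  changes now, which for a geometric change point is \<theta> at every time.\<close>

definition mix :: "real \<Rightarrow> 'x \<Rightarrow> real" where "mix a x = prior a * g x + (1 - prior a) * f x"

text \<open>Bayes' formula for the event of a change. Where the predictive density vanishes,
  division gives 0, and several proofs below treat such points separately.\<close>

definition upd :: "real \<Rightarrow> 'x \<Rightarrow> real" where "upd a x = prior a * g x / mix a x"

definition law :: "real \<Rightarrow> 'x measure" where "law a = density \<nu> (\<lambda>x. ennreal (mix a x))"

text \<open>Padding by 0 outside \<open>B\<close> puts the vectors of all active sets into the one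
  measurable space \<open>PiM UNIV\<close>.\<close>

definition upds :: "nat set \<Rightarrow> (nat \<Rightarrow> real) \<Rightarrow> (nat \<Rightarrow> 'x) \<Rightarrow> nat \<Rightarrow> real" where
  "upds B v x = (\<lambda>i. if i \<in> B then upd (v i) (x i) else 0)"

definition expect :: "((nat \<Rightarrow> real) \<Rightarrow> ennreal) \<Rightarrow> nat set \<Rightarrow> (nat \<Rightarrow> real) \<Rightarrow> ennreal" where
  "expect H B v = (\<integral>\<^sup>+x. H (upds B v x) \<partial>PiM B (\<lambda>i. law (v i)))"

lemma prior_bounds: "0 \<le> prior a" "prior a \<le> 1"
  by (auto simp: prior_def)

lemma prior_mono: "a \<le> b \<Longrightarrow> prior a \<le> prior b"
proof -
  assume "a \<le> b"
  then have "0 \<le> (1 - \<theta>) * (b - a)" using theta by simp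
  then have "a + \<theta> * (1 - a) \<le> b + \<theta> * (1 - b)" by (simp add: algebra_simps)
  then show ?thesis by (auto simp: prior_def)
qed

lemma prior_eq: "0 \<le> a \<Longrightarrow> a \<le> 1 \<Longrightarrow> prior a = a + \<theta> * (1 - a)"
proof -
  assume a: "0 \<le> a" "a \<le> 1"
  have "0 \<le> (1 - \<theta>) * (1 - a)" "0 \<le> \<theta> * (1 - a)" using theta a by simp_all
  then have "a + \<theta> * (1 - a) \<le> 1" "0 \<le> a + \<theta> * (1 - a)" using a by (simp_all add: algebra_simps)
  then show ?thesis by (simp add: prior_def)
qed

lemma prior_measurable[measurable]: "prior \<in> borel_measurable borel"
  unfolding prior_def by measurable

lemma mix_nonneg: "x \<in> space \<nu> \<Longrightarrow> 0 \<le> mix a x"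
  using prior_bounds[of a] f_nonneg g_nonneg by (simp add: mix_def)

lemma mix_measurable[measurable]: "(\<lambda>(a, x). mix a x) \<in> borel_measurable (borel \<Otimes>\<^sub>M \<nu>)"
  unfolding mix_def case_prod_unfold by measurable

lemma upd_measurable[measurable]: "(\<lambda>(a, x). upd a x) \<in> borel_measurable (borel \<Otimes>\<^sub>M \<nu>)"
  using mix_measurable unfolding upd_def case_prod_unfold by measurable

lemma upd_bounds:
  assumes "x \<in> space \<nu>" shows "0 \<le> upd a x" "upd a x \<le> 1"
proof -
  have "0 \<le> prior a * g x" "0 \<le> (1 - prior a) * f x"
    using prior_bounds[of a] f_nonneg[OF assms] g_nonneg[OF assms] by simp_all
  then show "0 \<le> upd a x" "upd a x \<le> 1"
    unfolding upd_def mix_def by (auto simp: divide_le_eq_1 intro!: divide_nonneg_nonneg)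
qed

text \<open>After cross-multiplication the difference of the two sides is
  \<open>(prior b - prior a) * (g x * f x)\<close>, which is nonnegative.\<close>

lemma upd_mono:
  assumes x: "x \<in> space \<nu>" and ab: "a \<le> b" shows "upd a x \<le> upd b x"
proof (cases "mix a x = 0 \<or> g x = 0")
  case True
  then show ?thesis using upd_bounds(1)[OF x, of b] by (auto simp: upd_def)
next
  case False
  then have ma: "0 < mix a x" and gx: "0 < g x"
    using mix_nonneg[OF x, of a] g_nonneg[OF x] by linarith+
  let ?a = "prior a" and ?b = "prior b"
  have p: "?a \<le> ?b" using prior_mono[OF ab] .
  show ?thesis
  proof (cases "?b = 0")
    case True
    then have "?a = 0" using p prior_bounds(1)[of a] by simp
    then show ?thesis using True by (simp add: upd_def)
  next
    case False
    then have b: "0 < ?b" using prior_bounds(1)[of b] by simp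
    have mb: "0 < mix b x"
      unfolding mix_def using b gx prior_bounds(2)[of b] f_nonneg[OF x] by (simp add: add_pos_nonneg)
    have "0 \<le> (?b - ?a) * (g x * f x)" using p gx f_nonneg[OF x] by simp
    then have "?a * g x * mix b x \<le> ?b * g x * mix a x"
      unfolding mix_def by (simp add: algebra_simps)
    then show ?thesis unfolding upd_def using ma mb by (simp add: divide_simps mult.commute)
  qed
qed

lemma law_prob: "prob_space (law a)"
proof (rule prob_spaceI)
  have "emeasure (law a) (space (law a)) = (\<integral>\<^sup>+x. ennreal (mix a x) \<partial>\<nu>)"
    unfolding law_def by (simp add: emeasure_density cong: nn_integral_cong)
  also have "\<dots> = (\<integral>\<^sup>+x. ennreal (prior a) * ennreal (g x) + ennreal (1 - prior a) * ennreal (f x) \<partial>\<nu>)"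
    by (rule nn_integral_cong)
      (use prior_bounds[of a] f_nonneg g_nonneg in \<open>simp add: mix_def ennreal_mult ennreal_plus\<close>)
  also have "\<dots> = ennreal (prior a) + ennreal (1 - prior a)"
    by (simp add: nn_integral_add nn_integral_cmult f_one g_one)
  also have "\<dots> = 1" using prior_bounds[of a] by (simp flip: ennreal_plus)
  finally show "emeasure (law a) (space (law a)) = 1" .
qed

lemma law_sets[measurable_cong]: "sets (law a) = sets \<nu>" by (simp add: law_def)

lemma space_law[simp]: "space (law a) = space \<nu>" by (simp add: law_def)

lemma law_product: "product_prob_space (\<lambda>i. law (v i))"
  using law_prob by (simp add: product_prob_space_def product_prob_space_axioms_def
      product_sigma_finite_def prob_space_def finite_measure_def)

lemma sets_PiM_law[measurable_cong]: "sets (PiM B (\<lambda>i. law (v i))) = sets (PiM B (\<lambda>_. \<nu>))"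
  by (intro sets_PiM_cong refl law_sets)

lemma upds_measurable[measurable]:
  "(\<lambda>(v, x). upds B v x) \<in> measurable (PiM UNIV (\<lambda>_. borel) \<Otimes>\<^sub>M PiM B (\<lambda>_. \<nu>)) (PiM UNIV (\<lambda>_. borel))"
proof (rule measurable_PiM_single')
  fix i
  show "(\<lambda>\<omega>. (case \<omega> of (v, x) \<Rightarrow> upds B v x) i)
      \<in> borel_measurable (PiM UNIV (\<lambda>_. borel) \<Otimes>\<^sub>M PiM B (\<lambda>_. \<nu>))"
  proof (cases "i \<in> B")
    case True
    have "(\<lambda>\<omega>. (fst \<omega> i, snd \<omega> i)) \<in> measurable (PiM UNIV (\<lambda>_. borel) \<Otimes>\<^sub>M PiM B (\<lambda>_. \<nu>)) (borel \<Otimes>\<^sub>M \<nu>)"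
      using True by measurable
    from measurable_compose[OF this upd_measurable] show ?thesis
      using True by (simp add: upds_def case_prod_unfold)
  qed (simp add: upds_def case_prod_unfold)
qed (auto simp: PiE_def)

lemma upds_measurable'[measurable]:
  "upds B v \<in> measurable (PiM B (\<lambda>i. law (u i))) (PiM UNIV (\<lambda>_. borel))"
proof -
  have "v \<in> space (PiM UNIV (\<lambda>_. borel))" by (simp add: space_PiM)
  from measurable_Pair2[OF upds_measurable this, of B] show ?thesis
    by (simp cong: measurable_cong_sets add: measurable_cong_sets[OF sets_PiM_law refl])
qed

text \<open>This moves \<open>v\<close> from the measure into the integrand over a fixed product
  measure; measurability in \<open>v\<close> then follows from that of parametrized
  integrals.\<close>

lemma expect_density:
  assumes B: "finite B" and H[measurable]: "H \<in> borel_measurable (PiM UNIV (\<lambda>_. borel))"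
  shows "expect H B v = (\<integral>\<^sup>+x. (\<Prod>i\<in>B. ennreal (mix (v i) (x i))) * H (upds B v x) \<partial>PiM B (\<lambda>_. \<nu>))"
proof -
  have [measurable]: "mix a \<in> borel_measurable \<nu>" for a unfolding mix_def by measurable
  have one: "(\<integral>\<^sup>+x. ennreal (mix a x) \<partial>\<nu>) = 1" for a
    using prob_space.emeasure_space_1[OF law_prob[of a]]
    by (simp add: law_def emeasure_density cong: nn_integral_cong)
  have "PiM B (\<lambda>i. law (v i)) = density (PiM B (\<lambda>_. \<nu>)) (\<lambda>x. \<Prod>i\<in>B. ennreal (mix (v i) (x i)))"
    unfolding law_def by (rule PiM_density[OF B prob_space_axioms]) (auto simp: one)
  moreover have "upds B v \<in> measurable (PiM B (\<lambda>_. \<nu>)) (PiM UNIV (\<lambda>_. borel))"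
    using upds_measurable'[of B v v] by (simp cong: measurable_cong_sets add: measurable_cong_sets[OF sets_PiM_law refl])
  ultimately show ?thesis unfolding expect_def
    by (subst (1) \<open>PiM B (\<lambda>i. law (v i)) = _\<close>, subst nn_integral_density) (auto intro!: measurable_compose[OF _ H])
qed

lemma expect_measurable:
  assumes B: "finite B" and H[measurable]: "H \<in> borel_measurable (PiM UNIV (\<lambda>_. borel))"
  shows "expect H B \<in> borel_measurable (PiM UNIV (\<lambda>_. borel))"
proof -
  interpret P: product_sigma_finite "\<lambda>_. \<nu>" by standard
  interpret finite_product_sigma_finite "\<lambda>_. \<nu>" B by standard (rule B)
  have [measurable]: "(\<lambda>(v, x). ennreal (mix (v i) (x i)))
      \<in> borel_measurable (PiM UNIV (\<lambda>_. borel) \<Otimes>\<^sub>M PiM B (\<lambda>_. \<nu>))" if "i \<in> B" for i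
  proof -
    have "(\<lambda>\<omega>. (fst \<omega> i, snd \<omega> i)) \<in> measurable (PiM UNIV (\<lambda>_. borel) \<Otimes>\<^sub>M PiM B (\<lambda>_. \<nu>)) (borel \<Otimes>\<^sub>M \<nu>)"
      using that by measurable
    from measurable_compose[OF this mix_measurable] show ?thesis by (simp add: case_prod_unfold)
  qed
  have "(\<lambda>v. \<integral>\<^sup>+x. (\<Prod>i\<in>B. ennreal (mix (v i) (x i))) * H (upds B v x) \<partial>PiM B (\<lambda>_. \<nu>))
      \<in> borel_measurable (PiM UNIV (\<lambda>_. borel))"
    by measurable
  then show ?thesis by (subst measurable_cong[OF expect_density[OF B H]])
qed

end

section \<open>Monotonicity of the expectation in the posteriors, and the value function\<close>

context change_densities
begin

text \<open>The excess of \<open>mix b\<close> over \<open>mix a\<close> is a nonnegative multiple of \<open>g - f\<close>, which has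
  integral \<open>0\<close> and the sign of \<open>upd b x - prior b\<close>, so one may subtract the constant
  \<open>H (prior b)\<close> from \<open>H\<close>. Both sides are shifted so that no subtraction in \<open>ennreal\<close> occurs.\<close>

lemma expect_one_antimono:
  assumes H: "H \<in> borel_measurable borel" and anti: "\<And>s t. s \<le> t \<Longrightarrow> H t \<le> H s"
    and fin: "\<And>s. H s < top" and ab: "a \<le> b"
  shows "(\<integral>\<^sup>+x. H (upd b x) \<partial>law b) \<le> (\<integral>\<^sup>+x. H (upd a x) \<partial>law a)"
proof -
  note [measurable] = H
  have [measurable]: "mix c \<in> borel_measurable \<nu>" "upd c \<in> borel_measurable \<nu>" for c
    unfolding mix_def upd_def by measurable
  define c where "c = H (prior b)"
  define \<delta> where "\<delta> = prior b - prior a"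
  have \<delta>: "0 \<le> \<delta>" using prior_mono[OF ab] by (simp add: \<delta>_def)
  have mixb: "mix b x = mix a x + \<delta> * (g x - f x)" for x
    by (simp add: mix_def \<delta>_def algebra_simps)
  \<comment> \<open>The left side is shifted by \<open>c\<close> times \<open>\<delta> * f\<close>,
    the right side by \<open>c\<close> times \<open>\<delta> * g\<close>. Both shifts have the same
    integral, so this pointwise bound integrates to the claim.\<close>
  have ae: "ennreal (mix b x) * H (upd b x) + c * ennreal (\<delta> * f x)
    \<le> ennreal (mix a x) * H (upd a x) + c * ennreal (\<delta> * g x)" if x: "x \<in> space \<nu>" for x
  proof -
    have nn: "0 \<le> mix a x" "0 \<le> mix b x" "0 \<le> f x" "0 \<le> g x"
      using mix_nonneg f_nonneg g_nonneg x by auto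
    have step1: "H (upd b x) \<le> H (upd a x)" by (intro anti upd_mono x ab)
    have "ennreal (mix b x) * H (upd b x) + c * ennreal (\<delta> * f x)
      \<le> ennreal (mix a x) * H (upd b x) + c * ennreal (\<delta> * g x)"
    proof (cases "f x \<le> g x")
      case True
      \<comment> \<open>Where \<open>mix b x\<close> vanishes, \<open>upd b x\<close> is 0 by
        convention. Then either \<open>prior b\<close> is 0 as well, or \<open>f\<close> and
        \<open>g\<close> both vanish at x and the shifts agree.\<close>
      have "H (upd b x) \<le> c \<or> g x = f x"
      proof (cases "mix b x = 0")
        case True
        have "0 \<le> prior b * g x" "0 \<le> (1 - prior b) * f x" using nn prior_bounds by simp_all
        then have "prior b * g x = 0" "(1 - prior b) * f x = 0" using True unfolding mix_def by linarith+
        then have "g x = f x \<or> prior b = 0" using nn \<open>f x \<le> g x\<close> by auto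
        then show ?thesis by (auto simp: c_def upd_def)
      next
        case False
        then have m: "0 < mix b x" using nn by simp
        have "0 \<le> prior b * ((1 - prior b) * (g x - f x))" using prior_bounds[of b] True by simp
        then have "prior b * mix b x \<le> prior b * g x" unfolding mix_def by (simp add: algebra_simps)
        then have "prior b \<le> upd b x" unfolding upd_def using m by (simp add: pos_le_divide_eq)
        then show ?thesis using anti by (simp add: c_def)
      qed
      then have le: "ennreal (\<delta> * (g x - f x)) * H (upd b x) \<le> c * ennreal (\<delta> * (g x - f x))"
        by (auto simp: mult.commute intro: mult_right_mono)
      have nn': "0 \<le> \<delta> * (g x - f x)" "0 \<le> \<delta> * f x" using \<delta> True nn by simp_all
      have "ennreal (mix b x) * H (upd b x) + c * ennreal (\<delta> * f x)
        = ennreal (mix a x) * H (upd b x) + (ennreal (\<delta> * (g x - f x)) * H (upd b x) + c * ennreal (\<delta> * f x))"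
        using nn nn' by (simp add: mixb[of x] ennreal_plus distrib_right distrib_left ac_simps)
      also have "\<dots> \<le> ennreal (mix a x) * H (upd b x) + (c * ennreal (\<delta> * (g x - f x)) + c * ennreal (\<delta> * f x))"
        by (intro add_mono le order_refl)
      also have "c * ennreal (\<delta> * (g x - f x)) + c * ennreal (\<delta> * f x) = c * ennreal (\<delta> * g x)"
        using nn' by (simp flip: distrib_left ennreal_plus)
      finally show ?thesis .
    next
      case False
      have "c \<le> H (upd b x)"
      proof -
        have "0 \<le> prior b * ((1 - prior b) * (f x - g x))" using prior_bounds[of b] False by simp
        then have "prior b * g x \<le> prior b * mix b x" unfolding mix_def by (simp add: algebra_simps)
        then have "upd b x \<le> prior b" unfolding upd_def using nn prior_bounds(1)[of b]
          by (cases "mix b x = 0") (auto simp: divide_le_eq)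
        then show ?thesis using anti by (simp add: c_def)
      qed
      then have le: "c * ennreal (\<delta> * (f x - g x)) \<le> ennreal (\<delta> * (f x - g x)) * H (upd b x)"
        by (simp add: mult.commute mult_right_mono)
      have nn': "0 \<le> \<delta> * (f x - g x)" "0 \<le> \<delta> * g x" using \<delta> False nn by simp_all
      have mixa: "mix a x = mix b x + \<delta> * (f x - g x)" using mixb[of x] by (simp add: algebra_simps)
      have "c * ennreal (\<delta> * f x) = c * ennreal (\<delta> * (f x - g x)) + c * ennreal (\<delta> * g x)"
        using nn' by (simp flip: distrib_left ennreal_plus)
      then have "ennreal (mix b x) * H (upd b x) + c * ennreal (\<delta> * f x)
        \<le> ennreal (mix b x) * H (upd b x) + (ennreal (\<delta> * (f x - g x)) * H (upd b x) + c * ennreal (\<delta> * g x))"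
        using le by (auto intro!: add_mono)
      also have "\<dots> = ennreal (mix a x) * H (upd b x) + c * ennreal (\<delta> * g x)"
        using nn nn' by (simp add: mixa ennreal_plus distrib_right distrib_left ac_simps)
      finally show ?thesis .
    qed
    also have "\<dots> \<le> ennreal (mix a x) * H (upd a x) + c * ennreal (\<delta> * g x)"
      by (intro add_mono mult_left_mono step1) auto
    finally show ?thesis .
  qed
  have sc: "(\<integral>\<^sup>+x. c * ennreal (\<delta> * h x) \<partial>\<nu>) = c * ennreal \<delta>"
    if [measurable]: "h \<in> borel_measurable \<nu>" and "(\<integral>\<^sup>+x. ennreal (h x) \<partial>\<nu>) = 1" for h
    using that \<delta> by (simp add: ennreal_mult' nn_integral_cmult)
  have "(\<integral>\<^sup>+x. H (upd b x) \<partial>law b) + c * ennreal \<delta>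
    = (\<integral>\<^sup>+x. ennreal (mix b x) * H (upd b x) + c * ennreal (\<delta> * f x) \<partial>\<nu>)"
    unfolding law_def by (subst nn_integral_density) (auto simp: nn_integral_add sc f_one)
  also have "\<dots> \<le> (\<integral>\<^sup>+x. ennreal (mix a x) * H (upd a x) + c * ennreal (\<delta> * g x) \<partial>\<nu>)"
    by (rule nn_integral_mono) (rule ae)
  also have "\<dots> = (\<integral>\<^sup>+x. H (upd a x) \<partial>law a) + c * ennreal \<delta>"
    unfolding law_def by (subst nn_integral_density) (auto simp: nn_integral_add sc g_one)
  \<comment> \<open>The common shift can be cancelled because it is finite; this is where finiteness
    of \<open>H\<close> enters.\<close>
  finally show ?thesis
    using ennreal_mult_less_top[of c "ennreal \<delta>"] fin[of "prior b"]
    by (auto simp: c_def add.commute[of _ "_ * _"] ennreal_add_left_cancel_le)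
qed

text \<open>One stream is changed at a time: integrate out stream j under its old law, change the
  others by induction, then change j with the others fixed by \<open>expect_one_antimono\<close>. A
  uniform bound \<open>c\<close> is required rather than pointwise finiteness because it survives
  integration over a probability measure.\<close>

lemma expect_antimono:
  assumes "finite B" and H: "H \<in> borel_measurable (PiM UNIV (\<lambda>_. borel))"
    and "\<And>s t. (\<And>i. i \<in> B \<Longrightarrow> s i \<le> t i) \<Longrightarrow> H t \<le> H s"
    and "\<And>s. H s \<le> c" and c: "c < top" and "\<And>i. i \<in> B \<Longrightarrow> u i \<le> v i"
  shows "expect H B v \<le> expect H B u"
  using assms(1,2,3,4,6)
proof (induction B arbitrary: H)
  case empty
  have "upds {} v = upds {} u" by (auto simp: upds_def fun_eq_iff)
  then show ?case by (simp add: expect_def PiM_empty)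
next
  case (insert j B)
  note [measurable] = insert.prems(1)
  have "(\<lambda>(z :: nat \<Rightarrow> real, r). z(j := r)) \<in> measurable (PiM UNIV (\<lambda>_. borel) \<Otimes>\<^sub>M borel) (PiM UNIV (\<lambda>_. borel))"
    by (rule measurable_PiM_single') (auto simp: PiE_def case_prod_unfold fun_upd_def)
  note upd1 = this
  have upd_j[measurable]: "upd a \<in> borel_measurable (law b)" for a b
    using measurable_Pair2[OF upd_measurable, of a] by (simp add: measurable_cong_sets[OF law_sets refl])
  have Hup[measurable]: "(\<lambda>(z, y). H (z(j := upd (v j) y)))
      \<in> borel_measurable (PiM UNIV (\<lambda>_. borel) \<Otimes>\<^sub>M law (v j))"
  proof -
    have "(\<lambda>\<omega>. (fst \<omega>, upd (v j) (snd \<omega>))) \<in> measurable (PiM UNIV (\<lambda>_. borel) \<Otimes>\<^sub>M law (v j)) (PiM UNIV (\<lambda>_. borel) \<Otimes>\<^sub>M borel)"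
      by measurable
    from measurable_compose[OF measurable_compose[OF this upd1] insert.prems(1)] show ?thesis
      unfolding case_prod_unfold fst_conv snd_conv .
  qed
  interpret lj: prob_space "law (v j)" by (rule law_prob)
  \<comment> \<open>Integrating out stream j keeps antitonicity and the bound, so the induction
    hypothesis applies to \<open>H'\<close> in place of \<open>H\<close>.\<close>
  define H' where "H' z = (\<integral>\<^sup>+y. H (z(j := upd (v j) y)) \<partial>law (v j))" for z
  have H'm: "H' \<in> borel_measurable (PiM UNIV (\<lambda>_. borel))"
    unfolding H'_def[abs_def] by measurable
  have fact: "expect H (insert j B) w = (\<integral>\<^sup>+x. \<integral>\<^sup>+y. H ((upds B w x)(j := upd (w j) y)) \<partial>law (w j) \<partial>PiM B (\<lambda>i. law (w i)))" for w
  proof -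
    interpret P: product_prob_space "\<lambda>i. law (w i)" by (rule law_product)
    have "upds (insert j B) w (x(j := y)) = (upds B w x)(j := upd (w j) y)" for x y
      using insert.hyps by (auto simp: upds_def fun_eq_iff)
    then show ?thesis unfolding expect_def
      by (subst P.product_nn_integral_insert) (use insert.hyps in auto)
  qed
  have "expect H (insert j B) v = expect H' B v"
    unfolding fact by (simp add: expect_def H'_def)
  also have "\<dots> \<le> expect H' B u"
  proof (rule insert.IH)
    show "H' \<in> borel_measurable (PiM UNIV (\<lambda>_. borel))" by (rule H'm)
    show "H' t \<le> H' s" if "\<And>i. i \<in> B \<Longrightarrow> s i \<le> t i" for s t
      unfolding H'_def by (intro nn_integral_mono insert.prems(2)) (use that in auto)
    show "H' s \<le> c" for s
    proof -
      have "H' s \<le> (\<integral>\<^sup>+y. c \<partial>law (v j))" unfolding H'_def by (intro nn_integral_mono insert.prems(3))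
      also have "\<dots> = c" using lj.emeasure_space_1 by simp
      finally show ?thesis .
    qed
  qed (use insert.prems in auto)
  also have "\<dots> \<le> expect H (insert j B) u"
    unfolding fact unfolding expect_def H'_def
  proof (rule nn_integral_mono)
    fix x
    let ?z = "upds B u x"
    show "(\<integral>\<^sup>+y. H (?z(j := upd (v j) y)) \<partial>law (v j)) \<le> (\<integral>\<^sup>+y. H (?z(j := upd (u j) y)) \<partial>law (u j))"
    proof (rule expect_one_antimono[of "\<lambda>r. H (?z(j := r))"])
      have "(\<lambda>r. (?z, r)) \<in> measurable borel (PiM UNIV (\<lambda>_. borel) \<Otimes>\<^sub>M borel)"
        by (intro measurable_Pair1') (simp add: space_PiM)
      from measurable_compose[OF measurable_compose[OF this upd1] insert.prems(1)]
      show "(\<lambda>r. H (?z(j := r))) \<in> borel_measurable borel" unfolding prod.case .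
      show "H (?z(j := t)) \<le> H (?z(j := s))" if "s \<le> t" for s t
        by (rule insert.prems(2)) (use that in auto)
      show "H (?z(j := s)) < top" for s using insert.prems(3) c by (rule le_less_trans)
      show "u j \<le> v j" using insert.prems(4) by simp
    qed
  qed
  finally show ?case .
qed

text \<open>Infeasible subsets contribute 0, the least element of \<open>ennreal\<close>, so the
  supremum is effectively over feasible ones. The next stage starts from \<open>B\<close>: a dropped
  stream never returns.\<close>

fun val :: "real \<Rightarrow> nat \<Rightarrow> nat set \<Rightarrow> (nat \<Rightarrow> real) \<Rightarrow> ennreal" where
  "val \<alpha> 0 A v = 0"
| "val \<alpha> (Suc n) A v =
    (SUP B\<in>Pow A. if (\<Sum>i\<in>B. v i) \<le> \<alpha> * card B then of_nat (card B) + expect (val \<alpha> n B) B v else 0)"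

lemma val_measurable: "finite A \<Longrightarrow> val \<alpha> n A \<in> borel_measurable (PiM UNIV (\<lambda>_. borel))"
proof (induction n arbitrary: A)
  case 0
  show ?case by simp
next
  case (Suc n)
  have "expect (val \<alpha> n B) B \<in> borel_measurable (PiM UNIV (\<lambda>_. borel))" if "B \<in> Pow A" for B
    using that Suc.prems by (intro expect_measurable Suc.IH) (auto intro: finite_subset)
  then have "(\<lambda>v. SUP B\<in>Pow A. if (\<Sum>i\<in>B. v i) \<le> \<alpha> * card B then of_nat (card B) + expect (val \<alpha> n B) B v else 0)
      \<in> borel_measurable (PiM UNIV (\<lambda>_. borel))"
    by (intro borel_measurable_SUP) (use Suc.prems in \<open>auto intro: countable_finite\<close>)
  then show ?case by simp
qed

text \<open>Supplies the uniform finite bound that \<open>expect_antimono\<close> asks for.\<close>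

lemma val_bounded: "finite A \<Longrightarrow> val \<alpha> n A v \<le> of_nat (n * card A)"
proof (induction n arbitrary: A v)
  case (Suc n)
  have "of_nat (card B) + expect (val \<alpha> n B) B v \<le> of_nat (Suc n * card A)" if "B \<subseteq> A" for B
  proof -
    have fin: "finite B" and card: "card B \<le> card A" using that Suc.prems by (auto intro: finite_subset card_mono)
    have "expect (val \<alpha> n B) B v \<le> (\<integral>\<^sup>+x. of_nat (n * card B) \<partial>PiM B (\<lambda>i. law (v i)))"
      unfolding expect_def by (intro nn_integral_mono Suc.IH fin)
    also have "\<dots> = of_nat (n * card B)"
      using prob_space.emeasure_space_1[OF prob_space_PiM[OF law_prob], of B v] by simp
    finally have "of_nat (card B) + expect (val \<alpha> n B) B v \<le> of_nat (card B + n * card B)" 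
      by (simp add: add_mono)
    also have "card B + n * card B \<le> Suc n * card A" using card by (simp add: add_mono)
    finally show ?thesis by simp
  qed
  then show ?case unfolding val.simps by (intro SUP_least) (simp del: of_nat_mult)
qed simp

text \<open>Monotonicity of \<open>val\<close> is a hypothesis here because the lemma serves twice:
  inside the induction that proves it, where it is the induction hypothesis, and afterwards in
  \<open>val_onestep\<close>.\<close>

lemma expect_reindex_le:
  assumes fin: "finite B" "finite D" and inj: "inj_on \<sigma> B" and sub: "\<sigma> ` B \<subseteq> D"
    and uv: "\<And>i. i \<in> B \<Longrightarrow> u (\<sigma> i) \<le> v i"
    and vmono: "\<And>A C \<rho> s t. finite A \<Longrightarrow> finite C \<Longrightarrow> inj_on \<rho> A \<Longrightarrow> \<rho> ` A \<subseteq> C \<Longrightarrow>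
      (\<And>i. i \<in> A \<Longrightarrow> s (\<rho> i) \<le> t i) \<Longrightarrow> val \<alpha> n A t \<le> val \<alpha> n C s"
  shows "expect (val \<alpha> n B) B v \<le> expect (val \<alpha> n D) D u"
proof -
  have "expect (val \<alpha> n B) B v \<le> expect (val \<alpha> n B) B (\<lambda>i. u (\<sigma> i))"
  proof (rule expect_antimono[OF fin(1) val_measurable[OF fin(1)], where c = "of_nat (n * card B)"])
    show "val \<alpha> n B t \<le> val \<alpha> n B s" if "\<And>i. i \<in> B \<Longrightarrow> s i \<le> t i" for s t
      by (rule vmono[of _ _ id]) (use fin that in auto)
  qed (use fin uv val_bounded[OF fin(1)] in \<open>auto simp del: of_nat_mult simp: of_nat_less_top\<close>)
  \<comment> \<open>The law of the streams in \<open>B\<close> is the image under reindexing of the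
    law of those in \<open>D\<close>. On this common space the updated posteriors correspond along
    \<sigma>, and \<open>vmono\<close> compares pointwise.\<close>
  also have "\<dots> \<le> expect (val \<alpha> n D) D u"
  proof -
    have d: "distr (PiM D (\<lambda>i. law (u i))) (\<Pi>\<^sub>M i\<in>B. law (u (\<sigma> i))) (\<lambda>x. \<lambda>i\<in>B. x (\<sigma> i)) = (\<Pi>\<^sub>M i\<in>B. law (u (\<sigma> i)))"
      by (rule distr_PiM_reindex) (use inj sub law_prob in auto)
    have m: "(\<lambda>x. \<lambda>i\<in>B. x (\<sigma> i)) \<in> measurable (PiM D (\<lambda>i. law (u i))) (\<Pi>\<^sub>M i\<in>B. law (u (\<sigma> i)))"
      by (rule measurable_restrict) (rule measurable_component_singleton, use sub in auto)
    have "expect (val \<alpha> n B) B (\<lambda>i. u (\<sigma> i))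
      = (\<integral>\<^sup>+x. val \<alpha> n B (upds B (\<lambda>i. u (\<sigma> i)) (\<lambda>i\<in>B. x (\<sigma> i))) \<partial>PiM D (\<lambda>i. law (u i)))"
      unfolding expect_def
      using nn_integral_distr[OF m, of "\<lambda>x. val \<alpha> n B (upds B (\<lambda>i. u (\<sigma> i)) x)"]
        measurable_compose[OF upds_measurable'[of B _ "\<lambda>i. u (\<sigma> i)"] val_measurable[OF fin(1)]]
      unfolding d measurable_distr_eq1 by blast
    also have "\<dots> \<le> expect (val \<alpha> n D) D u"
      unfolding expect_def
      by (intro nn_integral_mono vmono[of _ _ \<sigma>]) (use fin inj sub in \<open>auto simp: upds_def\<close>)
    finally show ?thesis .
  qed
  finally show ?thesis .
qed
text \<open>Each choice \<open>B\<close> is matched by its image under \<sigma>: it has the same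
  size and a smaller sum of posteriors, hence stays feasible, and its continuation is worth at least
  as much.\<close>

lemma val_mono:
  assumes "finite A" "finite C" "inj_on \<sigma> A" "\<sigma> ` A \<subseteq> C" "\<And>i. i \<in> A \<Longrightarrow> u (\<sigma> i) \<le> v i"
  shows "val \<alpha> n A v \<le> val \<alpha> n C u"
  using assms
proof (induction n arbitrary: A C \<sigma> u v)
  case 0
  show ?case by simp
next
  case (Suc n)
  have key: "expect (val \<alpha> n B) B v \<le> expect (val \<alpha> n (\<sigma> ` B)) (\<sigma> ` B) u" if B: "B \<subseteq> A" for B
    by (rule expect_reindex_le[where \<sigma> = \<sigma>])
      (use B Suc.prems Suc.IH in \<open>auto intro: finite_subset inj_on_subset\<close>)
  show ?case
    unfolding val.simps
  proof (rule SUP_least)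
    fix B assume "B \<in> Pow A"
    then have B: "B \<subseteq> A" by simp
    let ?D = "\<sigma> ` B"
    have inj: "inj_on \<sigma> B" using B Suc.prems(3) by (rule inj_on_subset[rotated])
    have card: "card ?D = card B" using inj by (rule card_image)
    have "(\<Sum>i\<in>?D. u i) \<le> (\<Sum>i\<in>B. v i)"
      using B Suc.prems(5) by (auto simp: sum.reindex[OF inj] intro!: sum_mono)
    then have "(if (\<Sum>i\<in>B. v i) \<le> \<alpha> * card B then of_nat (card B) + expect (val \<alpha> n B) B v else 0)
      \<le> (if (\<Sum>i\<in>?D. u i) \<le> \<alpha> * card ?D then of_nat (card ?D) + expect (val \<alpha> n ?D) ?D u else 0)"
      using key[OF B] card by (auto intro: add_mono)
    also have "\<dots> \<le> (SUP B\<in>Pow C. if (\<Sum>i\<in>B. u i) \<le> \<alpha> * card B then of_nat (card B) + expect (val \<alpha> n B) B u else 0)"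
      by (rule SUP_upper) (use B Suc.prems(4) in auto)
    finally show "(if (\<Sum>i\<in>B. v i) \<le> \<alpha> * card B then of_nat (card B) + expect (val \<alpha> n B) B v else 0) \<le> \<dots>" .
  qed
qed

lemma val_ge_step:
  assumes "B \<subseteq> A" "(\<Sum>i\<in>B. v i) \<le> \<alpha> * real (card B)"
  shows "of_nat (card B) + expect (val \<alpha> n B) B v \<le> val \<alpha> (Suc n) A v"
  unfolding val.simps by (rule SUP_upper2[of B]) (use assms in auto)

lemma val_onestep:
  assumes A: "finite A" and \<alpha>: "0 \<le> \<alpha>"
  shows "val \<alpha> (Suc n) A v = of_nat (card (onestep \<alpha> A v)) + expect (val \<alpha> n (onestep \<alpha> A v)) (onestep \<alpha> A v) v"
    (is "_ = of_nat (card ?G) + _")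
proof (rule antisym)
  have G: "?G \<subseteq> A" "finite ?G" using onestep_subset[OF A] A by (auto intro: finite_subset)
  show "of_nat (card ?G) + expect (val \<alpha> n ?G) ?G v \<le> val \<alpha> (Suc n) A v"
    by (rule val_ge_step[OF G(1) onestep_feasible[OF A \<alpha>]])
  show "val \<alpha> (Suc n) A v \<le> of_nat (card ?G) + expect (val \<alpha> n ?G) ?G v"
    unfolding val.simps
  proof (rule SUP_least)
    fix B assume "B \<in> Pow A"
    then have B: "B \<subseteq> A" "finite B" using A by (auto intro: finite_subset)
    show "(if (\<Sum>i\<in>B. v i) \<le> \<alpha> * card B then of_nat (card B) + expect (val \<alpha> n B) B v else 0)
      \<le> of_nat (card ?G) + expect (val \<alpha> n ?G) ?G v"
    proof (cases "(\<Sum>i\<in>B. v i) \<le> \<alpha> * card B")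
      case True
      then obtain \<sigma> where \<sigma>: "inj_on \<sigma> B" "\<sigma> ` B \<subseteq> ?G" "\<And>i. i \<in> B \<Longrightarrow> v (\<sigma> i) \<le> v i"
        using onestep_dominates[OF A \<alpha> B(1)] by metis
      have "card B \<le> card ?G" using \<sigma> G(2) by (metis card_inj_on_le)
      moreover have "expect (val \<alpha> n B) B v \<le> expect (val \<alpha> n ?G) ?G v"
        by (rule expect_reindex_le[where \<sigma> = \<sigma>]) (use B(2) G(2) \<sigma> val_mono in auto)
      ultimately show ?thesis using True by (simp add: add_mono)
    qed simp
  qed
qed

end

section \<open>Posterior and marginal density of a single stream\<close>

context change_densities
begin

text \<open>Posterior of the event that the change point is below s, after s observations. It starts
  at 0 because no change point is negative; the first update therefore works with
  \<open>prior 0\<close>, which is \<theta>.\<close>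

fun pst :: "nat \<Rightarrow> (nat \<Rightarrow> 'x) \<Rightarrow> real" where
  "pst 0 z = 0"
| "pst (Suc s) z = upd (pst s z) (z (Suc s))"

text \<open>The marginal density of the first \<open>s\<close> observations of a stream, factored into one-step
  predictive densities.\<close>

fun wt :: "nat \<Rightarrow> (nat \<Rightarrow> 'x) \<Rightarrow> real" where
  "wt 0 z = 1"
| "wt (Suc s) z = wt s z * mix (pst s z) (z (Suc s))"

definition obs_density :: "nat \<Rightarrow> nat \<Rightarrow> 'x \<Rightarrow> real" where
  "obs_density n r = (if r \<le> n then f else g)"

lemma pst_cong: "(\<And>r. r \<in> {1..s} \<Longrightarrow> z r = z' r) \<Longrightarrow> pst s z = pst s z'"
  by (induction s) auto

lemma wt_cong: "(\<And>r. r \<in> {1..s} \<Longrightarrow> z r = z' r) \<Longrightarrow> wt s z = wt s z'"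
proof (induction s)
  case (Suc s)
  then show ?case using pst_cong[of s z z'] by auto
qed simp

lemma pst_bounds:
  assumes "\<And>r. r \<in> {1..s} \<Longrightarrow> z r \<in> space \<nu>" shows "0 \<le> pst s z" "pst s z \<le> 1"
  using assms by (cases s; auto intro: upd_bounds)+

lemma wt_nonneg: "(\<And>r. r \<in> {1..s} \<Longrightarrow> z r \<in> space \<nu>) \<Longrightarrow> 0 \<le> wt s z"
  by (induction s) (auto intro!: mult_nonneg_nonneg mix_nonneg)

lemma pst_measurable:
  "(\<And>r. r \<in> {1..s} \<Longrightarrow> Z r \<in> measurable L \<nu>) \<Longrightarrow> (\<lambda>\<omega>. pst s (\<lambda>r. Z r \<omega>)) \<in> borel_measurable L"
proof (induction s)
  case (Suc s)
  then have [measurable]: "(\<lambda>\<omega>. pst s (\<lambda>r. Z r \<omega>)) \<in> borel_measurable L" "Z (Suc s) \<in> measurable L \<nu>"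
    by auto
  have "(\<lambda>\<omega>. (pst s (\<lambda>r. Z r \<omega>), Z (Suc s) \<omega>)) \<in> measurable L (borel \<Otimes>\<^sub>M \<nu>)" by measurable
  from measurable_compose[OF this upd_measurable] show ?case by simp
qed simp

lemma wt_measurable:
  "(\<And>r. r \<in> {1..s} \<Longrightarrow> Z r \<in> measurable L \<nu>) \<Longrightarrow> (\<lambda>\<omega>. wt s (\<lambda>r. Z r \<omega>)) \<in> borel_measurable L"
proof (induction s)
  case (Suc s)
  have [measurable]: "(\<lambda>\<omega>. pst s (\<lambda>r. Z r \<omega>)) \<in> borel_measurable L" "Z (Suc s) \<in> measurable L \<nu>"
    "(\<lambda>\<omega>. wt s (\<lambda>r. Z r \<omega>)) \<in> borel_measurable L"
    using Suc by (auto intro: pst_measurable)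
  have "(\<lambda>\<omega>. (pst s (\<lambda>r. Z r \<omega>), Z (Suc s) \<omega>)) \<in> measurable L (borel \<Otimes>\<^sub>M \<nu>)" by measurable
  from measurable_compose[OF this mix_measurable] have [measurable]:
    "(\<lambda>\<omega>. mix (pst s (\<lambda>r. Z r \<omega>)) (Z (Suc s) \<omega>)) \<in> borel_measurable L" by simp
  show ?case by simp
qed simp

text \<open>Bayes' formula with the denominator cleared. It also holds where \<open>mix\<close>
  vanishes, since both of its nonnegative summands vanish there.\<close>

lemma mix_upd: assumes "x \<in> space \<nu>" shows "mix a x * upd a x = prior a * g x"
proof (cases "mix a x = 0")
  case True
  have "0 \<le> prior a * g x" "0 \<le> (1 - prior a) * f x"
    using prior_bounds[of a] f_nonneg[OF assms] g_nonneg[OF assms] by simp_all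
  then have "prior a * g x = 0" using True unfolding mix_def by linarith
  then show ?thesis using True by simp
qed (simp add: upd_def)

text \<open>The forward recursion of a two-state hidden Markov chain: \<open>wt * pst\<close> and
  \<open>wt * (1 - pst)\<close> are the unnormalized masses of the states changed and unchanged, and
  \<theta> is the probability of moving from the latter to the former.\<close>

lemma wt_pst_Suc:
  assumes z: "\<And>r. r \<in> {1..Suc s} \<Longrightarrow> z r \<in> space \<nu>"
  shows "wt (Suc s) z * pst (Suc s) z = (wt s z * pst s z + \<theta> * (wt s z * (1 - pst s z))) * g (z (Suc s))"
    and "wt (Suc s) z * (1 - pst (Suc s) z) = (1 - \<theta>) * (wt s z * (1 - pst s z)) * f (z (Suc s))"
proof -
  let ?a = "pst s z" and ?x = "z (Suc s)"
  have "0 \<le> ?a" "?a \<le> 1" using pst_bounds[of s z] z by auto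
  note p = prior_eq[OF this]
  have mu: "mix ?a ?x * upd ?a ?x = prior ?a * g ?x" by (rule mix_upd) (simp add: z)
  have "wt (Suc s) z * pst (Suc s) z = wt s z * (mix ?a ?x * upd ?a ?x)" by simp
  then show "wt (Suc s) z * pst (Suc s) z = (wt s z * ?a + \<theta> * (wt s z * (1 - ?a))) * g ?x"
    unfolding mu p by (simp add: algebra_simps)
  have "wt (Suc s) z * (1 - pst (Suc s) z) = wt s z * (mix ?a ?x - mix ?a ?x * upd ?a ?x)"
    by (simp add: algebra_simps)
  also have "\<dots> = wt s z * ((1 - prior ?a) * f ?x)" unfolding mu by (simp add: mix_def)
  finally show "wt (Suc s) z * (1 - pst (Suc s) z) = (1 - \<theta>) * (wt s z * (1 - ?a)) * f ?x"
    unfolding p by (simp add: algebra_simps)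
qed

lemma wt_not_changed:
  "(\<And>r. r \<in> {1..s} \<Longrightarrow> z r \<in> space \<nu>) \<Longrightarrow> wt s z * (1 - pst s z) = (1 - \<theta>) ^ s * (\<Prod>r\<in>{1..s}. f (z r))"
proof (induction s)
  case (Suc s)
  have "wt s z * (1 - pst s z) = (1 - \<theta>) ^ s * (\<Prod>r\<in>{1..s}. f (z r))" using Suc by auto
  then show ?case using wt_pst_Suc(2)[of s z] Suc.prems by (simp add: ac_simps prod.nat_ivl_Suc')
qed simp

lemma wt_changed:
  "(\<And>r. r \<in> {1..s} \<Longrightarrow> z r \<in> space \<nu>) \<Longrightarrow>
    wt s z * pst s z = (\<Sum>n<s. \<theta> * (1 - \<theta>) ^ n * (\<Prod>r\<in>{1..s}. obs_density n r (z r)))"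
proof (induction s)
  case (Suc s)
  have IH: "wt s z * pst s z = (\<Sum>n<s. \<theta> * (1 - \<theta>) ^ n * (\<Prod>r\<in>{1..s}. obs_density n r (z r)))"
    using Suc by auto
  \<comment> \<open>Every n below \<open>Suc s\<close> puts observation \<open>Suc s\<close> after
    the change, so \<open>g\<close> factors out. The new term n = s has density \<open>f\<close> for
    all earlier observations.\<close>
  have "(\<Sum>n<Suc s. \<theta> * (1 - \<theta>) ^ n * (\<Prod>r\<in>{1..Suc s}. obs_density n r (z r)))
    = (\<Sum>n<Suc s. \<theta> * (1 - \<theta>) ^ n * (\<Prod>r\<in>{1..s}. obs_density n r (z r))) * g (z (Suc s))"
    by (subst sum_distrib_right) (auto intro!: sum.cong simp: obs_density_def prod.nat_ivl_Suc')
  also have "(\<Sum>n<Suc s. \<theta> * (1 - \<theta>) ^ n * (\<Prod>r\<in>{1..s}. obs_density n r (z r)))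
    = wt s z * pst s z + \<theta> * ((1 - \<theta>) ^ s * (\<Prod>r\<in>{1..s}. f (z r)))"
    using IH by (simp add: obs_density_def)
  also have "(1 - \<theta>) ^ s * (\<Prod>r\<in>{1..s}. f (z r)) = wt s z * (1 - pst s z)"
    using wt_not_changed[of s z] Suc.prems by auto
  finally show ?case using wt_pst_Suc(1)[of s z] Suc.prems by simp
qed simp

lemma emeasure_geometric_atLeast: "emeasure (geometric_pmf \<theta>) {s..} = ennreal ((1 - \<theta>) ^ s)"
proof (induction s)
  case 0
  have "{0::nat..} = UNIV" by auto
  then show ?case using measure_pmf.emeasure_space_1[of "geometric_pmf \<theta>"] by simp
next
  case (Suc s)
  have "{s..} = insert s {Suc s..}" by auto
  then have "measure (geometric_pmf \<theta>) {s..} = measure (geometric_pmf \<theta>) {s} + measure (geometric_pmf \<theta>) {Suc s..}"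
    using measure_pmf.finite_measure_Union[of "{s}" "geometric_pmf \<theta>" "{Suc s..}"] by simp
  moreover have "measure (geometric_pmf \<theta>) {s..} = (1 - \<theta>) ^ s"
    using Suc theta by (simp add: measure_pmf.emeasure_eq_measure)
  moreover have "measure (geometric_pmf \<theta>) {s} = (1 - \<theta>) ^ s * \<theta>"
    using theta by (simp add: measure_pmf_single)
  ultimately have "measure (geometric_pmf \<theta>) {Suc s..} = (1 - \<theta>) ^ Suc s" by (simp add: algebra_simps)
  then show ?case by (simp add: measure_pmf.emeasure_eq_measure)
qed

lemma obs_density_nonneg: "x \<in> space \<nu> \<Longrightarrow> 0 \<le> obs_density n r x"
  using f_nonneg g_nonneg by (simp add: obs_density_def)

text \<open>This and the next two lemmas link the recursion to the model: integrating the likelihood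
  over the geometric change point, restricted to n < s, to n \<ge> s, or not at all, gives the two
  masses and their sum.\<close>

lemma geometric_changed:
  assumes z: "\<And>r. r \<in> {1..s} \<Longrightarrow> z r \<in> space \<nu>"
  shows "(\<integral>\<^sup>+n. indicator {..<s} n * (\<Prod>r\<in>{1..s}. ennreal (obs_density n r (z r))) \<partial>geometric_pmf \<theta>)
    = ennreal (wt s z * pst s z)"
proof -
  have d: "(\<Prod>r\<in>{1..s}. ennreal (obs_density n r (z r))) = ennreal (\<Prod>r\<in>{1..s}. obs_density n r (z r))" for n
    by (rule prod_ennreal) (intro obs_density_nonneg z)
  have nn: "0 \<le> (\<Prod>r\<in>{1..s}. obs_density n r (z r))" for n
    by (intro prod_nonneg obs_density_nonneg z)
  have "(\<integral>\<^sup>+n. indicator {..<s} n * (\<Prod>r\<in>{1..s}. ennreal (obs_density n r (z r))) \<partial>geometric_pmf \<theta>)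
    = (\<integral>\<^sup>+n. ennreal (pmf (geometric_pmf \<theta>) n) * (indicator {..<s} n * ennreal (\<Prod>r\<in>{1..s}. obs_density n r (z r))) \<partial>count_space UNIV)"
    unfolding nn_integral_measure_pmf d ..
  also have "\<dots> = (\<Sum>n<s. ennreal (pmf (geometric_pmf \<theta>) n) * (indicator {..<s} n * ennreal (\<Prod>r\<in>{1..s}. obs_density n r (z r))))"
    by (rule nn_integral_count_space') auto
  also have "\<dots> = (\<Sum>n<s. ennreal (\<theta> * (1 - \<theta>) ^ n * (\<Prod>r\<in>{1..s}. obs_density n r (z r))))"
    using theta by (intro sum.cong refl) (simp add: ennreal_mult' nn ac_simps)
  also have "\<dots> = ennreal (wt s z * pst s z)"
  proof -
    have e: "wt s z * pst s z = (\<Sum>n<s. \<theta> * (1 - \<theta>) ^ n * (\<Prod>r\<in>{1..s}. obs_density n r (z r)))"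
      by (rule wt_changed) (rule z)
    show ?thesis unfolding e using theta nn by (intro sum_ennreal) auto
  qed
  finally show ?thesis .
qed

lemma geometric_not_changed:
  assumes z: "\<And>r. r \<in> {1..s} \<Longrightarrow> z r \<in> space \<nu>"
  shows "(\<integral>\<^sup>+n. indicator {s..} n * (\<Prod>r\<in>{1..s}. ennreal (obs_density n r (z r))) \<partial>geometric_pmf \<theta>)
    = ennreal (wt s z * (1 - pst s z))"
proof -
  have "(\<integral>\<^sup>+n. indicator {s..} n * (\<Prod>r\<in>{1..s}. ennreal (obs_density n r (z r))) \<partial>geometric_pmf \<theta>)
    = (\<integral>\<^sup>+n. ennreal (\<Prod>r\<in>{1..s}. f (z r)) * indicator {s..} n \<partial>geometric_pmf \<theta>)"
  proof (rule nn_integral_cong)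
    fix n
    have "(\<Prod>r\<in>{1..s}. ennreal (obs_density n r (z r))) = ennreal (\<Prod>r\<in>{1..s}. f (z r))" if "s \<le> n"
      using that f_nonneg z by (subst prod_ennreal[symmetric]) (auto intro!: prod.cong simp: obs_density_def)
    then show "indicator {s..} n * (\<Prod>r\<in>{1..s}. ennreal (obs_density n r (z r))) = ennreal (\<Prod>r\<in>{1..s}. f (z r)) * indicator {s..} n"
      by (auto simp: indicator_def)
  qed
  also have "\<dots> = ennreal (\<Prod>r\<in>{1..s}. f (z r)) * ennreal ((1 - \<theta>) ^ s)"
    by (simp add: nn_integral_cmult emeasure_geometric_atLeast)
  also have "\<dots> = ennreal (wt s z * (1 - pst s z))"
  proof -
    have e: "wt s z * (1 - pst s z) = (1 - \<theta>) ^ s * (\<Prod>r\<in>{1..s}. f (z r))"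
      by (rule wt_not_changed) (rule z)
    have "0 \<le> (\<Prod>r\<in>{1..s}. f (z r))" by (intro prod_nonneg f_nonneg z)
    then show ?thesis unfolding e using theta by (simp add: ennreal_mult mult.commute)
  qed
  finally show ?thesis .
qed

lemma geometric_total:
  assumes z: "\<And>r. r \<in> {1..s} \<Longrightarrow> z r \<in> space \<nu>"
  shows "(\<integral>\<^sup>+n. (\<Prod>r\<in>{1..s}. ennreal (obs_density n r (z r))) \<partial>geometric_pmf \<theta>) = ennreal (wt s z)"
proof -
  have "(\<integral>\<^sup>+n. (\<Prod>r\<in>{1..s}. ennreal (obs_density n r (z r))) \<partial>geometric_pmf \<theta>)
    = (\<integral>\<^sup>+n. indicator {..<s} n * (\<Prod>r\<in>{1..s}. ennreal (obs_density n r (z r)))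
        + indicator {s..} n * (\<Prod>r\<in>{1..s}. ennreal (obs_density n r (z r))) \<partial>geometric_pmf \<theta>)"
    by (rule nn_integral_cong) (auto simp: indicator_def)
  also have "\<dots> = ennreal (wt s z * pst s z) + ennreal (wt s z * (1 - pst s z))"
  proof -
    have "(\<integral>\<^sup>+n. indicator {..<s} n * (\<Prod>r\<in>{1..s}. ennreal (obs_density n r (z r))) \<partial>geometric_pmf \<theta>) = ennreal (wt s z * pst s z)"
      "(\<integral>\<^sup>+n. indicator {s..} n * (\<Prod>r\<in>{1..s}. ennreal (obs_density n r (z r))) \<partial>geometric_pmf \<theta>) = ennreal (wt s z * (1 - pst s z))"
      by (intro geometric_changed geometric_not_changed z; assumption)+
    then show ?thesis by (subst nn_integral_add) simp_all
  qed
  also have "\<dots> = ennreal (wt s z)"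
  proof -
    have "0 \<le> wt s z" "0 \<le> pst s z" "pst s z \<le> 1"
      by (intro wt_nonneg pst_bounds z; assumption)+
    then show ?thesis by (subst ennreal_plus[symmetric]) (auto simp: mult_left_le algebra_simps intro: mult_left_le_one_le)
  qed
  finally show ?thesis .
qed

end

declare One_nat_def [simp del]

section \<open>The law of the observations\<close>

text \<open>Only finite change points occur in \<open>joint\<close>. Their probabilities already sum
  to 1, so infinite values have probability zero; see \<open>AE_ev\<close>.\<close>

locale geometric_streams = change_densities \<nu> f g \<theta> + obs: prob_space M
  for \<nu> :: "'x measure" and f g :: "'x \<Rightarrow> real" and \<theta> :: real and M :: "'w measure" +
  fixes K :: nat and \<tau> :: "nat \<Rightarrow> 'w \<Rightarrow> enat" and X :: "nat \<Rightarrow> nat \<Rightarrow> 'w \<Rightarrow> 'x"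
  assumes tau_meas: "k \<in> {1..K} \<Longrightarrow> \<tau> k \<in> measurable M (count_space UNIV)"
    and X_meas: "k \<in> {1..K} \<Longrightarrow> 1 \<le> t \<Longrightarrow> X k t \<in> measurable M \<nu>"
    and joint: "finite F \<Longrightarrow> F \<subseteq> {1..K} \<times> {1..} \<Longrightarrow> (\<And>kt. kt \<in> F \<Longrightarrow> B kt \<in> sets \<nu>) \<Longrightarrow>
      emeasure M {\<omega>\<in>space M. (\<forall>k\<in>{1..K}. \<tau> k \<omega> = enat (v k)) \<and> (\<forall>(k, t)\<in>F. X k t \<omega> \<in> B (k, t))}
      = (\<Prod>k\<in>{1..K}. ennreal (\<theta> * (1 - \<theta>) ^ v k)) *
        (\<Prod>(k, t)\<in>F. emeasure (density \<nu> (\<lambda>x. ennreal (obs_density (v k) t x))) (B (k, t)))"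
begin

definition grid :: "nat \<Rightarrow> (nat \<times> nat) set" where "grid s = {1..K} \<times> {1..s}"

definition hist :: "nat \<Rightarrow> 'w \<Rightarrow> nat \<times> nat \<Rightarrow> 'x" where
  "hist s \<omega> = (\<lambda>kr\<in>grid s. X (fst kr) (snd kr) \<omega>)"

definition hist_space :: "nat \<Rightarrow> (nat \<times> nat \<Rightarrow> 'x) measure" where "hist_space s = PiM (grid s) (\<lambda>_. \<nu>)"

definition ev :: "(nat \<Rightarrow> nat) \<Rightarrow> 'w set" where
  "ev v = {\<omega>\<in>space M. \<forall>k\<in>{1..K}. \<tau> k \<omega> = enat (v k)}"

lemma finite_grid[simp]: "finite (grid s)" by (simp add: grid_def)

lemma hist_measurable[measurable]: "hist s \<in> measurable M (hist_space s)"
  unfolding hist_def hist_space_def by (rule measurable_restrict) (auto simp: grid_def intro: X_meas)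

lemma ev_sets[measurable]: "ev v \<in> sets M"
  unfolding ev_def
proof (rule sets.sets_Collect_finite_All)
  fix k assume k: "k \<in> {1..K}"
  have "\<tau> k -` {enat (v k)} \<inter> space M \<in> sets M"
    using tau_meas[OF k] by (rule measurable_sets) simp
  also have "\<tau> k -` {enat (v k)} \<inter> space M = {\<omega>\<in>space M. \<tau> k \<omega> = enat (v k)}" by auto
  finally show "{\<omega>\<in>space M. \<tau> k \<omega> = enat (v k)} \<in> sets M" .
qed simp

lemma emeasure_ev: "emeasure M (ev v) = (\<Prod>k\<in>{1..K}. ennreal (\<theta> * (1 - \<theta>) ^ v k))"
  using joint[of "{}" "\<lambda>_. {}" v] by (simp add: ev_def)

lemma emeasure_ev_nz: "emeasure M (ev v) \<noteq> 0" "emeasure M (ev v) \<noteq> top"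
  using theta by (auto simp: emeasure_ev ennreal_prod_eq_top)

lemma obs_density_measurable[measurable]: "obs_density n r \<in> borel_measurable \<nu>"
  unfolding obs_density_def by (cases "r \<le> n") simp_all

lemma obs_density_one: "(\<integral>\<^sup>+x. ennreal (obs_density n r x) \<partial>\<nu>) = 1"
  by (simp add: obs_density_def f_one g_one)

text \<open>The event \<open>ev v\<close> has positive probability, so conditioning is elementary,
  and on rectangles the claim is \<open>joint\<close> divided by
  \<open>emeasure M (ev v)\<close>.\<close>

lemma conditional_law:
  "distr (uniform_measure M (ev v)) (hist_space s) (hist s)
    = PiM (grid s) (\<lambda>kr. density \<nu> (\<lambda>x. ennreal (obs_density (v (fst kr)) (snd kr) x)))"
proof -
  let ?D = "\<lambda>kr. density \<nu> (\<lambda>x. ennreal (obs_density (v (fst kr)) (snd kr) x))"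
  have "prob_space (?D kr)" for kr
    by (rule prob_spaceI) (simp add: emeasure_density obs_density_one cong: nn_integral_cong)
  then interpret P: product_sigma_finite ?D
    by (auto simp: product_sigma_finite_def prob_space_def finite_measure_def)
  have hm: "hist s \<in> measurable (uniform_measure M (ev v)) (hist_space s)" by measurable
  show ?thesis
  proof (rule P.PiM_eqI)
    show "sets (distr (uniform_measure M (ev v)) (hist_space s) (hist s)) = sets (PiM (grid s) ?D)"
      by (simp add: hist_space_def cong: sets_PiM_cong)
    fix A assume A: "\<And>i. i \<in> grid s \<Longrightarrow> A i \<in> sets (?D i)"
    then have A': "\<And>i. i \<in> grid s \<Longrightarrow> A i \<in> sets \<nu>" by simp
    have PA: "Pi\<^sub>E (grid s) A \<in> sets (hist_space s)" unfolding hist_space_def by (rule sets_PiM_I_finite) (use A' in auto)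
    have eq: "ev v \<inter> (hist s -` Pi\<^sub>E (grid s) A \<inter> space M)
      = {\<omega>\<in>space M. (\<forall>k\<in>{1..K}. \<tau> k \<omega> = enat (v k)) \<and> (\<forall>(k, t)\<in>grid s. X k t \<omega> \<in> A (k, t))}"
    proof -
      have "hist s \<omega> \<in> Pi\<^sub>E (grid s) A \<longleftrightarrow> (\<forall>(k, t)\<in>grid s. X k t \<omega> \<in> A (k, t))" for \<omega>
        by (simp add: hist_def PiE_iff case_prod_unfold)
      then show ?thesis by (auto simp: ev_def)
    qed
    have "emeasure (distr (uniform_measure M (ev v)) (hist_space s) (hist s)) (Pi\<^sub>E (grid s) A)
      = emeasure (uniform_measure M (ev v)) (hist s -` Pi\<^sub>E (grid s) A \<inter> space M)"
      by (subst emeasure_distr[OF hm PA]) simp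
    also have "\<dots> = emeasure M (ev v \<inter> (hist s -` Pi\<^sub>E (grid s) A \<inter> space M)) / emeasure M (ev v)"
      by (rule emeasure_uniform_measure) (use measurable_sets[OF hist_measurable PA] in auto)
    also have "emeasure M (ev v \<inter> (hist s -` Pi\<^sub>E (grid s) A \<inter> space M))
      = emeasure M (ev v) * (\<Prod>(k, t)\<in>grid s. emeasure (density \<nu> (\<lambda>x. ennreal (obs_density (v k) t x))) (A (k, t)))"
      unfolding eq emeasure_ev by (rule joint) (use A' in \<open>auto simp: grid_def\<close>)
    also have "\<dots> / emeasure M (ev v) = (\<Prod>(k, t)\<in>grid s. emeasure (density \<nu> (\<lambda>x. ennreal (obs_density (v k) t x))) (A (k, t)))"
      using emeasure_ev_nz[of v] by (subst mult.commute) (rule ennreal_mult_divide_eq)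
    finally show "emeasure (distr (uniform_measure M (ev v)) (hist_space s) (hist s)) (Pi\<^sub>E (grid s) A)
      = (\<Prod>i\<in>grid s. emeasure (?D i) (A i))" by (simp add: case_prod_unfold)
  qed simp
qed

lemma nn_integral_ev:
  assumes h[measurable]: "h \<in> borel_measurable (hist_space s)"
  shows "(\<integral>\<^sup>+\<omega>. h (hist s \<omega>) * indicator (ev v) \<omega> \<partial>M)
    = emeasure M (ev v) * (\<integral>\<^sup>+y. (\<Prod>kr\<in>grid s. ennreal (obs_density (v (fst kr)) (snd kr) (y kr))) * h y \<partial>hist_space s)"
proof -
  let ?D = "\<lambda>kr. density \<nu> (\<lambda>x. ennreal (obs_density (v (fst kr)) (snd kr) x))"
  have D: "PiM (grid s) ?D = density (hist_space s) (\<lambda>y. \<Prod>kr\<in>grid s. ennreal (obs_density (v (fst kr)) (snd kr) (y kr)))"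
    unfolding hist_space_def by (rule PiM_density) (auto simp: obs_density_one intro: prob_space_axioms)
  have "(\<integral>\<^sup>+\<omega>. h (hist s \<omega>) * indicator (ev v) \<omega> \<partial>M) / emeasure M (ev v)
    = (\<integral>\<^sup>+\<omega>. h (hist s \<omega>) \<partial>uniform_measure M (ev v))"
    by (rule nn_integral_uniform_measure[symmetric]) measurable
  also have "\<dots> = (\<integral>\<^sup>+y. h y \<partial>distr (uniform_measure M (ev v)) (hist_space s) (hist s))"
    by (rule nn_integral_distr[symmetric]) measurable
  also have "\<dots> = (\<integral>\<^sup>+y. (\<Prod>kr\<in>grid s. ennreal (obs_density (v (fst kr)) (snd kr) (y kr))) * h y \<partial>hist_space s)"
    unfolding conditional_law D by (rule nn_integral_density) (use h in \<open>simp_all add: hist_space_def\<close>)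
  finally have "emeasure M (ev v) * ((\<integral>\<^sup>+\<omega>. h (hist s \<omega>) * indicator (ev v) \<omega> \<partial>M) / emeasure M (ev v))
    = emeasure M (ev v) * (\<integral>\<^sup>+y. (\<Prod>kr\<in>grid s. ennreal (obs_density (v (fst kr)) (snd kr) (y kr))) * h y \<partial>hist_space s)"
    by simp
  then show ?thesis
    unfolding ennreal_times_divide mult.commute[of "emeasure M (ev v)" "nn_integral M _"]
      ennreal_mult_divide_eq[OF emeasure_ev_nz(1,2)] .
qed

text \<open>The default value 0 outside \<open>{1..K}\<close> gives each tuple of change points
  exactly one representative, which makes the events \<open>ev\<close> disjoint over the
  support.\<close>

abbreviation tau_pmf :: "(nat \<Rightarrow> nat) pmf" where
  "tau_pmf \<equiv> Pi_pmf {1..K} 0 (\<lambda>_. geometric_pmf \<theta>)"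

definition tau_support :: "(nat \<Rightarrow> nat) set" where "tau_support = set_pmf tau_pmf"

lemma tau_support_iff: "v \<in> tau_support \<longleftrightarrow> (\<forall>k. k \<notin> {1..K} \<longrightarrow> v k = 0)"
  unfolding tau_support_def using theta by (auto simp: set_Pi_pmf PiE_dflt_def set_pmf_geometric)

lemma countable_tau_support[simp]: "countable tau_support" by (simp add: tau_support_def)

lemma pmf_tau: "v \<in> tau_support \<Longrightarrow> ennreal (pmf tau_pmf v) = emeasure M (ev v)"
  using theta by (subst pmf_Pi') (auto simp: tau_support_iff emeasure_ev prod_ennreal mult.commute)

lemma nn_integral_tau: "(\<integral>\<^sup>+v. \<phi> v \<partial>tau_pmf) = (\<integral>\<^sup>+v. emeasure M (ev v) * \<phi> v \<partial>count_space tau_support)"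
proof -
  have "(\<integral>\<^sup>+v. \<phi> v \<partial>tau_pmf) = (\<integral>\<^sup>+v. ennreal (pmf tau_pmf v) * \<phi> v \<partial>count_space UNIV)"
    by (rule nn_integral_measure_pmf)
  also have "\<dots> = (\<integral>\<^sup>+v. ennreal (pmf tau_pmf v) * \<phi> v \<partial>count_space tau_support)"
    by (rule nn_integral_count_space_eq) (auto simp: tau_support_def set_pmf_iff)
  also have "\<dots> = (\<integral>\<^sup>+v. emeasure M (ev v) * \<phi> v \<partial>count_space tau_support)"
    by (rule nn_integral_cong) (simp add: pmf_tau)
  finally show ?thesis .
qed

lemma ev_disjoint: "disjoint_family_on ev tau_support"
proof (unfold disjoint_family_on_def, safe)
  fix v w \<omega> assume *: "v \<in> tau_support" "w \<in> tau_support" "v \<noteq> w" "\<omega> \<in> ev v" "\<omega> \<in> ev w"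
  have "v k = w k" for k using * by (cases "k \<in> {1..K}") (auto simp: ev_def tau_support_iff)
  then show "\<omega> \<in> {}" using *(3) by auto
qed

text \<open>The probabilities of these countably many disjoint events are the masses of
  \<open>tau_pmf\<close>, so they add up to 1.\<close>

lemma AE_ev: "AE \<omega> in M. \<exists>v\<in>tau_support. \<omega> \<in> ev v"
proof -
  have "emeasure M (\<Union>v\<in>tau_support. ev v) = (\<integral>\<^sup>+v. emeasure M (ev v) \<partial>count_space tau_support)"
    by (rule emeasure_UN_countable) (use ev_disjoint in auto)
  also have "\<dots> = (\<integral>\<^sup>+v. 1 \<partial>tau_pmf)" by (subst nn_integral_tau) simp
  also have "\<dots> = 1" using measure_pmf.emeasure_space_1[of tau_pmf] by simp
  finally have "AE \<omega> in M. \<omega> \<in> (\<Union>v\<in>tau_support. ev v)"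
    by (intro obs.AE_prob_1) (simp add: obs.emeasure_eq_measure)
  then show ?thesis by simp
qed

text \<open>Splitting over the values of the change points gives a sum that is exchanged with the
  integral over the data. For fixed data, weight and likelihood are both products over streams and
  the prior is a product law, so the sum over all tuples factors. The weight \<gamma> will be 1 or
  single out one stream.\<close>

lemma joint_law:
  fixes \<gamma> :: "nat \<Rightarrow> nat \<Rightarrow> ennreal"
  assumes h[measurable]: "h \<in> borel_measurable (hist_space s)"
  shows "(\<integral>\<^sup>+\<omega>. (\<Prod>k\<in>{1..K}. \<gamma> k (the_enat (\<tau> k \<omega>))) * h (hist s \<omega>) \<partial>M)
    = (\<integral>\<^sup>+y. (\<Prod>k\<in>{1..K}. \<integral>\<^sup>+n. \<gamma> k n * (\<Prod>r\<in>{1..s}. ennreal (obs_density n r (y (k, r)))) \<partial>geometric_pmf \<theta>) * h y \<partial>hist_space s)"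
proof -
  define \<Gamma> where "\<Gamma> v = (\<Prod>k\<in>{1..K}. \<gamma> k (v k))" for v :: "nat \<Rightarrow> nat"
  let ?d = "\<lambda>v y. \<Prod>kr\<in>grid s. ennreal (obs_density (v (fst kr)) (snd kr) (y kr))"
  have dm[measurable]: "?d v \<in> borel_measurable (hist_space s)" for v by (simp add: hist_space_def)
  interpret hist_space: prob_space "hist_space s" unfolding hist_space_def by (rule prob_space_PiM) (rule prob_space_axioms)
  interpret C: sigma_finite_measure "count_space tau_support" by (rule sigma_finite_measure_count_space_countable) simp
  interpret CM: pair_sigma_finite "count_space tau_support" M by standard
  interpret CH: pair_sigma_finite "count_space tau_support" "hist_space s" by standard
  have "(\<integral>\<^sup>+\<omega>. (\<Prod>k\<in>{1..K}. \<gamma> k (the_enat (\<tau> k \<omega>))) * h (hist s \<omega>) \<partial>M)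
    = (\<integral>\<^sup>+\<omega>. \<integral>\<^sup>+v. \<Gamma> v * (h (hist s \<omega>) * indicator (ev v) \<omega>) \<partial>count_space tau_support \<partial>M)"
  proof (rule nn_integral_cong_AE)
    show "AE \<omega> in M. (\<Prod>k\<in>{1..K}. \<gamma> k (the_enat (\<tau> k \<omega>))) * h (hist s \<omega>)
      = (\<integral>\<^sup>+v. \<Gamma> v * (h (hist s \<omega>) * indicator (ev v) \<omega>) \<partial>count_space tau_support)"
      using AE_ev
    proof eventually_elim
      case (elim \<omega>)
      then obtain v where v: "v \<in> tau_support" "\<omega> \<in> ev v" by blast
      have other: "\<omega> \<notin> ev w" if "w \<in> tau_support" "w \<noteq> v" for w
        using ev_disjoint v that by (auto simp: disjoint_family_on_def)
      have "(\<integral>\<^sup>+w. \<Gamma> w * (h (hist s \<omega>) * indicator (ev w) \<omega>) \<partial>count_space tau_support)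
        = (\<Sum>w\<in>{v}. \<Gamma> w * (h (hist s \<omega>) * indicator (ev w) \<omega>))"
        by (rule nn_integral_count_space') (use v other in auto)
      also have "\<dots> = \<Gamma> v * h (hist s \<omega>)" using v by simp
      also have "\<Gamma> v = (\<Prod>k\<in>{1..K}. \<gamma> k (the_enat (\<tau> k \<omega>)))"
        unfolding \<Gamma>_def using v by (intro prod.cong) (auto simp: ev_def)
      finally show ?case by simp
    qed
  qed
  also have "\<dots> = (\<integral>\<^sup>+v. \<integral>\<^sup>+\<omega>. \<Gamma> v * (h (hist s \<omega>) * indicator (ev v) \<omega>) \<partial>M \<partial>count_space tau_support)"
    by (rule CM.Fubini') (rule measurable_pair_measure_countable1; simp)
  also have "\<dots> = (\<integral>\<^sup>+v. \<integral>\<^sup>+y. emeasure M (ev v) * (\<Gamma> v * ?d v y) * h y \<partial>hist_space s \<partial>count_space tau_support)"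
  proof (rule nn_integral_cong)
    fix v
    have "(\<integral>\<^sup>+\<omega>. \<Gamma> v * (h (hist s \<omega>) * indicator (ev v) \<omega>) \<partial>M)
      = \<Gamma> v * (emeasure M (ev v) * (\<integral>\<^sup>+y. ?d v y * h y \<partial>hist_space s))"
      by (subst nn_integral_cmult) (simp_all add: nn_integral_ev)
    also have "\<dots> = (\<Gamma> v * emeasure M (ev v)) * (\<integral>\<^sup>+y. ?d v y * h y \<partial>hist_space s)" by (simp add: mult.assoc)
    also have "\<dots> = (\<integral>\<^sup>+y. (\<Gamma> v * emeasure M (ev v)) * (?d v y * h y) \<partial>hist_space s)"
      by (rule nn_integral_cmult[symmetric]) simp
    finally show "(\<integral>\<^sup>+\<omega>. \<Gamma> v * (h (hist s \<omega>) * indicator (ev v) \<omega>) \<partial>M)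
      = (\<integral>\<^sup>+y. emeasure M (ev v) * (\<Gamma> v * ?d v y) * h y \<partial>hist_space s)" by (simp add: ac_simps)
  qed
  also have "\<dots> = (\<integral>\<^sup>+y. \<integral>\<^sup>+v. emeasure M (ev v) * (\<Gamma> v * ?d v y) * h y \<partial>count_space tau_support \<partial>hist_space s)"
    by (rule CH.Fubini'[symmetric]) (rule measurable_pair_measure_countable1; simp)
  also have "\<dots> = (\<integral>\<^sup>+y. (\<integral>\<^sup>+v. \<Gamma> v * ?d v y \<partial>tau_pmf) * h y \<partial>hist_space s)"
    by (intro nn_integral_cong) (simp add: nn_integral_tau nn_integral_multc)
  also have "\<dots> = (\<integral>\<^sup>+y. (\<Prod>k\<in>{1..K}. \<integral>\<^sup>+n. \<gamma> k n * (\<Prod>r\<in>{1..s}. ennreal (obs_density n r (y (k, r)))) \<partial>geometric_pmf \<theta>) * h y \<partial>hist_space s)"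
  proof (rule nn_integral_cong)
    fix y
    have "\<Gamma> v * ?d v y = (\<Prod>k\<in>{1..K}. \<gamma> k (v k) * (\<Prod>r\<in>{1..s}. ennreal (obs_density (v k) r (y (k, r)))))" for v
      unfolding \<Gamma>_def grid_def by (simp add: prod.distrib prod.cartesian_product case_prod_unfold)
    then have "(\<integral>\<^sup>+v. \<Gamma> v * ?d v y \<partial>tau_pmf)
      = (\<Prod>k\<in>{1..K}. \<integral>\<^sup>+n. \<gamma> k n * (\<Prod>r\<in>{1..s}. ennreal (obs_density n r (y (k, r)))) \<partial>geometric_pmf \<theta>)"
      using nn_integral_prod_Pi_pmf[of "{1..K}" 0 "\<lambda>_. geometric_pmf \<theta>"
          "\<lambda>k n. \<gamma> k n * (\<Prod>r\<in>{1..s}. ennreal (obs_density n r (y (k, r))))"] by simp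
    then show "(\<integral>\<^sup>+v. \<Gamma> v * ?d v y \<partial>tau_pmf) * h y
      = (\<Prod>k\<in>{1..K}. \<integral>\<^sup>+n. \<gamma> k n * (\<Prod>r\<in>{1..s}. ennreal (obs_density n r (y (k, r)))) \<partial>geometric_pmf \<theta>) * h y"
      by simp
  qed
  finally show ?thesis .
qed

end

section \<open>Posterior vector and transition law given the full history\<close>

context geometric_streams
begin

definition pvec :: "nat \<Rightarrow> (nat \<times> nat \<Rightarrow> 'x) \<Rightarrow> nat \<Rightarrow> real" where
  "pvec s y = (\<lambda>i. if i \<in> {1..K} then pst s (\<lambda>r. y (i, r)) else 0)"

definition post :: "nat \<Rightarrow> 'w \<Rightarrow> nat \<Rightarrow> real" where
  "post s \<omega> = (\<lambda>i. if i \<in> {1..K} then pst s (\<lambda>r. X i r \<omega>) else 0)"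

lemma pvec_hist: "pvec s (hist s \<omega>) = post s \<omega>"
  by (auto simp: pvec_def post_def hist_def grid_def fun_eq_iff intro!: pst_cong)

lemma component_measurable:
  assumes "k \<in> {1..K}" "r \<in> {1..s}" shows "(\<lambda>y. y (k, r)) \<in> measurable (hist_space s) \<nu>"
  unfolding hist_space_def by (rule measurable_component_singleton) (use assms in \<open>simp add: grid_def\<close>)

lemma space_hist_space:
  assumes "y \<in> space (hist_space s)" "k \<in> {1..K}" "r \<in> {1..s}" shows "y (k, r) \<in> space \<nu>"
  using measurable_space[OF component_measurable[OF assms(2,3)] assms(1)] .

lemma pvec_component_measurable[measurable]: "(\<lambda>y. pvec s y i) \<in> borel_measurable (hist_space s)"
proof (cases "i \<in> {1..K}")
  case True
  then have "(\<lambda>y. pst s (\<lambda>r. y (i, r))) \<in> borel_measurable (hist_space s)"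
    by (intro pst_measurable component_measurable)
  then show ?thesis using True by (simp add: pvec_def)
next
  case False
  then have "(\<lambda>y. pvec s y i) = (\<lambda>_. 0)" by (auto simp: pvec_def fun_eq_iff)
  then show ?thesis by simp
qed

lemma pvec_measurable[measurable]: "pvec s \<in> measurable (hist_space s) (PiM UNIV (\<lambda>_. borel))"
  by (rule measurable_PiM_single') (auto simp: PiE_def)

lemma post_measurable[measurable]: "post s \<in> measurable M (PiM UNIV (\<lambda>_. borel))"
  using measurable_compose[OF hist_measurable pvec_measurable] by (simp add: pvec_hist)

lemma post_component_measurable[measurable]: "(\<lambda>\<omega>. post s \<omega> i) \<in> borel_measurable M"
  using measurable_compose[OF hist_measurable pvec_component_measurable] by (simp add: pvec_hist)

lemma post_bounds:
  assumes "\<omega> \<in> space M" shows "0 \<le> post s \<omega> i" "post s \<omega> i \<le> 1"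
proof -
  have "X i r \<omega> \<in> space \<nu>" if "i \<in> {1..K}" "r \<in> {1..s}" for r
    using measurable_space[OF X_meas assms] that by simp
  then have "0 \<le> pst s (\<lambda>r. X i r \<omega>)" "pst s (\<lambda>r. X i r \<omega>) \<le> 1" if "i \<in> {1..K}"
    using that by (intro pst_bounds; simp)+
  then show "0 \<le> post s \<omega> i" "post s \<omega> i \<le> 1" by (auto simp: post_def)
qed

lemma history_law:
  assumes h: "h \<in> borel_measurable (hist_space s)"
  shows "(\<integral>\<^sup>+\<omega>. h (hist s \<omega>) \<partial>M)
    = (\<integral>\<^sup>+y. (\<Prod>k\<in>{1..K}. ennreal (wt s (\<lambda>r. y (k, r)))) * h y \<partial>hist_space s)"
proof -
  have "(\<integral>\<^sup>+n. 1 * (\<Prod>r\<in>{1..s}. ennreal (obs_density n r (y (k, r)))) \<partial>geometric_pmf \<theta>) = ennreal (wt s (\<lambda>r. y (k, r)))"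
    if "k \<in> {1..K}" "y \<in> space (hist_space s)" for k y
    unfolding mult_1_left by (rule geometric_total) (use space_hist_space that in blast)
  then have "(\<integral>\<^sup>+y. (\<Prod>k\<in>{1..K}. \<integral>\<^sup>+n. 1 * (\<Prod>r\<in>{1..s}. ennreal (obs_density n r (y (k, r)))) \<partial>geometric_pmf \<theta>) * h y \<partial>hist_space s)
    = (\<integral>\<^sup>+y. (\<Prod>k\<in>{1..K}. ennreal (wt s (\<lambda>r. y (k, r)))) * h y \<partial>hist_space s)"
    by (intro nn_integral_cong arg_cong2[where f = "(*)"] prod.cong refl) auto
  then show ?thesis using joint_law[OF h, of "\<lambda>_ _. 1"] by simp
qed

text \<open>Says that \<open>post s\<close> is the conditional probability given all observations up
  to s. With the indicator on stream \<open>k0\<close> alone, every other stream contributes only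
  its marginal density and \<open>k0\<close> contributes an extra factor \<open>pst\<close>.\<close>

lemma posterior_law:
  assumes h[measurable]: "h \<in> borel_measurable (hist_space s)" and k0: "k0 \<in> {1..K}"
  shows "(\<integral>\<^sup>+\<omega>. indicator {\<omega>\<in>space M. \<tau> k0 \<omega> < enat s} \<omega> * h (hist s \<omega>) \<partial>M)
    = (\<integral>\<^sup>+\<omega>. ennreal (post s \<omega> k0) * h (hist s \<omega>) \<partial>M)"
proof -
  define \<gamma> :: "nat \<Rightarrow> nat \<Rightarrow> ennreal" where "\<gamma> k n = (if k = k0 then indicator {..<s} n else 1)" for k n
  have "(\<integral>\<^sup>+\<omega>. indicator {\<omega>\<in>space M. \<tau> k0 \<omega> < enat s} \<omega> * h (hist s \<omega>) \<partial>M)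
    = (\<integral>\<^sup>+\<omega>. (\<Prod>k\<in>{1..K}. \<gamma> k (the_enat (\<tau> k \<omega>))) * h (hist s \<omega>) \<partial>M)"
  proof (rule nn_integral_cong_AE)
    show "AE \<omega> in M. indicator {\<omega>\<in>space M. \<tau> k0 \<omega> < enat s} \<omega> * h (hist s \<omega>)
      = (\<Prod>k\<in>{1..K}. \<gamma> k (the_enat (\<tau> k \<omega>))) * h (hist s \<omega>)"
      using AE_ev
    proof eventually_elim
      case (elim \<omega>)
      then obtain v where "\<omega> \<in> ev v" by blast
      then have v: "\<omega> \<in> space M" "\<tau> k0 \<omega> = enat (v k0)" using k0 by (auto simp: ev_def)
      have "(\<Prod>k\<in>{1..K}. \<gamma> k (the_enat (\<tau> k \<omega>))) = indicator {..<s} (v k0)"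
        using k0 v unfolding \<gamma>_def by (simp add: if_distrib prod.delta)
      then show ?case using v by (auto simp: indicator_def)
    qed
  qed
  also have "\<dots> = (\<integral>\<^sup>+y. (\<Prod>k\<in>{1..K}. ennreal (wt s (\<lambda>r. y (k, r)))) * (ennreal (pvec s y k0) * h y) \<partial>hist_space s)"
    unfolding joint_law[OF h]
  proof (rule nn_integral_cong)
    fix y assume y: "y \<in> space (hist_space s)"
    have "(\<integral>\<^sup>+n. \<gamma> k n * (\<Prod>r\<in>{1..s}. ennreal (obs_density n r (y (k, r)))) \<partial>geometric_pmf \<theta>)
      = ennreal (wt s (\<lambda>r. y (k, r))) * (if k = k0 then ennreal (pvec s y k0) else 1)" if k: "k \<in> {1..K}" for k
    proof (cases "k = k0")
      case True
      have "(\<integral>\<^sup>+n. indicator {..<s} n * (\<Prod>r\<in>{1..s}. ennreal (obs_density n r (y (k, r)))) \<partial>geometric_pmf \<theta>)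
        = ennreal (wt s (\<lambda>r. y (k, r)) * pst s (\<lambda>r. y (k, r)))"
        by (rule geometric_changed) (use space_hist_space y k in blast)
      also have "\<dots> = ennreal (wt s (\<lambda>r. y (k, r))) * ennreal (pst s (\<lambda>r. y (k, r)))"
      proof (rule ennreal_mult)
        have "y (k, r) \<in> space \<nu>" if "r \<in> {1..s}" for r by (rule space_hist_space[OF y k that])
        then show "0 \<le> wt s (\<lambda>r. y (k, r))" "0 \<le> pst s (\<lambda>r. y (k, r))"
          by (intro wt_nonneg pst_bounds; assumption)+
      qed
      finally show ?thesis using True k0 by (simp add: \<gamma>_def pvec_def)
    next
      case False
      have "(\<integral>\<^sup>+n. (\<Prod>r\<in>{1..s}. ennreal (obs_density n r (y (k, r)))) \<partial>geometric_pmf \<theta>)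
        = ennreal (wt s (\<lambda>r. y (k, r)))"
        by (rule geometric_total) (use space_hist_space y k in blast)
      then show ?thesis using False by (simp add: \<gamma>_def)
    qed
    then have "(\<Prod>k\<in>{1..K}. \<integral>\<^sup>+n. \<gamma> k n * (\<Prod>r\<in>{1..s}. ennreal (obs_density n r (y (k, r)))) \<partial>geometric_pmf \<theta>)
      = (\<Prod>k\<in>{1..K}. ennreal (wt s (\<lambda>r. y (k, r))) * (if k = k0 then ennreal (pvec s y k0) else 1))"
      by (intro prod.cong) auto
    also have "\<dots> = (\<Prod>k\<in>{1..K}. ennreal (wt s (\<lambda>r. y (k, r)))) * ennreal (pvec s y k0)"
      using k0 by (simp add: prod.distrib prod.delta)
    finally show "(\<Prod>k\<in>{1..K}. \<integral>\<^sup>+n. \<gamma> k n * (\<Prod>r\<in>{1..s}. ennreal (obs_density n r (y (k, r)))) \<partial>geometric_pmf \<theta>) * h y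
      = (\<Prod>k\<in>{1..K}. ennreal (wt s (\<lambda>r. y (k, r)))) * (ennreal (pvec s y k0) * h y)"
      by (simp add: mult.assoc)
  qed
  also have "\<dots> = (\<integral>\<^sup>+\<omega>. ennreal (pvec s (hist s \<omega>) k0) * h (hist s \<omega>) \<partial>M)"
    by (rule history_law[symmetric]) measurable
  finally show ?thesis by (simp add: pvec_hist)
qed

definition column :: "nat \<Rightarrow> (nat \<times> nat) set" where "column s = {1..K} \<times> {s}"

lemma grid_Suc: "grid (Suc s) = grid s \<union> column (Suc s)" "grid s \<inter> column (Suc s) = {}"
  by (auto simp: grid_def column_def)

text \<open>The integral runs over the new observations of all K streams. Under the product of
  predictive laws the streams outside \<open>B\<close> drop out by projection onto
  \<open>B\<close>.\<close>

lemma expect_column: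
  assumes H[measurable]: "H \<in> borel_measurable (PiM UNIV (\<lambda>_. borel))" and B: "B \<subseteq> {1..K}"
  shows "(\<integral>\<^sup>+x. (\<Prod>k\<in>{1..K}. ennreal (mix (a k) (x (k, s)))) * H (upds B a (\<lambda>i. x (i, s))) \<partial>PiM (column s) (\<lambda>_. \<nu>))
    = expect H B a"
proof -
  let ?L = "\<lambda>kr. law (a (fst kr))"
  have [measurable]: "mix c \<in> borel_measurable \<nu>" for c unfolding mix_def by measurable
  have one: "(\<integral>\<^sup>+x. ennreal (mix c x) \<partial>\<nu>) = 1" for c
    using prob_space.emeasure_space_1[OF law_prob[of c]]
    by (simp add: law_def emeasure_density cong: nn_integral_cong)
  have D: "PiM (column s) ?L = density (PiM (column s) (\<lambda>_. \<nu>)) (\<lambda>x. \<Prod>kr\<in>column s. ennreal (mix (a (fst kr)) (x kr)))"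
    unfolding law_def by (rule PiM_density) (auto simp: one column_def intro: prob_space_axioms)
  have R: "distr (PiM (column s) ?L) (\<Pi>\<^sub>M i\<in>B. ?L (i, s)) (\<lambda>x. \<lambda>i\<in>B. x (i, s)) = (\<Pi>\<^sub>M i\<in>B. ?L (i, s))"
    by (rule distr_PiM_reindex) (use B law_prob in \<open>auto simp: inj_on_def column_def\<close>)
  have m: "(\<lambda>x. \<lambda>i\<in>B. x (i, s)) \<in> measurable (PiM (column s) ?L) (\<Pi>\<^sub>M i\<in>B. ?L (i, s))"
    by (rule measurable_restrict) (rule measurable_component_singleton, use B in \<open>auto simp: column_def\<close>)
  have u: "(\<lambda>x. H (upds B a x)) \<in> borel_measurable (\<Pi>\<^sub>M i\<in>B. ?L (i, s))"
    using measurable_compose[OF upds_measurable'[of B a a] H] by simp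
  have ur: "upds B a (\<lambda>i\<in>B. x (i, s)) = upds B a (\<lambda>i. x (i, s))" for x :: "nat \<times> nat \<Rightarrow> 'x"
    by (auto simp: upds_def fun_eq_iff)
  have mu: "(\<lambda>x. H (upds B a (\<lambda>i. x (i, s)))) \<in> borel_measurable (PiM (column s) (\<lambda>_. \<nu>))"
    using measurable_compose[OF m u] unfolding ur
    by (simp add: measurable_cong_sets[OF sets_PiM_cong[OF refl law_sets] refl])
  have "expect H B a = (\<integral>\<^sup>+x. H (upds B a x) \<partial>distr (PiM (column s) ?L) (\<Pi>\<^sub>M i\<in>B. ?L (i, s)) (\<lambda>x. \<lambda>i\<in>B. x (i, s)))"
    unfolding R by (simp add: expect_def)
  also have "\<dots> = (\<integral>\<^sup>+x. H (upds B a (\<lambda>i. x (i, s))) \<partial>PiM (column s) ?L)"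
    by (subst nn_integral_distr[OF m]) (use u in \<open>simp_all add: ur\<close>)
  also have "\<dots> = (\<integral>\<^sup>+x. (\<Prod>kr\<in>column s. ennreal (mix (a (fst kr)) (x kr))) * H (upds B a (\<lambda>i. x (i, s))) \<partial>PiM (column s) (\<lambda>_. \<nu>))"
    unfolding D by (rule nn_integral_density) (use mu in simp_all)
  also have "\<dots> = (\<integral>\<^sup>+x. (\<Prod>k\<in>{1..K}. ennreal (mix (a k) (x (k, s)))) * H (upds B a (\<lambda>i. x (i, s))) \<partial>PiM (column s) (\<lambda>_. \<nu>))"
  proof (intro nn_integral_cong arg_cong2[where f = "(*)"] refl)
    fix x :: "nat \<times> nat \<Rightarrow> 'x"
    have "column s = (\<lambda>k. (k, s)) ` {1..K}" by (auto simp: column_def)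
    then show "(\<Prod>kr\<in>column s. ennreal (mix (a (fst kr)) (x kr))) = (\<Prod>k\<in>{1..K}. ennreal (mix (a k) (x (k, s))))"
      by (simp add: prod.reindex inj_on_def)
  qed
  finally show ?thesis by simp
qed

text \<open>The arbitrary factor \<open>u\<close> makes this a statement about conditional
  expectations given the history up to s. The marginal density up to \<open>Suc s\<close> is the one
  up to s times the predictive densities, so the newest column can be integrated first.\<close>

lemma transition_law:
  assumes u[measurable]: "u \<in> borel_measurable (hist_space s)"
    and H[measurable]: "H \<in> borel_measurable (PiM UNIV (\<lambda>_. borel))" and B: "B \<subseteq> {1..K}"
  shows "(\<integral>\<^sup>+\<omega>. u (hist s \<omega>) * H (\<lambda>i. if i \<in> B then post (Suc s) \<omega> i else 0) \<partial>M)
    = (\<integral>\<^sup>+\<omega>. u (hist s \<omega>) * expect H B (post s \<omega>) \<partial>M)"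
proof -
  have finB: "finite B" using B by (rule finite_subset) simp
  interpret P: product_sigma_finite "\<lambda>_ :: nat \<times> nat. \<nu>" by standard
  define h where "h y = u (restrict y (grid s)) * H (\<lambda>i. if i \<in> B then pvec (Suc s) y i else 0)" for y
  have sub: "grid s \<subseteq> grid (Suc s)" by (simp add: grid_Suc)
  have [measurable]: "(\<lambda>y. restrict y (grid s)) \<in> measurable (hist_space (Suc s)) (hist_space s)"
    unfolding hist_space_def by (rule measurable_restrict_subset) (rule sub)
  have "(\<lambda>y i. if i \<in> B then pvec (Suc s) y i else 0) \<in> measurable (hist_space (Suc s)) (PiM UNIV (\<lambda>_. borel))"
  proof (rule measurable_PiM_single')
    show "(\<lambda>y. if i \<in> B then pvec (Suc s) y i else 0) \<in> borel_measurable (hist_space (Suc s))" for i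
      by (cases "i \<in> B") simp_all
  qed (auto simp: PiE_def)
  note [measurable] = measurable_compose[OF this H]
  have hm[measurable]: "h \<in> borel_measurable (hist_space (Suc s))" unfolding h_def[abs_def] by measurable
  have [measurable]: "(\<lambda>y. wt s (\<lambda>r. y (k, r))) \<in> borel_measurable (hist_space s)" if "k \<in> {1..K}" for k s
    using that by (intro wt_measurable component_measurable) auto
  have "(\<integral>\<^sup>+\<omega>. u (hist s \<omega>) * H (\<lambda>i. if i \<in> B then post (Suc s) \<omega> i else 0) \<partial>M)
    = (\<integral>\<^sup>+\<omega>. h (hist (Suc s) \<omega>) \<partial>M)"
  proof (rule nn_integral_cong)
    fix \<omega>
    have "restrict (hist (Suc s) \<omega>) (grid s) = hist s \<omega>"
      unfolding hist_def using sub by (auto simp: fun_eq_iff restrict_def)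
    then show "u (hist s \<omega>) * H (\<lambda>i. if i \<in> B then post (Suc s) \<omega> i else 0) = h (hist (Suc s) \<omega>)"
      unfolding h_def pvec_hist by simp
  qed
  also have "\<dots> = (\<integral>\<^sup>+y. (\<Prod>k\<in>{1..K}. ennreal (wt (Suc s) (\<lambda>r. y (k, r)))) * h y \<partial>hist_space (Suc s))"
    by (rule history_law) measurable
  also have "\<dots> = (\<integral>\<^sup>+y. \<integral>\<^sup>+x. (\<Prod>k\<in>{1..K}. ennreal (wt (Suc s) (\<lambda>r. merge (grid s) (column (Suc s)) (y, x) (k, r))))
      * h (merge (grid s) (column (Suc s)) (y, x)) \<partial>PiM (column (Suc s)) (\<lambda>_. \<nu>) \<partial>hist_space s)"
  proof -
    have "(\<lambda>y. (\<Prod>k\<in>{1..K}. ennreal (wt (Suc s) (\<lambda>r. y (k, r)))) * h y) \<in> borel_measurable (hist_space (Suc s))"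
      by measurable
    moreover have "finite (column (Suc s))" by (simp add: column_def)
    ultimately show ?thesis
      unfolding hist_space_def grid_Suc(1) by (intro P.product_nn_integral_fold grid_Suc(2) finite_grid)
  qed
  also have "\<dots> = (\<integral>\<^sup>+y. (\<Prod>k\<in>{1..K}. ennreal (wt s (\<lambda>r. y (k, r)))) * (u y * expect H B (pvec s y)) \<partial>hist_space s)"
  proof (rule nn_integral_cong)
    fix y assume y: "y \<in> space (hist_space s)"
    define a where "a = pvec s y"
    let ?m = "\<lambda>x. merge (grid s) (column (Suc s)) (y, x)"
    let ?w = "\<Prod>k\<in>{1..K}. ennreal (wt s (\<lambda>r. y (k, r)))"
    have m: "?m x (k, r) = y (k, r)" if "k \<in> {1..K}" "r \<in> {1..s}" for x k r
      using that by (simp add: merge_def grid_def)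
    have m': "?m x (k, Suc s) = x (k, Suc s)" if "k \<in> {1..K}" for x k
      using that by (simp add: merge_def grid_def column_def)
    have ps: "pst s (\<lambda>r. ?m x (k, r)) = a k" if "k \<in> {1..K}" for x k
      using that by (auto simp: a_def pvec_def m intro!: pst_cong)
    have ws: "wt s (\<lambda>r. ?m x (k, r)) = wt s (\<lambda>r. y (k, r))" if "k \<in> {1..K}" for x k
      using that by (intro wt_cong) (simp add: m)
    have W: "(\<Prod>k\<in>{1..K}. ennreal (wt (Suc s) (\<lambda>r. ?m x (k, r))))
      = ?w * (\<Prod>k\<in>{1..K}. ennreal (mix (a k) (x (k, Suc s))))" for x
    proof -
      have "ennreal (wt (Suc s) (\<lambda>r. ?m x (k, r))) = ennreal (wt s (\<lambda>r. y (k, r))) * ennreal (mix (a k) (x (k, Suc s)))"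
        if k: "k \<in> {1..K}" for k
        using wt_nonneg[of s "\<lambda>r. y (k, r)"] space_hist_space[OF y k]
        by (simp add: ps[OF k] ws[OF k] m'[OF k] ennreal_mult')
      then show ?thesis by (simp add: prod.distrib)
    qed
    have rest: "restrict (?m x) (grid s) = y" for x
    proof -
      have "y \<in> extensional (grid s)" using y by (simp add: hist_space_def space_PiM PiE_def)
      then show ?thesis by (auto simp: fun_eq_iff merge_def extensional_def restrict_def)
    qed
    have up: "(\<lambda>i. if i \<in> B then pvec (Suc s) (?m x) i else 0) = upds B a (\<lambda>i. x (i, Suc s))" for x
      using B by (auto simp: upds_def fun_eq_iff pvec_def ps m')
    have "(\<integral>\<^sup>+x. (\<Prod>k\<in>{1..K}. ennreal (wt (Suc s) (\<lambda>r. ?m x (k, r)))) * h (?m x) \<partial>PiM (column (Suc s)) (\<lambda>_. \<nu>))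
      = (\<integral>\<^sup>+x. (?w * u y) * ((\<Prod>k\<in>{1..K}. ennreal (mix (a k) (x (k, Suc s)))) * H (upds B a (\<lambda>i. x (i, Suc s))))
          \<partial>PiM (column (Suc s)) (\<lambda>_. \<nu>))"
      unfolding W h_def rest up by (simp add: ac_simps)
    also have "\<dots> = (?w * u y) * expect H B a"
    proof -
      have x: "(\<lambda>x. x (i, Suc s)) \<in> measurable (PiM (column (Suc s)) (\<lambda>_. \<nu>)) \<nu>" if "i \<in> {1..K}" for i
        by (rule measurable_component_singleton) (use that in \<open>simp add: column_def\<close>)
      have [measurable]: "mix c \<in> borel_measurable \<nu>" "upd c \<in> borel_measurable \<nu>" for c
        unfolding mix_def upd_def by measurable
      have "(\<lambda>x. upds B a (\<lambda>i. x (i, Suc s))) \<in> measurable (PiM (column (Suc s)) (\<lambda>_. \<nu>)) (PiM UNIV (\<lambda>_. borel))"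
      proof (rule measurable_PiM_single')
        show "(\<lambda>x. upds B a (\<lambda>i. x (i, Suc s)) i) \<in> borel_measurable (PiM (column (Suc s)) (\<lambda>_. \<nu>))" for i
        proof (cases "i \<in> B")
          case True
          then show ?thesis using measurable_compose[OF x, of i "upd (a i)" borel] B by (auto simp: upds_def)
        qed (simp add: upds_def)
      qed (auto simp: PiE_def)
      note [measurable] = measurable_compose[OF this H]
      have [measurable]: "(\<lambda>x. mix (a k) (x (k, Suc s))) \<in> borel_measurable (PiM (column (Suc s)) (\<lambda>_. \<nu>))" if "k \<in> {1..K}" for k
        by (rule measurable_compose[OF x[OF that]]) simp
      show ?thesis by (subst nn_integral_cmult) (simp_all add: expect_column[OF H B])
    qed
    finally show "(\<integral>\<^sup>+x. (\<Prod>k\<in>{1..K}. ennreal (wt (Suc s) (\<lambda>r. ?m x (k, r)))) * h (?m x) \<partial>PiM (column (Suc s)) (\<lambda>_. \<nu>))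
      = ?w * (u y * expect H B (pvec s y))" by (simp add: a_def mult.assoc)
  qed
  also have "\<dots> = (\<integral>\<^sup>+\<omega>. u (hist s \<omega>) * expect H B (pvec s (hist s \<omega>)) \<partial>M)"
    by (rule history_law[symmetric]) (use measurable_compose[OF pvec_measurable expect_measurable[OF finB H]] in measurable)
  finally show ?thesis by (simp add: pvec_hist)
qed

end

section \<open>Procedures and their filtrations\<close>

text \<open>Only measurability is assumed. Error control of the switching procedures needs neither
  densities nor a geometric prior.\<close>

locale streams = prob_space M
  for M :: "'w measure" +
  fixes N :: "'x measure" and K :: nat and \<tau> :: "nat \<Rightarrow> 'w \<Rightarrow> enat" and X :: "nat \<Rightarrow> nat \<Rightarrow> 'w \<Rightarrow> 'x"
  assumes tau_meas: "k \<in> {1..K} \<Longrightarrow> \<tau> k \<in> measurable M (count_space UNIV)"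
    and X_meas: "k \<in> {1..K} \<Longrightarrow> 1 \<le> t \<Longrightarrow> X k t \<in> measurable M N"
begin

lemma proc_first: "is_proc M N K X S \<Longrightarrow> \<omega> \<in> space M \<Longrightarrow> S 1 \<omega> = {1..K}"
  by (simp add: is_proc_def)

lemma proc_antimono:
  assumes S: "is_proc M N K X S" and "1 \<le> s" "s \<le> t" "\<omega> \<in> space M"
  shows "S t \<omega> \<subseteq> S s \<omega>"
  using assms(3,2)
proof (induction t rule: dec_induct)
  case (step n)
  then have "1 \<le> n" by simp
  then have "S (Suc n) \<omega> \<subseteq> S n \<omega>" using S assms(4) unfolding is_proc_def by blast
  then show ?case using step by blast
qed simp

lemma proc_subset:
  assumes "is_proc M N K X S" "1 \<le> t" "\<omega> \<in> space M" shows "S t \<omega> \<subseteq> {1..K}"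
  using proc_antimono[OF assms(1) order_refl assms(2,3)] proc_first[OF assms(1,3)] by simp

lemma proc_finite: "is_proc M N K X S \<Longrightarrow> 1 \<le> t \<Longrightarrow> \<omega> \<in> space M \<Longrightarrow> finite (S t \<omega>)"
  by (rule finite_subset[OF proc_subset finite_atLeastAtMost])

lemma filt_gen_Pow: "filt_gen M N X S t \<subseteq> Pow (space M)"
  by (auto simp: filt_gen_def)

lemma space_filt[simp]: "space (filt M N X S t) = space M"
  by (simp add: filt_def space_measure_of[OF filt_gen_Pow])

lemma sets_filt: "sets (filt M N X S t) = sigma_sets (space M) (filt_gen M N X S t)"
  by (simp add: filt_def sets_measure_of[OF filt_gen_Pow])

lemma filt_generator: "A \<in> filt_gen M N X S t \<Longrightarrow> A \<in> sets (filt M N X S t)"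
  by (simp add: sets_filt sigma_sets.Basic)

lemma active_event:
  assumes S: "is_proc M N K X S" and t: "1 \<le> t" and G: "space G = space M"
    and eq: "\<And>A. {\<omega>\<in>space M. S t \<omega> = A} \<in> sets G"
  shows "{\<omega>\<in>space M. k \<in> S t \<omega>} \<in> sets G"
proof -
  have "{\<omega>\<in>space M. k \<in> S t \<omega>} = (\<Union>A\<in>{A\<in>Pow {1..K}. k \<in> A}. {\<omega>\<in>space M. S t \<omega> = A})"
    using proc_subset[OF S t] by blast
  moreover have "finite {A\<in>Pow {1..K}. k \<in> A}" by simp
  ultimately show ?thesis using eq by (metis (no_types, lifting) sets.finite_UN)
qed

text \<open>The filtration of a procedure lies in any increasing family that makes the data
  measurable. Strong induction is needed because the set at time s is measurable for the filtration
  one step earlier. It is used with \<open>G\<close> constantly M and with \<open>G\<close>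
  generated by the full history.\<close>

lemma filt_subset:
  assumes S: "is_proc M N K X S"
    and G: "\<And>t. space (G t) = space M" "\<And>s t. s \<le> t \<Longrightarrow> sets (G s) \<subseteq> sets (G t)"
    and X: "\<And>k s t. k \<in> {1..K} \<Longrightarrow> 1 \<le> s \<Longrightarrow> s \<le> t \<Longrightarrow> X k s \<in> measurable (G t) N"
  shows "sets (filt M N X S t) \<subseteq> sets (G t)"
proof (induction t rule: less_induct)
  case (less t)
  have S_eq: "{\<omega>\<in>space M. S s \<omega> = A} \<in> sets (G t)" if s: "1 \<le> s" "s \<le> t" for s A
  proof (cases "s = 1")
    case True
    then have "{\<omega>\<in>space M. S s \<omega> = A} = (if A = {1..K} then space (G t) else {})"
      using proc_first[OF S] by (auto simp: G(1))
    then show ?thesis by simp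
  next
    case False
    then obtain r where r: "s = Suc r" "1 \<le> r" using s by (cases s) auto
    then have "{\<omega>\<in>space M. S s \<omega> = A} \<in> sets (filt M N X S r)"
      using S unfolding is_proc_def by blast
    then have "{\<omega>\<in>space M. S s \<omega> = A} \<in> sets (G r)" using less[of r] r s by auto
    then show ?thesis using G(2)[of r t] r s by auto
  qed
  have "filt_gen M N X S t \<subseteq> sets (G t)"
  proof
    fix C assume "C \<in> filt_gen M N X S t"
    then consider (S) s A where "1 \<le> s" "s \<le> t" "C = {\<omega>\<in>space M. S s \<omega> = A}"
      | (X) s k B where "1 \<le> s" "s \<le> t" "B \<in> sets N" "C = {\<omega>\<in>space M. k \<in> S s \<omega> \<and> X k s \<omega> \<in> B}"
      unfolding filt_gen_def by blast
    then show "C \<in> sets (G t)"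
    proof cases
      case S then show ?thesis using S_eq by simp
    next
      case X
      show ?thesis
      proof (cases "k \<in> {1..K}")
        case True
        have "C = {\<omega>\<in>space M. k \<in> S s \<omega>} \<inter> (X k s -` B \<inter> space (G t))" using X(4) G(1) by auto
        moreover have "{\<omega>\<in>space M. k \<in> S s \<omega>} \<in> sets (G t)"
          by (rule active_event[OF S X(1) G(1) S_eq[OF X(1,2)]])
        ultimately show ?thesis
          using measurable_sets[OF assms(4)[OF True X(1,2)] X(3)] by simp
      next
        case False
        then have "C = {}" using X proc_subset[OF S X(1)] by blast
        then show ?thesis by simp
      qed
    qed
  qed
  then show ?case unfolding sets_filt by (metis G(1) sets.sigma_sets_subset)
qed

lemma filt_subalgebra: assumes S: "is_proc M N K X S" shows "subalgebra M (filt M N X S t)"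
  unfolding subalgebra_def using filt_subset[OF S, of "\<lambda>_. M"] X_meas by simp

lemma filt_finite_subalgebra:
  assumes "is_proc M N K X S" shows "finite_measure_subalgebra M (filt M N X S t)"
  by (rule finite_measure_subalgebra.intro)
    (simp_all add: finite_measure_subalgebra_axioms_def filt_subalgebra[OF assms] finite_measure_axioms)

lemma proc_event:
  assumes S: "is_proc M N K X S" and "1 \<le> s" "s \<le> Suc t" "1 \<le> t"
  shows "{\<omega>\<in>space M. S s \<omega> = A} \<in> sets (filt M N X S t)"
proof (cases "s = Suc t")
  case True
  then show ?thesis using S assms(4) by (simp add: is_proc_def)
next
  case False
  then have "\<exists>s' A'. {\<omega>\<in>space M. S s \<omega> = A} = {\<omega>\<in>space M. S s' \<omega> = A'} \<and> 1 \<le> s' \<and> s' \<le> t"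
    using assms(2,3) by (intro exI[of _ s] exI[of _ A]) simp
  then show ?thesis unfolding filt_gen_def by (intro filt_generator[unfolded filt_gen_def] UnI1) simp
qed

lemma proc_measurable:
  assumes S: "is_proc M N K X S" and "1 \<le> s" "s \<le> Suc t" "1 \<le> t"
  shows "S s \<in> measurable (filt M N X S t) (count_space (Pow {1..K}))"
proof (subst measurable_count_space_eq2)
  have "S s -` {A} \<inter> space M = {\<omega>\<in>space M. S s \<omega> = A}" for A by auto
  then show "S s \<in> space (filt M N X S t) \<rightarrow> Pow {1..K} \<and>
      (\<forall>A\<in>Pow {1..K}. S s -` {A} \<inter> space (filt M N X S t) \<in> sets (filt M N X S t))"
    using proc_subset[OF S assms(2)] proc_event[OF assms] by simp
qed simp

lemma proc_measurable_M:
  assumes S: "is_proc M N K X S" and "1 \<le> s"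
  shows "S s \<in> measurable M (count_space (Pow {1..K}))"
  using measurable_from_subalg[OF filt_subalgebra[OF S] proc_measurable[OF S assms(2), of s]] assms(2) by simp

lemma tau_event[measurable]: "k \<in> {1..K} \<Longrightarrow> {\<omega>\<in>space M. \<tau> k \<omega> < enat t} \<in> sets M"
proof -
  assume k: "k \<in> {1..K}"
  have "\<tau> k -` {..<enat t} \<inter> space M \<in> sets M" by (rule measurable_sets[OF tau_meas[OF k]]) simp
  also have "\<tau> k -` {..<enat t} \<inter> space M = {\<omega>\<in>space M. \<tau> k \<omega> < enat t}" by auto
  finally show ?thesis .
qed

text \<open>The next active set is already known at time t, so the membership indicators and the
  denominator can be pulled out of the conditional expectation, leaving one posterior per
  stream.\<close>

lemma LFNR_eq:
  assumes S: "is_proc M N K X S" and t: "1 \<le> t"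
  shows "AE \<omega> in M. LFNR M N \<tau> X S t \<omega>
    = (\<Sum>k\<in>S (Suc t) \<omega>. W M N \<tau> X S k t \<omega>) / real (max (card (S (Suc t) \<omega>)) 1)"
proof -
  let ?F = "filt M N X S t"
  interpret finite_measure_subalgebra M ?F by (rule filt_finite_subalgebra[OF S])
  define c where "c k \<omega> = (if k \<in> S (Suc t) \<omega> then 1 / real (max (card (S (Suc t) \<omega>)) 1) else 0)" for k \<omega>
  \<comment> \<open>Measurability of \<open>\<tau> k\<close> is available only for k in
    \<open>{1..K}\<close>; the value 0 elsewhere makes every \<open>I k\<close> measurable.\<close>
  define I :: "nat \<Rightarrow> 'w \<Rightarrow> real" where
    "I k = (if k \<in> {1..K} then indicator {\<omega>\<in>space M. \<tau> k \<omega> < enat t} else (\<lambda>_. 0))" for k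
  have Sm: "S (Suc t) \<in> measurable ?F (count_space (Pow {1..K}))"
    by (rule proc_measurable[OF S]) (use t in auto)
  have cm[measurable]: "c k \<in> borel_measurable ?F" for k
    unfolding c_def
    by (rule measurable_compose[OF Sm, of "\<lambda>A. if k \<in> A then 1 / real (max (card A) 1) else 0"]) simp
  have cM[measurable]: "c k \<in> borel_measurable M" for k by (rule measurable_from_subalg[OF subalg cm])
  have Im[measurable]: "I k \<in> borel_measurable M" for k
    unfolding I_def using tau_event[of k t] by (cases "k \<in> {1..K}") simp_all
  have int: "integrable M (\<lambda>\<omega>. c k \<omega> * I k \<omega>)" for k
  proof (rule integrable_const_bound)
    show "AE \<omega> in M. norm (c k \<omega> * I k \<omega>) \<le> 1" by (rule AE_I2) (simp add: c_def I_def indicator_def)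
  qed measurable
  have rep: "(\<Sum>k\<in>{1..K}. c k \<omega> * z k) = (\<Sum>k\<in>S (Suc t) \<omega>. z k) / real (max (card (S (Suc t) \<omega>)) 1)"
    if "\<omega> \<in> space M" for \<omega> z
  proof -
    have "(\<Sum>k\<in>{1..K}. c k \<omega> * z k) = (\<Sum>k\<in>S (Suc t) \<omega>. c k \<omega> * z k)"
      by (rule sum.mono_neutral_right) (use proc_subset[OF S _ that, of "Suc t"] in \<open>auto simp: c_def\<close>)
    also have "\<dots> = (\<Sum>k\<in>S (Suc t) \<omega>. z k / real (max (card (S (Suc t) \<omega>)) 1))"
      by (rule sum.cong) (auto simp: c_def)
    finally show ?thesis by (simp add: sum_divide_distrib)
  qed
  have FNP: "FNP \<tau> S t \<omega> = (\<Sum>k\<in>{1..K}. c k \<omega> * I k \<omega>)" if "\<omega> \<in> space M" for \<omega>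
    unfolding rep[OF that] FNP_def using that proc_subset[OF S _ that, of "Suc t"]
    by (intro arg_cong2[where f = "(/)"] sum.cong refl) (auto simp: I_def indicator_def)
  have "AE \<omega> in M. LFNR M N \<tau> X S t \<omega> = real_cond_exp M ?F (\<lambda>\<omega>. \<Sum>k\<in>{1..K}. c k \<omega> * I k \<omega>) \<omega>"
    unfolding LFNR_def
  proof (rule real_cond_exp_cong)
    have "(\<lambda>\<omega>. \<Sum>k\<in>{1..K}. c k \<omega> * I k \<omega>) \<in> borel_measurable M" by measurable
    then show "FNP \<tau> S t \<in> borel_measurable M" by (subst measurable_cong[OF FNP])
  qed (use FNP in auto)
  moreover have "AE \<omega> in M. real_cond_exp M ?F (\<lambda>\<omega>. \<Sum>k\<in>{1..K}. c k \<omega> * I k \<omega>) \<omega>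
      = (\<Sum>k\<in>{1..K}. real_cond_exp M ?F (\<lambda>\<omega>. c k \<omega> * I k \<omega>) \<omega>)"
    by (rule real_cond_exp_sum) (rule int)
  moreover have "AE \<omega> in M. \<forall>k\<in>{1..K}. real_cond_exp M ?F (\<lambda>\<omega>. c k \<omega> * I k \<omega>) \<omega> = c k \<omega> * W M N \<tau> X S k t \<omega>"
  proof (intro AE_finite_allI)
    fix k assume "k \<in> {1..K}"
    then have "W M N \<tau> X S k t = real_cond_exp M ?F (I k)" by (simp add: W_def I_def)
    then show "AE \<omega> in M. real_cond_exp M ?F (\<lambda>\<omega>. c k \<omega> * I k \<omega>) \<omega> = c k \<omega> * W M N \<tau> X S k t \<omega>"
      using real_cond_exp_mult[OF cm Im int] by simp
  qed simp
  ultimately show ?thesis using AE_space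
  proof eventually_elim
    case (elim \<omega>)
    then show ?case using rep[of \<omega> "\<lambda>k. W M N \<tau> X S k t \<omega>"] by simp
  qed
qed

text \<open>Multiplying by the size of the set yields the condition used in \<open>val\<close>. For
  the empty set both sides hold because \<alpha> is nonnegative.\<close>

lemma LFNR_le_iff:
  assumes S: "is_proc M N K X S" and t: "1 \<le> t" and \<alpha>: "0 \<le> \<alpha>"
  shows "(AE \<omega> in M. LFNR M N \<tau> X S t \<omega> \<le> \<alpha>) \<longleftrightarrow>
    (AE \<omega> in M. (\<Sum>k\<in>S (Suc t) \<omega>. W M N \<tau> X S k t \<omega>) \<le> \<alpha> * real (card (S (Suc t) \<omega>)))"
proof -
  have "AE \<omega> in M. LFNR M N \<tau> X S t \<omega> \<le> \<alpha> \<longleftrightarrow>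
    (\<Sum>k\<in>S (Suc t) \<omega>. W M N \<tau> X S k t \<omega>) \<le> \<alpha> * real (card (S (Suc t) \<omega>))"
    using LFNR_eq[OF S t] AE_space
  proof eventually_elim
    case (elim \<omega>)
    show ?case
    proof (cases "S (Suc t) \<omega> = {}")
      case True
      then show ?thesis using elim(1) \<alpha> by simp
    next
      case False
      then have "0 < card (S (Suc t) \<omega>)" using proc_finite[OF S _ elim(2), of "Suc t"] by (simp add: card_gt_0_iff)
      then have "max (card (S (Suc t) \<omega>)) 1 = card (S (Suc t) \<omega>)" by simp
      then show ?thesis using elim(1) \<open>0 < card _\<close> by (simp add: divide_le_eq)
    qed
  qed
  then show ?thesis by (rule eventually_subst)
qed

lemma onestep_LFNR:
  assumes S: "is_proc M N K X S" and t: "1 \<le> t" and \<alpha>: "0 \<le> \<alpha>"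
    and step: "AE \<omega> in M. S (Suc t) \<omega> = onestep \<alpha> (S t \<omega>) (\<lambda>k. W M N \<tau> X S k t \<omega>)"
  shows "AE \<omega> in M. LFNR M N \<tau> X S t \<omega> \<le> \<alpha>"
  unfolding LFNR_le_iff[OF S t \<alpha>] using step AE_space
proof eventually_elim
  case (elim \<omega>)
  then show ?case using onestep_feasible[OF proc_finite[OF S t elim(2)] \<alpha>] by simp
qed

lemma filt_cong:
  assumes "\<And>s \<omega>. 1 \<le> s \<Longrightarrow> s \<le> t \<Longrightarrow> \<omega> \<in> space M \<Longrightarrow> S s \<omega> = S' s \<omega>"
  shows "filt M N X S t = filt M N X S' t"
proof -
  have "{\<omega>\<in>space M. S s \<omega> = A} = {\<omega>\<in>space M. S' s \<omega> = A}"
    "{\<omega>\<in>space M. k \<in> S s \<omega> \<and> X k s \<omega> \<in> B} = {\<omega>\<in>space M. k \<in> S' s \<omega> \<and> X k s \<omega> \<in> B}"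
    if "1 \<le> s" "s \<le> t" for s A B k
    using assms[OF that] by auto
  then have "filt_gen M N X S t = filt_gen M N X S' t"
    unfolding filt_gen_def by (intro arg_cong2[where f = "(\<union>)"] Collect_cong) (metis (no_types, lifting))+
  then show ?thesis by (simp add: filt_def)
qed

text \<open>After the switch each set is feasible by construction. Before it, sets, filtration and
  posteriors all coincide with those of \<open>SA\<close>, whose control is inherited.\<close>

lemma switching_in_T_alpha:
  assumes \<alpha>: "0 \<le> \<alpha>" and A: "in_T_alpha M N K \<tau> X \<alpha> SA" and G: "is_switching M N K \<tau> X \<alpha> SA t0 S"
  shows "in_T_alpha M N K \<tau> X \<alpha> S"
  unfolding in_T_alpha_def
proof (intro conjI allI impI)
  show S: "is_proc M N K X S" using G by (simp add: is_switching_def)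
  have SA: "is_proc M N K X SA" using A by (simp add: in_T_alpha_def)
  fix t :: nat assume t: "1 \<le> t"
  show "AE \<omega> in M. LFNR M N \<tau> X S t \<omega> \<le> \<alpha>"
  proof (cases "max t0 1 \<le> t")
    case True
    then show ?thesis using G by (intro onestep_LFNR[OF S t \<alpha>]) (simp add: is_switching_def)
  next
    case False
    then have less: "Suc t \<le> t0" using t by simp
    have eq: "S s \<omega> = SA s \<omega>" if "1 \<le> s" "s \<le> Suc t" "\<omega> \<in> space M" for s \<omega>
      using G that less by (simp add: is_switching_def)
    have F: "filt M N X S t = filt M N X SA t" by (rule filt_cong) (use eq in auto)
    have W: "W M N \<tau> X S k t = W M N \<tau> X SA k t" for k unfolding W_def F ..
    have "AE \<omega> in M. (\<Sum>k\<in>SA (Suc t) \<omega>. W M N \<tau> X SA k t \<omega>) \<le> \<alpha> * real (card (SA (Suc t) \<omega>))"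
      using A t LFNR_le_iff[OF SA t \<alpha>] by (simp add: in_T_alpha_def)
    then show ?thesis unfolding LFNR_le_iff[OF S t \<alpha>] W using AE_space
      by eventually_elim (use eq t in simp)
  qed
qed

end

section \<open>Posteriors given the filtration of a procedure\<close>

context geometric_streams
begin

sublocale st: streams M \<nu> K \<tau> X
  by unfold_locales (use tau_meas X_meas in auto)

lemma hist_restrict: "s \<le> t \<Longrightarrow> restrict (hist t \<omega>) (grid s) = hist s \<omega>"
  unfolding hist_def by (auto simp: fun_eq_iff restrict_def grid_def)

lemma restrict_hist_measurable: "s \<le> t \<Longrightarrow> (\<lambda>y. restrict y (grid s)) \<in> measurable (hist_space t) (hist_space s)"
  unfolding hist_space_def by (rule measurable_restrict_subset) (auto simp: grid_def)

lemma sets_hist_algebra: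
  "sets (vimage_algebra (space M) (hist t) (hist_space t)) = {hist t -` C \<inter> space M | C. C \<in> sets (hist_space t)}"
  by (rule sets_vimage_algebra2) (use measurable_space[OF hist_measurable] in auto)

text \<open>Every event known to a procedure is an event of the full history, so laws computed for
  the history apply to any procedure.\<close>

lemma filt_hist:
  assumes S: "is_proc M \<nu> K X S" and A: "A \<in> sets (filt M \<nu> X S t)"
  obtains C where "C \<in> sets (hist_space t)" "A = hist t -` C \<inter> space M"
proof -
  let ?G = "\<lambda>t. vimage_algebra (space M) (hist t) (hist_space t)"
  have "sets (filt M \<nu> X S t) \<subseteq> sets (?G t)"
  proof (rule st.filt_subset[OF S])
    show "sets (?G s) \<subseteq> sets (?G t)" if st: "s \<le> t" for s t
    proof
      fix B assume "B \<in> sets (?G s)"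
      then obtain C where C: "C \<in> sets (hist_space s)" "B = hist s -` C \<inter> space M"
        unfolding sets_hist_algebra by blast
      let ?D = "(\<lambda>y. restrict y (grid s)) -` C \<inter> space (hist_space t)"
      have "?D \<in> sets (hist_space t)" using measurable_sets[OF restrict_hist_measurable[OF st] C(1)] .
      moreover have "B = hist t -` ?D \<inter> space M"
        using C(2) measurable_space[OF hist_measurable[of t]] by (auto simp: hist_restrict[OF st])
      ultimately show "B \<in> sets (?G t)" unfolding sets_hist_algebra by blast
    qed
    show "X k s \<in> measurable (?G t) \<nu>" if ks: "k \<in> {1..K}" "1 \<le> s" "s \<le> t" for k s t
    proof -
      have "hist t \<in> measurable (?G t) (hist_space t)"
        by (rule measurable_vimage_algebra1) (use measurable_space[OF hist_measurable] in auto)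
      from measurable_compose[OF this component_measurable[of k s]]
      have "(\<lambda>\<omega>. hist t \<omega> (k, s)) \<in> measurable (?G t) \<nu>" using ks by simp
      then show ?thesis using ks by (simp add: hist_def grid_def)
    qed
  qed simp
  then show ?thesis using A that unfolding sets_hist_algebra by blast
qed

text \<open>A stream active at time t was active at all earlier times, so on that event its whole
  record belongs to the filtration.\<close>

lemma active_post_measurable:
  assumes S: "is_proc M \<nu> K X S" and t: "1 \<le> t" and k: "k \<in> {1..K}"
  shows "(\<lambda>\<omega>. indicator {\<omega>\<in>space M. k \<in> S t \<omega>} \<omega> * post t \<omega> k) \<in> borel_measurable (filt M \<nu> X S t)"
proof -
  let ?F = "filt M \<nu> X S t"
  let ?D = "{\<omega>\<in>space M. k \<in> S t \<omega>}"
  have spF: "space ?F = space M" by simp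
  have D: "?D \<in> sets ?F"
    by (rule st.active_event[OF S t spF]) (rule st.proc_event[OF S t], use t in auto)
  obtain x0 where x0: "x0 \<in> space \<nu>" using not_empty by blast
  \<comment> \<open>Off the event that k is active its data may be unknown; a fixed point
    \<open>x0\<close> replaces them, and the indicator removes the effect.\<close>
  define Z where "Z r \<omega> = (if k \<in> S t \<omega> then X k r \<omega> else x0)" for r \<omega>
  have "Z r \<in> measurable ?F \<nu>" if r: "r \<in> {1..t}" for r
  proof (rule measurableI)
    fix \<omega> assume "\<omega> \<in> space ?F"
    then show "Z r \<omega> \<in> space \<nu>" using measurable_space[OF X_meas[OF k]] r x0 by (simp add: Z_def)
  next
    fix B assume B: "B \<in> sets \<nu>"
    have R: "{\<omega>\<in>space M. k \<in> S r \<omega> \<and> X k r \<omega> \<in> B} \<in> sets ?F"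
      by (rule st.filt_generator) (use r B in \<open>auto simp: filt_gen_def\<close>)
    have sub: "k \<in> S r \<omega>" if "\<omega> \<in> space M" "k \<in> S t \<omega>" for \<omega>
      using st.proc_antimono[OF S, of r t] r that by auto
    have "Z r -` B \<inter> space ?F
      = (?D \<inter> {\<omega>\<in>space M. k \<in> S r \<omega> \<and> X k r \<omega> \<in> B}) \<union> (if x0 \<in> B then space ?F - ?D else {})"
      by (auto simp: Z_def sub split: if_splits)
    also have "\<dots> \<in> sets ?F"
      by (intro sets.Un sets.Int D R) (use sets.compl_sets[OF D] in \<open>simp split: if_split\<close>)
    finally show "Z r -` B \<inter> space ?F \<in> sets ?F" .
  qed
  then have "(\<lambda>\<omega>. pst t (\<lambda>r. Z r \<omega>)) \<in> borel_measurable ?F" by (rule pst_measurable)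
  then have "(\<lambda>\<omega>. indicator ?D \<omega> * pst t (\<lambda>r. Z r \<omega>)) \<in> borel_measurable ?F"
    using D by (intro borel_measurable_times borel_measurable_indicator)
  also have "(\<lambda>\<omega>. indicator ?D \<omega> * pst t (\<lambda>r. Z r \<omega>)) = (\<lambda>\<omega>. indicator ?D \<omega> * post t \<omega> k)"
    using k by (auto simp: fun_eq_iff indicator_def Z_def post_def)
  finally show ?thesis .
qed

text \<open>The filtration is coarser than the full history, yet the posterior of an active stream
  is the same: it is measurable for the filtration, and intersecting an event with activity of k
  gives a history event, to which \<open>posterior_law\<close> applies.\<close>

lemma W_eq_post:
  assumes S: "is_proc M \<nu> K X S" and t: "1 \<le> t"
  shows "AE \<omega> in M. \<forall>k\<in>S t \<omega>. W M \<nu> \<tau> X S k t \<omega> = post t \<omega> k"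
proof -
  let ?F = "filt M \<nu> X S t"
  interpret F: finite_measure_subalgebra M ?F by (rule st.filt_finite_subalgebra[OF S])
  have "AE \<omega> in M. k \<in> S t \<omega> \<longrightarrow> W M \<nu> \<tau> X S k t \<omega> = post t \<omega> k" if k: "k \<in> {1..K}" for k
  proof -
    let ?D = "{\<omega>\<in>space M. k \<in> S t \<omega>}"
    let ?T = "{\<omega>\<in>space M. \<tau> k \<omega> < enat t}"
    have spF: "space ?F = space M" by simp
    have D: "?D \<in> sets ?F"
      by (rule st.active_event[OF S t spF]) (rule st.proc_event[OF S t], use t in auto)
    have DM[measurable]: "?D \<in> sets M" using D F.subalg by (auto simp: subalgebra_def)
    have T[measurable]: "?T \<in> sets M" by (rule st.tau_event[OF k])
    have int1: "integrable M (\<lambda>\<omega>. indicator ?D \<omega> * indicator ?T \<omega> :: real)"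
      by (rule obs.integrable_const_bound[where B = 1]) (auto simp: indicator_def)
    have int2: "integrable M (\<lambda>\<omega>. indicator ?D \<omega> * post t \<omega> k)"
    proof (rule obs.integrable_const_bound[where B = 1])
      show "AE \<omega> in M. norm (indicator ?D \<omega> * post t \<omega> k) \<le> 1"
        using post_bounds by (intro AE_I2) (auto simp: indicator_def)
    qed measurable
    have "AE \<omega> in M. real_cond_exp M ?F (\<lambda>\<omega>. indicator ?D \<omega> * indicator ?T \<omega>) \<omega> = indicator ?D \<omega> * post t \<omega> k"
    proof (rule F.real_cond_exp_charact[OF _ int1 int2 active_post_measurable[OF S t k]])
      fix A assume A: "A \<in> sets ?F"
      then have "A \<inter> ?D \<in> sets ?F" using D by (rule sets.Int)
      then obtain C where C: "C \<in> sets (hist_space t)" "A \<inter> ?D = hist t -` C \<inter> space M"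
        by (rule filt_hist[OF S])
      have AM: "A \<in> sets M" using A F.subalg by (auto simp: subalgebra_def)
      have mem: "hist t \<omega> \<in> C \<longleftrightarrow> \<omega> \<in> A \<and> k \<in> S t \<omega>" if "\<omega> \<in> space M" for \<omega>
        using C(2) that by blast
      have hm: "indicator C \<in> borel_measurable (hist_space t)" using C(1) by simp
      have "(\<integral>\<^sup>+\<omega>. ennreal (indicator A \<omega> * (indicator ?D \<omega> * indicator ?T \<omega>)) \<partial>M)
        = (\<integral>\<^sup>+\<omega>. indicator ?T \<omega> * indicator C (hist t \<omega>) \<partial>M)"
      proof (rule nn_integral_cong)
        fix \<omega> assume \<omega>: "\<omega> \<in> space M"
        show "ennreal (indicator A \<omega> * (indicator ?D \<omega> * indicator ?T \<omega>)) = indicator ?T \<omega> * indicator C (hist t \<omega>)"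
          using mem[OF \<omega>] \<omega> by (auto simp: indicator_def)
      qed
      also have "\<dots> = (\<integral>\<^sup>+\<omega>. ennreal (post t \<omega> k) * indicator C (hist t \<omega>) \<partial>M)"
        by (rule posterior_law[OF hm k])
      also have "\<dots> = (\<integral>\<^sup>+\<omega>. ennreal (indicator A \<omega> * (indicator ?D \<omega> * post t \<omega> k)) \<partial>M)"
      proof (rule nn_integral_cong)
        fix \<omega> assume \<omega>: "\<omega> \<in> space M"
        show "ennreal (post t \<omega> k) * indicator C (hist t \<omega>) = ennreal (indicator A \<omega> * (indicator ?D \<omega> * post t \<omega> k))"
          using mem[OF \<omega>] \<omega> by (auto simp: indicator_def)
      qed
      finally have eq: "(\<integral>\<^sup>+\<omega>. ennreal (indicator A \<omega> * (indicator ?D \<omega> * indicator ?T \<omega>)) \<partial>M)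
        = (\<integral>\<^sup>+\<omega>. ennreal (indicator A \<omega> * (indicator ?D \<omega> * post t \<omega> k)) \<partial>M)" .
      have "(\<integral>\<omega>. indicator A \<omega> * (indicator ?D \<omega> * indicator ?T \<omega>) \<partial>M) = (\<integral>\<omega>. indicator A \<omega> * (indicator ?D \<omega> * post t \<omega> k) \<partial>M)"
        using AM post_bounds eq
        by (subst (1 2) integral_eq_nn_integral) (auto intro!: AE_I2)
      then show "(\<integral>\<omega>\<in>A. indicator ?D \<omega> * indicator ?T \<omega> \<partial>M) = (\<integral>\<omega>\<in>A. indicator ?D \<omega> * post t \<omega> k \<partial>M)"
        by (simp add: set_lebesgue_integral_def)
    qed
    moreover have "AE \<omega> in M. real_cond_exp M ?F (\<lambda>\<omega>. indicator ?D \<omega> * indicator ?T \<omega>) \<omega> = indicator ?D \<omega> * W M \<nu> \<tau> X S k t \<omega>"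
      unfolding W_def by (rule F.real_cond_exp_mult) (use D int1 in auto)
    ultimately show ?thesis using AE_space
      by eventually_elim (auto simp: indicator_def split: if_splits)
  qed
  then have "AE \<omega> in M. \<forall>k\<in>{1..K}. k \<in> S t \<omega> \<longrightarrow> W M \<nu> \<tau> X S k t \<omega> = post t \<omega> k"
    by (intro AE_finite_allI) auto
  then show ?thesis using AE_space
    by eventually_elim (use st.proc_subset[OF S t] in blast)
qed

end

context change_densities
begin

lemma val_cong: "finite A \<Longrightarrow> (\<And>i. i \<in> A \<Longrightarrow> u i = v i) \<Longrightarrow> val \<alpha> n A u = val \<alpha> n A v"
  by (intro antisym val_mono[where \<sigma> = id]) auto

lemma expect_cong: "(\<And>i. i \<in> B \<Longrightarrow> u i = v i) \<Longrightarrow> expect H B u = expect H B v"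
proof -
  assume *: "\<And>i. i \<in> B \<Longrightarrow> u i = v i"
  then have "upds B u = upds B v" by (auto simp: upds_def fun_eq_iff)
  moreover have "PiM B (\<lambda>i. law (u i)) = PiM B (\<lambda>i. law (v i))" by (rule PiM_cong) (simp_all add: *)
  ultimately show ?thesis by (simp add: expect_def)
qed

end

section \<open>Expected utilization along a procedure\<close>

context geometric_streams
begin

text \<open>Expected utilization up to time \<open>t\<close> if the active sets are those of \<open>S\<close> up to time \<open>s\<close> and
  are chosen optimally afterwards.\<close>

definition worth :: "real \<Rightarrow> (nat \<Rightarrow> 'w \<Rightarrow> nat set) \<Rightarrow> nat \<Rightarrow> nat \<Rightarrow> ennreal" where
  "worth \<alpha> S t s = (\<integral>\<^sup>+\<omega>. (\<Sum>r\<in>{1..s}. of_nat (card (S r \<omega>))) + val \<alpha> (t - s) (S s \<omega>) (post s \<omega>) \<partial>M)"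

lemma card_measurable:
  assumes "is_proc M \<nu> K X S" "1 \<le> s"
  shows "(\<lambda>\<omega>. of_nat (card (S s \<omega>)) :: ennreal) \<in> borel_measurable M"
  by (rule measurable_compose[OF st.proc_measurable_M[OF assms]]) simp

lemma selected_measurable:
  assumes "is_proc M \<nu> K X S" "1 \<le> s"
    and "\<And>B. B \<subseteq> {1..K} \<Longrightarrow> (\<lambda>\<omega>. h B \<omega>) \<in> borel_measurable M"
  shows "(\<lambda>\<omega>. h (S s \<omega>) \<omega> :: ennreal) \<in> borel_measurable M"
  by (rule measurable_compose_countable'[OF _ st.proc_measurable_M[OF assms(1,2)]])
    (use assms(3) in \<open>auto intro: countable_finite\<close>)

lemma val_post_measurable: "finite B \<Longrightarrow> (\<lambda>\<omega>. val \<alpha> n B (post s \<omega>)) \<in> borel_measurable M"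
  by (rule measurable_compose[OF post_measurable val_measurable])

lemma expect_post_measurable: "finite B \<Longrightarrow> (\<lambda>\<omega>. expect (val \<alpha> n B) B (post s \<omega>)) \<in> borel_measurable M"
  by (rule measurable_compose[OF post_measurable expect_measurable[OF _ val_measurable]])

lemma finite_active: "B \<subseteq> {1..K} \<Longrightarrow> finite B"
  by (rule finite_subset[OF _ finite_atLeastAtMost])

text \<open>The next active set takes finitely many values, each on an event decided by time s. On
  each such event \<open>transition_law\<close> applies with its indicator as
  \<open>u\<close>.\<close>

lemma expect_step:
  assumes S: "is_proc M \<nu> K X S" and s: "1 \<le> s"
  shows "(\<integral>\<^sup>+\<omega>. expect (val \<alpha> n (S (Suc s) \<omega>)) (S (Suc s) \<omega>) (post s \<omega>) \<partial>M)
    = (\<integral>\<^sup>+\<omega>. val \<alpha> n (S (Suc s) \<omega>) (post (Suc s) \<omega>) \<partial>M)"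
proof -
  let ?E = "\<lambda>B. {\<omega>\<in>space M. S (Suc s) \<omega> = B}"
  have E: "?E B \<in> sets (filt M \<nu> X S s)" for B
    by (rule st.proc_event[OF S]) (use s in auto)
  have EM[measurable]: "?E B \<in> sets M" for B
    using E[of B] st.filt_subalgebra[OF S, of s] by (auto simp: subalgebra_def)
  have split: "(\<integral>\<^sup>+\<omega>. h (S (Suc s) \<omega>) \<omega> \<partial>M) = (\<Sum>B\<in>Pow {1..K}. \<integral>\<^sup>+\<omega>. indicator (?E B) \<omega> * h B \<omega> \<partial>M)"
    if h: "\<And>B. B \<subseteq> {1..K} \<Longrightarrow> h B \<in> borel_measurable M" for h :: "nat set \<Rightarrow> 'w \<Rightarrow> ennreal"
  proof -
    have "(\<integral>\<^sup>+\<omega>. h (S (Suc s) \<omega>) \<omega> \<partial>M) = (\<integral>\<^sup>+\<omega>. (\<Sum>B\<in>Pow {1..K}. indicator (?E B) \<omega> * h B \<omega>) \<partial>M)"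
    proof (rule nn_integral_cong)
      fix \<omega> assume \<omega>: "\<omega> \<in> space M"
      have "(\<Sum>B\<in>Pow {1..K}. indicator (?E B) \<omega> * h B \<omega>) = (\<Sum>B\<in>Pow {1..K}. if S (Suc s) \<omega> = B then h B \<omega> else 0)"
        using \<omega> by (intro sum.cong refl) (simp add: indicator_def)
      also have "\<dots> = h (S (Suc s) \<omega>) \<omega>"
        using st.proc_subset[OF S _ \<omega>, of "Suc s"] by (simp add: sum.delta')
      finally show "h (S (Suc s) \<omega>) \<omega> = (\<Sum>B\<in>Pow {1..K}. indicator (?E B) \<omega> * h B \<omega>)" by simp
    qed
    also have "\<dots> = (\<Sum>B\<in>Pow {1..K}. \<integral>\<^sup>+\<omega>. indicator (?E B) \<omega> * h B \<omega> \<partial>M)"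
    proof (rule nn_integral_sum)
      fix B assume "B \<in> Pow {1..K}"
      then have [measurable]: "h B \<in> borel_measurable M" using h by simp
      show "(\<lambda>\<omega>. indicator (?E B) \<omega> * h B \<omega>) \<in> borel_measurable M" by measurable
    qed
    finally show ?thesis .
  qed
  have "(\<integral>\<^sup>+\<omega>. expect (val \<alpha> n (S (Suc s) \<omega>)) (S (Suc s) \<omega>) (post s \<omega>) \<partial>M)
    = (\<Sum>B\<in>Pow {1..K}. \<integral>\<^sup>+\<omega>. indicator (?E B) \<omega> * expect (val \<alpha> n B) B (post s \<omega>) \<partial>M)"
    by (rule split[of "\<lambda>B \<omega>. expect (val \<alpha> n B) B (post s \<omega>)"]) (intro expect_post_measurable finite_active)
  also have "\<dots> = (\<Sum>B\<in>Pow {1..K}. \<integral>\<^sup>+\<omega>. indicator (?E B) \<omega> * val \<alpha> n B (post (Suc s) \<omega>) \<partial>M)"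
  proof (rule sum.cong[OF refl])
    fix B assume "B \<in> Pow {1..K}"
    then have B: "B \<subseteq> {1..K}" and finB: "finite B" using finite_active by auto
    obtain C where C: "C \<in> sets (hist_space s)" "?E B = hist s -` C \<inter> space M"
      using filt_hist[OF S E[of B]] by blast
    have ind: "indicator (?E B) \<omega> = (indicator C (hist s \<omega>) :: ennreal)" if "\<omega> \<in> space M" for \<omega>
      unfolding C(2) using that by (simp add: indicator_def)
    have cm: "indicator C \<in> borel_measurable (hist_space s)" using C(1) by simp
    have "(\<integral>\<^sup>+\<omega>. indicator (?E B) \<omega> * expect (val \<alpha> n B) B (post s \<omega>) \<partial>M)
      = (\<integral>\<^sup>+\<omega>. indicator C (hist s \<omega>) * expect (val \<alpha> n B) B (post s \<omega>) \<partial>M)"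
      by (rule nn_integral_cong) (simp only: ind)
    also have "\<dots> = (\<integral>\<^sup>+\<omega>. indicator C (hist s \<omega>) * val \<alpha> n B (\<lambda>i. if i \<in> B then post (Suc s) \<omega> i else 0) \<partial>M)"
      by (rule transition_law[OF cm val_measurable[OF finB] B, symmetric])
    also have "\<dots> = (\<integral>\<^sup>+\<omega>. indicator (?E B) \<omega> * val \<alpha> n B (post (Suc s) \<omega>) \<partial>M)"
      by (intro nn_integral_cong arg_cong2[where f = "(*)"] val_cong finB) (simp_all only: ind if_True)
    finally show "(\<integral>\<^sup>+\<omega>. indicator (?E B) \<omega> * expect (val \<alpha> n B) B (post s \<omega>) \<partial>M)
      = (\<integral>\<^sup>+\<omega>. indicator (?E B) \<omega> * val \<alpha> n B (post (Suc s) \<omega>) \<partial>M)" .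
  qed
  also have "\<dots> = (\<integral>\<^sup>+\<omega>. val \<alpha> n (S (Suc s) \<omega>) (post (Suc s) \<omega>) \<partial>M)"
    by (rule split[of "\<lambda>B \<omega>. val \<alpha> n B (post (Suc s) \<omega>)", symmetric]) (intro val_post_measurable finite_active)
  finally show ?thesis .
qed

text \<open>Expresses the worth at \<open>Suc s\<close> by posteriors at time s, so that it can be
  compared with the worth at s inside one integral.\<close>

lemma worth_Suc:
  assumes S: "is_proc M \<nu> K X S" and s: "1 \<le> s"
  shows "worth \<alpha> S t (Suc s) = (\<integral>\<^sup>+\<omega>. (\<Sum>r\<in>{1..s}. of_nat (card (S r \<omega>))) + (of_nat (card (S (Suc s) \<omega>))
    + expect (val \<alpha> (t - Suc s) (S (Suc s) \<omega>)) (S (Suc s) \<omega>) (post s \<omega>)) \<partial>M)"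
proof -
  have [measurable]: "(\<lambda>\<omega>. \<Sum>r\<in>{1..Suc s}. of_nat (card (S r \<omega>)) :: ennreal) \<in> borel_measurable M"
    by (intro borel_measurable_sum card_measurable[OF S]) simp
  have [measurable]: "(\<lambda>\<omega>. val \<alpha> n (S (Suc s) \<omega>) (post (Suc s) \<omega>)) \<in> borel_measurable M"
    "(\<lambda>\<omega>. expect (val \<alpha> n (S (Suc s) \<omega>)) (S (Suc s) \<omega>) (post s \<omega>)) \<in> borel_measurable M" for n
    by (rule selected_measurable[OF S], simp, intro val_post_measurable expect_post_measurable finite_active, assumption)+
  let ?c = "\<lambda>\<omega>. \<Sum>r\<in>{1..Suc s}. of_nat (card (S r \<omega>)) :: ennreal"
  have "worth \<alpha> S t (Suc s) = (\<integral>\<^sup>+\<omega>. ?c \<omega> \<partial>M) + (\<integral>\<^sup>+\<omega>. val \<alpha> (t - Suc s) (S (Suc s) \<omega>) (post (Suc s) \<omega>) \<partial>M)"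
    unfolding worth_def by (rule nn_integral_add) measurable
  also have "\<dots> = (\<integral>\<^sup>+\<omega>. ?c \<omega> + expect (val \<alpha> (t - Suc s) (S (Suc s) \<omega>)) (S (Suc s) \<omega>) (post s \<omega>) \<partial>M)"
    unfolding expect_step[OF S s, symmetric] by (rule nn_integral_add[symmetric]) measurable
  finally show ?thesis by (simp add: add.assoc)
qed

lemma worth_Suc_le:
  assumes S: "is_proc M \<nu> K X S" and s: "1 \<le> s" "s < t" and \<alpha>: "0 \<le> \<alpha>"
    and feas: "AE \<omega> in M. LFNR M \<nu> \<tau> X S s \<omega> \<le> \<alpha>"
  shows "worth \<alpha> S t (Suc s) \<le> worth \<alpha> S t s"
  unfolding worth_Suc[OF S s(1)] unfolding worth_def
proof (rule nn_integral_mono_AE)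
  have n: "t - s = Suc (t - Suc s)" using s by simp
  have "AE \<omega> in M. (\<Sum>k\<in>S (Suc s) \<omega>. W M \<nu> \<tau> X S k s \<omega>) \<le> \<alpha> * real (card (S (Suc s) \<omega>))"
    using feas st.LFNR_le_iff[OF S s(1) \<alpha>] by simp
  then show "AE \<omega> in M. (\<Sum>r\<in>{1..s}. of_nat (card (S r \<omega>))) + (of_nat (card (S (Suc s) \<omega>))
      + expect (val \<alpha> (t - Suc s) (S (Suc s) \<omega>)) (S (Suc s) \<omega>) (post s \<omega>))
    \<le> (\<Sum>r\<in>{1..s}. of_nat (card (S r \<omega>))) + val \<alpha> (t - s) (S s \<omega>) (post s \<omega>)"
    using W_eq_post[OF S s(1)] AE_space
  proof eventually_elim
    case (elim \<omega>)
    have sub: "S (Suc s) \<omega> \<subseteq> S s \<omega>" using st.proc_antimono[OF S s(1) _ elim(3), of "Suc s"] by simp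
    have "(\<Sum>k\<in>S (Suc s) \<omega>. post s \<omega> k) = (\<Sum>k\<in>S (Suc s) \<omega>. W M \<nu> \<tau> X S k s \<omega>)"
      by (rule sum.cong) (use elim(2) sub in auto)
    then show ?case
      unfolding n by (intro add_left_mono val_ge_step[OF sub]) (use elim(1) in simp)
  qed
qed

lemma worth_Suc_onestep:
  assumes S: "is_proc M \<nu> K X S" and s: "1 \<le> s" "s < t" and \<alpha>: "0 \<le> \<alpha>"
    and step: "AE \<omega> in M. S (Suc s) \<omega> = onestep \<alpha> (S s \<omega>) (\<lambda>k. W M \<nu> \<tau> X S k s \<omega>)"
  shows "worth \<alpha> S t (Suc s) = worth \<alpha> S t s"
  unfolding worth_Suc[OF S s(1)] unfolding worth_def
proof (rule nn_integral_cong_AE)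
  have n: "t - s = Suc (t - Suc s)" using s by simp
  show "AE \<omega> in M. (\<Sum>r\<in>{1..s}. of_nat (card (S r \<omega>))) + (of_nat (card (S (Suc s) \<omega>))
      + expect (val \<alpha> (t - Suc s) (S (Suc s) \<omega>)) (S (Suc s) \<omega>) (post s \<omega>))
    = (\<Sum>r\<in>{1..s}. of_nat (card (S r \<omega>))) + val \<alpha> (t - s) (S s \<omega>) (post s \<omega>)"
    using step W_eq_post[OF S s(1)] AE_space
  proof eventually_elim
    case (elim \<omega>)
    define w where "w = (\<lambda>k. W M \<nu> \<tau> X S k s \<omega>)"
    have fin: "finite (S s \<omega>)" by (rule st.proc_finite[OF S s(1) elim(3)])
    have S': "S (Suc s) \<omega> = onestep \<alpha> (S s \<omega>) w" using elim(1) by (simp add: w_def)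
    have sub: "S (Suc s) \<omega> \<subseteq> S s \<omega>" unfolding S' by (rule onestep_subset[OF fin])
    have eq: "post s \<omega> k = w k" if "k \<in> S s \<omega>" for k using elim(2) that by (simp add: w_def)
    \<comment> \<open>The rule acts on \<open>w\<close>, which agrees with \<open>post\<close> only
      on the active set. Since \<open>val\<close> and \<open>expect\<close> read no other
      coordinates, \<open>w\<close> may replace \<open>post\<close> and be replaced back.\<close>
    have "val \<alpha> (t - s) (S s \<omega>) (post s \<omega>) = val \<alpha> (Suc (t - Suc s)) (S s \<omega>) w"
      unfolding n by (rule val_cong[OF fin eq])
    also have "\<dots> = of_nat (card (S (Suc s) \<omega>)) + expect (val \<alpha> (t - Suc s) (S (Suc s) \<omega>)) (S (Suc s) \<omega>) w"
      unfolding S' by (rule val_onestep[OF fin \<alpha>])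
    also have "expect (val \<alpha> (t - Suc s) (S (Suc s) \<omega>)) (S (Suc s) \<omega>) w
      = expect (val \<alpha> (t - Suc s) (S (Suc s) \<omega>)) (S (Suc s) \<omega>) (post s \<omega>)"
      by (rule expect_cong) (use eq sub in auto)
    finally show ?case by simp
  qed
qed

lemma worth_antimono:
  assumes T: "in_T_alpha M \<nu> K \<tau> X \<alpha> S" and \<alpha>: "0 \<le> \<alpha>" and s: "1 \<le> s" "s \<le> s'" "s' \<le> t"
  shows "worth \<alpha> S t s' \<le> worth \<alpha> S t s"
  using s(2,3)
proof (induction s' rule: dec_induct)
  case (step n)
  have "worth \<alpha> S t (Suc n) \<le> worth \<alpha> S t n"
    by (rule worth_Suc_le) (use T \<alpha> step s(1) in \<open>auto simp: in_T_alpha_def\<close>)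
  then show ?case using step by simp
qed simp

lemma worth_constant:
  assumes S: "is_proc M \<nu> K X S" and \<alpha>: "0 \<le> \<alpha>" and s: "1 \<le> s" "s \<le> s'" "s' \<le> t"
    and step: "\<And>r. s \<le> r \<Longrightarrow> AE \<omega> in M. S (Suc r) \<omega> = onestep \<alpha> (S r \<omega>) (\<lambda>k. W M \<nu> \<tau> X S k r \<omega>)"
  shows "worth \<alpha> S t s' = worth \<alpha> S t s"
  using s(2,3)
proof (induction s' rule: dec_induct)
  case (step n)
  have "worth \<alpha> S t (Suc n) = worth \<alpha> S t n"
    by (rule worth_Suc_onestep) (use S \<alpha> step s(1) assms(6) in auto)
  then show ?case using step by simp
qed simp

lemma worth_agree:
  assumes "1 \<le> s" "\<And>r \<omega>. 1 \<le> r \<Longrightarrow> r \<le> s \<Longrightarrow> \<omega> \<in> space M \<Longrightarrow> S r \<omega> = S' r \<omega>"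
  shows "worth \<alpha> S t s = worth \<alpha> S' t s"
  unfolding worth_def
  by (intro nn_integral_cong arg_cong2[where f = "(+)"] sum.cong) (use assms in auto)

text \<open>At s = t no step remains and \<open>val\<close> is 0.\<close>

lemma worth_EU:
  assumes S: "is_proc M \<nu> K X S" shows "worth \<alpha> S t t = ennreal (EU M S t)"
proof -
  have m: "(\<lambda>\<omega>. \<Sum>s\<in>{1..t}. real (card (S s \<omega>))) \<in> borel_measurable M"
    by (intro borel_measurable_sum measurable_compose[OF st.proc_measurable_M[OF S]]) simp_all
  have "integrable M (\<lambda>\<omega>. \<Sum>s\<in>{1..t}. real (card (S s \<omega>)))"
  proof (rule obs.integrable_const_bound[where B = "real t * real K"])
    show "AE \<omega> in M. norm (\<Sum>s\<in>{1..t}. real (card (S s \<omega>))) \<le> real t * real K"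
    proof (rule AE_I2)
      fix \<omega> assume \<omega>: "\<omega> \<in> space M"
      have "real (card (S s \<omega>)) \<le> real K" if "s \<in> {1..t}" for s
        using card_mono[OF _ st.proc_subset[OF S _ \<omega>, of s]] that by simp
      then have "(\<Sum>s\<in>{1..t}. real (card (S s \<omega>))) \<le> real t * real K"
        using sum_bounded_above[of "{1..t}" "\<lambda>s. real (card (S s \<omega>))" "real K"] by simp
      then show "norm (\<Sum>s\<in>{1..t}. real (card (S s \<omega>))) \<le> real t * real K"
        by (simp add: sum_nonneg)
    qed
  qed (rule m)
  then have "(\<integral>\<^sup>+\<omega>. ennreal (\<Sum>s\<in>{1..t}. real (card (S s \<omega>))) \<partial>M) = ennreal (EU M S t)"
    unfolding EU_def by (rule nn_integral_eq_integral) (intro AE_I2 sum_nonneg, simp)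
  moreover have "ennreal (\<Sum>s\<in>{1..t}. real (card (S s \<omega>))) = (\<Sum>s\<in>{1..t}. of_nat (card (S s \<omega>)))" for \<omega>
    by (simp add: ennreal_of_nat_eq_real_of_nat)
  ultimately show ?thesis by (simp add: worth_def)
qed

lemma EU_mono_worth:
  assumes "worth \<alpha> S t t \<le> worth \<alpha> S' t t" "is_proc M \<nu> K X S" "is_proc M \<nu> K X S'"
  shows "EU M S t \<le> EU M S' t"
proof -
  have "0 \<le> EU M S' t" unfolding EU_def by (rule Bochner_Integration.integral_nonneg) (simp add: sum_nonneg)
  then show ?thesis using assms by (simp add: worth_EU)
qed

text \<open>The rule is in force from \<open>max t0 1\<close> on, so the worth is constant from
  there; at that time the sets are still those of \<open>SA\<close>. For t0 = 0 this holds since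
  every procedure starts with all streams. The minimum covers horizons before the switch.\<close>

lemma switching_worth:
  assumes \<alpha>: "0 \<le> \<alpha>" and t: "1 \<le> t" and A: "is_proc M \<nu> K X SA" and G: "is_switching M \<nu> K \<tau> X \<alpha> SA t0 S"
  shows "worth \<alpha> S t t = worth \<alpha> SA t (min t (max t0 1))"
proof -
  let ?m = "min t (max t0 1)"
  have S: "is_proc M \<nu> K X S" using G by (simp add: is_switching_def)
  have "worth \<alpha> S t t = worth \<alpha> S t ?m"
  proof (cases "t \<le> max t0 1")
    case False
    then have m: "?m = max t0 1" by simp
    show ?thesis unfolding m
      by (rule worth_constant[OF S \<alpha>]) (use False G in \<open>auto simp: is_switching_def\<close>)
  qed (simp add: min_def)
  also have "\<dots> = worth \<alpha> SA t ?m"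
  proof (rule worth_agree)
    fix r \<omega> assume r: "1 \<le> r" "r \<le> ?m" and \<omega>: "\<omega> \<in> space M"
    show "S r \<omega> = SA r \<omega>"
    proof (cases "r = 1")
      case True
      then show ?thesis using st.proc_first[OF S \<omega>] st.proc_first[OF A \<omega>] by simp
    next
      case False
      then have "r \<le> t0" using r by auto
      then show ?thesis using G r \<omega> by (simp add: is_switching_def)
    qed
  qed (use t in auto)
  finally show ?thesis .
qed

lemma switching_EU:
  assumes \<alpha>: "0 \<le> \<alpha>" and t: "1 \<le> t" and A: "in_T_alpha M \<nu> K \<tau> X \<alpha> SA"
    and G0: "is_switching M \<nu> K \<tau> X \<alpha> SA t0 SG0"
    and G1: "is_switching M \<nu> K \<tau> X \<alpha> SA (Suc t0) SG1"
    and star: "is_Tstar M \<nu> K \<tau> X \<alpha> Sstar"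
  shows "EU M SA t \<le> EU M SG1 t \<and> EU M SG1 t \<le> EU M SG0 t \<and> EU M SG0 t \<le> EU M Sstar t"
proof -
  have pA: "is_proc M \<nu> K X SA" using A by (simp add: in_T_alpha_def)
  have p: "is_proc M \<nu> K X SG0" "is_proc M \<nu> K X SG1" "is_proc M \<nu> K X Sstar"
    using G0 G1 star by (simp_all add: is_switching_def is_Tstar_def)
  \<comment> \<open>For switching time 0 agreement with \<open>SA\<close> is required at no time, so
    \<open>Sstar\<close> is such a procedure for every \<open>SA\<close>.\<close>
  have "is_switching M \<nu> K \<tau> X \<alpha> SA 0 Sstar" using star by (simp add: is_switching_def is_Tstar_def)
  note w = switching_worth[OF \<alpha> t pA G0] switching_worth[OF \<alpha> t pA G1] switching_worth[OF \<alpha> t pA this]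
  note mono = worth_antimono[OF A \<alpha>]
  \<comment> \<open>All four values are worths of \<open>SA\<close>, at the decreasing times t,
    \<open>min t (max (Suc t0) 1)\<close>, \<open>min t (max t0 1)\<close> and
    \<open>min t 1\<close>.\<close>
  have "worth \<alpha> SA t t \<le> worth \<alpha> SG1 t t" "worth \<alpha> SG1 t t \<le> worth \<alpha> SG0 t t"
    "worth \<alpha> SG0 t t \<le> worth \<alpha> Sstar t t"
    unfolding w by (rule mono; use t in auto)+
  then show ?thesis using EU_mono_worth pA p by blast
qed

end

section \<open>The theorem\<close>

lemma streams_cp_model: "cp_model M N K \<tau> X p q \<Longrightarrow> streams M N K \<tau> X"
  unfolding cp_model_def streams_def streams_axioms_def by blast

text \<open>Allows the baseline measure to be exchanged: it enters a filtration only through its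
  measurable sets.\<close>

lemma filt_sets_cong: "sets N = sets N' \<Longrightarrow> filt M N X S t = filt M N' X S t"
  by (simp add: filt_def filt_gen_def)

text \<open>The baseline measure need not be \<open>\<sigma>\<close>-finite; the average of the two observation laws is
  a probability measure that dominates both.\<close>

lemma geometric_streams_model_s:
  assumes model: "cp_model M N K \<tau> X p q" and ms: "model_s M K \<tau> p q \<theta> p0 q0"
  defines "m \<equiv> \<lambda>x. (p0 x + q0 x) / 2"
  shows "geometric_streams (density N (\<lambda>x. ennreal (m x))) (\<lambda>x. p0 x / m x) (\<lambda>x. q0 x / m x) \<theta> M K \<tau> X"
proof -
  let ?\<nu> = "density N (\<lambda>x. ennreal (m x))" and ?f = "\<lambda>x. p0 x / m x" and ?g = "\<lambda>x. q0 x / m x"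
  interpret M: prob_space M using model by (simp add: cp_model_def)
  have K: "1 \<le> K" and tau: "\<And>k. k \<in> {1..K} \<Longrightarrow> \<tau> k \<in> measurable M (count_space UNIV)"
    and X: "\<And>k t. k \<in> {1..K} \<Longrightarrow> 1 \<le> t \<Longrightarrow> X k t \<in> measurable M N"
    using model unfolding cp_model_def by blast+
  have \<theta>: "0 < \<theta>" "\<theta> < 1"
    and prior: "\<And>v :: nat \<Rightarrow> nat. measure M {\<omega>\<in>space M. \<forall>k\<in>{1..K}. \<tau> k \<omega> = enat (v k)} = (\<Prod>k\<in>{1..K}. \<theta> * (1 - \<theta>) ^ v k)"
    and pq: "\<And>k t. k \<in> {1..K} \<Longrightarrow> 1 \<le> t \<Longrightarrow> p k t = p0 \<and> q k t = q0"
    using ms unfolding model_s_def by blast+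
  have "p 1 1 \<in> borel_measurable N \<and> (\<forall>x\<in>space N. p 1 1 x \<ge> 0) \<and> (\<integral>\<^sup>+ x. ennreal (p 1 1 x) \<partial>N) = 1 \<and>
      q 1 1 \<in> borel_measurable N \<and> (\<forall>x\<in>space N. q 1 1 x \<ge> 0) \<and> (\<integral>\<^sup>+ x. ennreal (q 1 1 x) \<partial>N) = 1"
    using model K unfolding cp_model_def by simp
  moreover have "p 1 1 = p0" "q 1 1 = q0" using pq[of 1 1] K by simp_all
  ultimately have [measurable]: "p0 \<in> borel_measurable N" "q0 \<in> borel_measurable N"
    and nn: "\<And>x. x \<in> space N \<Longrightarrow> 0 \<le> p0 x" "\<And>x. x \<in> space N \<Longrightarrow> 0 \<le> q0 x"
    and one: "(\<integral>\<^sup>+ x. ennreal (p0 x) \<partial>N) = 1" "(\<integral>\<^sup>+ x. ennreal (q0 x) \<partial>N) = 1"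
    by simp_all
  have mm[measurable]: "m \<in> borel_measurable N" unfolding m_def by measurable
  \<comment> \<open>Where \<open>m\<close> vanishes both densities vanish, so the quotients, which
    are 0 there, still recover them.\<close>
  have mf: "ennreal (m x) * ennreal (?f x) = ennreal (p0 x)" "ennreal (m x) * ennreal (?g x) = ennreal (q0 x)"
    if x: "x \<in> space N" for x
  proof -
    have "m x = 0 \<Longrightarrow> p0 x = 0 \<and> q0 x = 0" "0 \<le> m x" using nn[OF x] by (auto simp: m_def)
    then show "ennreal (m x) * ennreal (?f x) = ennreal (p0 x)" "ennreal (m x) * ennreal (?g x) = ennreal (q0 x)"
      using nn[OF x] by (cases "m x = 0"; simp flip: ennreal_mult)+
  qed
  have df: "density ?\<nu> (\<lambda>x. ennreal (?f x)) = density N (\<lambda>x. ennreal (p0 x))"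
    and dg: "density ?\<nu> (\<lambda>x. ennreal (?g x)) = density N (\<lambda>x. ennreal (q0 x))"
    by (subst density_density_eq; (intro density_cong)?; simp add: mf)+
  have prob: "prob_space ?\<nu>"
  proof (rule prob_spaceI)
    have "emeasure ?\<nu> (space ?\<nu>) = (\<integral>\<^sup>+x. ennreal (m x) \<partial>N)"
      by (simp add: emeasure_density cong: nn_integral_cong)
    also have "\<dots> = (\<integral>\<^sup>+x. (ennreal (p0 x) + ennreal (q0 x)) * ennreal (1/2) \<partial>N)"
    proof (rule nn_integral_cong)
      fix x assume x: "x \<in> space N"
      have "ennreal (m x) = ennreal ((p0 x + q0 x) * (1/2))" by (simp add: m_def)
      also have "\<dots> = ennreal (p0 x + q0 x) * ennreal (1/2)" by (rule ennreal_mult) (use nn[OF x] in auto)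
      finally show "ennreal (m x) = (ennreal (p0 x) + ennreal (q0 x)) * ennreal (1/2)"
        using nn[OF x] by simp
    qed
    also have "\<dots> = (1 + 1) * ennreal (1/2)"
      by (simp add: nn_integral_multc nn_integral_add one)
    also have "\<dots> = ennreal 2 * ennreal (1/2)" by simp
    also have "\<dots> = ennreal (2 * (1/2))" by (rule ennreal_mult[symmetric]) simp_all
    also have "\<dots> = 1" by simp
    finally show "emeasure ?\<nu> (space ?\<nu>) = 1" .
  qed
  have cd: "change_densities ?\<nu> ?f ?g \<theta>"
    unfolding change_densities_def change_densities_axioms_def
  proof (intro conjI allI impI prob \<theta>)
    show "(\<integral>\<^sup>+x. ennreal (?f x) \<partial>?\<nu>) = 1" "(\<integral>\<^sup>+x. ennreal (?g x) \<partial>?\<nu>) = 1"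
      by (subst nn_integral_density; simp add: mf one cong: nn_integral_cong)+
  qed (use nn in \<open>simp_all add: m_def\<close>)
  then interpret cd: change_densities ?\<nu> ?f ?g \<theta> .
  have dens: "density ?\<nu> (\<lambda>x. ennreal (cd.obs_density n t x))
      = density N (\<lambda>x. ennreal (if enat t \<le> enat n then p0 x else q0 x))" for n t
    by (cases "t \<le> n") (simp_all add: cd.obs_density_def df dg)
  \<comment> \<open>The model is stated with real-valued \<open>measure\<close>, the locale with
    \<open>emeasure\<close>; finiteness of these laws lets one pass between them.\<close>
  have dprob: "prob_space (density N (\<lambda>x. ennreal (if enat t \<le> enat n then p0 x else q0 x)))" for n t :: nat
    by (cases "t \<le> n"; rule prob_spaceI; simp add: emeasure_density one cong: nn_integral_cong)
  show ?thesis
  proof (intro geometric_streams.intro cd M.prob_space_axioms geometric_streams_axioms.intro)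
    fix k t :: nat assume "k \<in> {1..K}" "1 \<le> t"
    then show "X k t \<in> measurable M ?\<nu>" using X by simp
  next
    fix F :: "(nat \<times> nat) set" and B :: "nat \<times> nat \<Rightarrow> 'b set" and v :: "nat \<Rightarrow> nat"
    assume F: "finite F" "F \<subseteq> {1..K} \<times> {1..}" and B: "\<And>kt. kt \<in> F \<Longrightarrow> B kt \<in> sets ?\<nu>"
    let ?Q = "\<lambda>(k, t). density N (\<lambda>x. ennreal (if enat t \<le> enat (v k) then p0 x else q0 x))"
    have "measure M {\<omega>\<in>space M. (\<forall>k\<in>{1..K}. \<tau> k \<omega> = enat (v k)) \<and> (\<forall>(k, t)\<in>F. X k t \<omega> \<in> B (k, t))}
      = (\<Prod>k\<in>{1..K}. \<theta> * (1 - \<theta>) ^ v k) * (\<Prod>(k, t)\<in>F. measure (density N (\<lambda>x. ennreal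
          (if enat t \<le> enat (v k) then p k t x else q k t x))) (B (k, t)))"
    proof -
      have "\<forall>(v :: nat \<Rightarrow> enat) (F :: (nat \<times> nat) set) (B :: nat \<times> nat \<Rightarrow> 'b set).
        finite F \<longrightarrow> F \<subseteq> {1..K} \<times> {1..} \<longrightarrow> (\<forall>kt\<in>F. B kt \<in> sets N) \<longrightarrow>
        measure M {\<omega>\<in>space M. (\<forall>k\<in>{1..K}. \<tau> k \<omega> = v k) \<and> (\<forall>(k,t)\<in>F. X k t \<omega> \<in> B (k,t))}
        = measure M {\<omega>\<in>space M. \<forall>k\<in>{1..K}. \<tau> k \<omega> = v k} *
          (\<Prod>(k,t)\<in>F. measure (density N (\<lambda>x. ennreal (if enat t \<le> v k then p k t x else q k t x))) (B (k,t)))"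
        using model unfolding cp_model_def by blast
      from this[rule_format, of F B "\<lambda>k. enat (v k)"] show ?thesis using F B prior[of v] by simp
    qed
    also have "(\<Prod>(k, t)\<in>F. measure (density N (\<lambda>x. ennreal (if enat t \<le> enat (v k) then p k t x else q k t x))) (B (k, t)))
      = (\<Prod>kt\<in>F. measure (?Q kt) (B kt))"
    proof (intro prod.cong refl)
      fix kt assume kt: "kt \<in> F"
      obtain k t where eq: "kt = (k, t)" by (cases kt)
      have "p k t = p0 \<and> q k t = q0" using kt F(2) unfolding eq by (intro pq) auto
      then have pq': "p k t = p0" "q k t = q0" by simp_all
      show "(case kt of (k, t) \<Rightarrow> measure (density N (\<lambda>x. ennreal (if enat t \<le> enat (v k) then p k t x else q k t x))) (B (k, t)))
        = measure (?Q kt) (B kt)" unfolding eq prod.case pq' ..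
    qed
    finally have "emeasure M {\<omega>\<in>space M. (\<forall>k\<in>{1..K}. \<tau> k \<omega> = enat (v k)) \<and> (\<forall>(k, t)\<in>F. X k t \<omega> \<in> B (k, t))}
      = ennreal ((\<Prod>k\<in>{1..K}. \<theta> * (1 - \<theta>) ^ v k) * (\<Prod>kt\<in>F. measure (?Q kt) (B kt)))"
      by (simp add: M.emeasure_eq_measure)
    also have "\<dots> = (\<Prod>k\<in>{1..K}. ennreal (\<theta> * (1 - \<theta>) ^ v k)) * (\<Prod>kt\<in>F. ennreal (measure (?Q kt) (B kt)))"
    proof -
      have "(\<Prod>k\<in>{1..K}. ennreal (\<theta> * (1 - \<theta>) ^ v k)) = ennreal (\<Prod>k\<in>{1..K}. \<theta> * (1 - \<theta>) ^ v k)"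
        by (rule prod_ennreal) (use \<theta> in simp)
      moreover have "(\<Prod>kt\<in>F. ennreal (measure (?Q kt) (B kt))) = ennreal (\<Prod>kt\<in>F. measure (?Q kt) (B kt))"
        by (rule prod_ennreal) simp
      ultimately show ?thesis
        using \<theta> by (simp only:) (intro ennreal_mult prod_nonneg; simp)
    qed
    also have "(\<Prod>kt\<in>F. ennreal (measure (?Q kt) (B kt)))
      = (\<Prod>(k, t)\<in>F. emeasure (density ?\<nu> (\<lambda>x. ennreal (cd.obs_density (v k) t x))) (B (k, t)))"
    proof (intro prod.cong refl)
      fix kt assume "kt \<in> F"
      obtain k t where kt: "kt = (k, t)" by (cases kt)
      interpret Q: prob_space "density N (\<lambda>x. ennreal (if enat t \<le> enat (v k) then p0 x else q0 x))"
        by (rule dprob)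
      show "ennreal (measure (?Q kt) (B kt))
        = (case kt of (k, t) \<Rightarrow> emeasure (density ?\<nu> (\<lambda>x. ennreal (cd.obs_density (v k) t x))) (B (k, t)))"
        unfolding kt prod.case dens by (rule Q.emeasure_eq_measure[symmetric])
    qed
    finally show "emeasure M {\<omega>\<in>space M. (\<forall>k\<in>{1..K}. \<tau> k \<omega> = enat (v k)) \<and> (\<forall>(k, t)\<in>F. X k t \<omega> \<in> B (k, t))}
      = (\<Prod>k\<in>{1..K}. ennreal (\<theta> * (1 - \<theta>) ^ v k)) *
        (\<Prod>(k, t)\<in>F. emeasure (density ?\<nu> (\<lambda>x. ennreal (cd.obs_density (v k) t x))) (B (k, t)))" .
  qed (rule tau)
qed

theorem theorem5:
  fixes M :: "'w measure" and N :: "'x measure" and K :: nat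
    and \<tau> :: "nat \<Rightarrow> 'w \<Rightarrow> enat" and X :: "nat \<Rightarrow> nat \<Rightarrow> 'w \<Rightarrow> 'x"
    and p q :: "nat \<Rightarrow> nat \<Rightarrow> 'x \<Rightarrow> real" and \<alpha> :: real and t0 :: nat
    and SA SG0 SG1 :: "nat \<Rightarrow> 'w \<Rightarrow> nat set"
  assumes model: "cp_model M N K \<tau> X p q"
    and alpha: "0 < \<alpha>" "\<alpha> \<le> 1"
    and A: "in_T_alpha M N K \<tau> X \<alpha> SA"
    and G0: "is_switching M N K \<tau> X \<alpha> SA t0 SG0"
    and G1: "is_switching M N K \<tau> X \<alpha> SA (Suc t0) SG1"
  shows "in_T_alpha M N K \<tau> X \<alpha> SG0 \<and> in_T_alpha M N K \<tau> X \<alpha> SG1 \<and>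
    ((\<exists>\<theta> p0 q0. model_s M K \<tau> p q \<theta> p0 q0) \<longrightarrow>
      (\<forall>Sstar. is_Tstar M N K \<tau> X \<alpha> Sstar \<longrightarrow>
        (\<forall>t\<ge>1. EU M SA t \<le> EU M SG1 t \<and> EU M SG1 t \<le> EU M SG0 t \<and>
                EU M SG0 t \<le> EU M Sstar t)))"
proof (intro conjI impI)
  interpret st: streams M N K \<tau> X by (rule streams_cp_model[OF model])
  show "in_T_alpha M N K \<tau> X \<alpha> SG0" "in_T_alpha M N K \<tau> X \<alpha> SG1"
    using st.switching_in_T_alpha[OF _ A G0] st.switching_in_T_alpha[OF _ A G1] alpha by simp_all
  assume "\<exists>\<theta> p0 q0. model_s M K \<tau> p q \<theta> p0 q0"
  then obtain \<theta> p0 q0 where ms: "model_s M K \<tau> p q \<theta> p0 q0" by blast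
  let ?m = "\<lambda>x. (p0 x + q0 x) / 2"
  let ?\<nu> = "density N (\<lambda>x. ennreal (?m x))"
  interpret gs: geometric_streams ?\<nu> "\<lambda>x. p0 x / ?m x" "\<lambda>x. q0 x / ?m x" \<theta> M K \<tau> X
    by (rule geometric_streams_model_s[OF model ms])
  have F: "filt M N X S t = filt M ?\<nu> X S t" for S t by (rule filt_sets_cong) simp
  note transfer = F is_proc_def in_T_alpha_def is_switching_def is_Tstar_def LFNR_def W_def
  have A': "in_T_alpha M ?\<nu> K \<tau> X \<alpha> SA" using A unfolding transfer .
  have G0': "is_switching M ?\<nu> K \<tau> X \<alpha> SA t0 SG0" using G0 unfolding transfer .
  have G1': "is_switching M ?\<nu> K \<tau> X \<alpha> SA (Suc t0) SG1" using G1 unfolding transfer .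
  have star': "is_Tstar M ?\<nu> K \<tau> X \<alpha> Sstar" if "is_Tstar M N K \<tau> X \<alpha> Sstar" for Sstar
    using that unfolding transfer .
  show "\<forall>Sstar. is_Tstar M N K \<tau> X \<alpha> Sstar \<longrightarrow>
      (\<forall>t\<ge>1. EU M SA t \<le> EU M SG1 t \<and> EU M SG1 t \<le> EU M SG0 t \<and> EU M SG0 t \<le> EU M Sstar t)"
    using gs.switching_EU[OF less_imp_le[OF alpha(1)] _ A' G0' G1' star'] by blast
qed

end
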